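(* Let $n\ge 4$ be an even integer and let $u\in C^\infty(\mathbb{R}^n)$ be such that the conformal metric $g=e^{2u}|dx|^2$ on $\mathbb{R}^n$ is complete and has finite total Q-curvature, with Q-curvature $Q$ and scalar curvature $R_g$. (1) If $R_g\ge 0$ near infinity, then $$0\le \int_{\mathbb{R}^n}Qe^{nu}\,dx\le \frac{(n-1)!\,|\mathbb{S}^n|}{2}.$$ (2) If there are constants $C>0$ and $p\ge 0$ such that $R_g(x)\ge C|x|^{-p}$ near infinity, then $$\frac{(n-1)!\,|\mathbb{S}^n|}{2}\max\left\{0,1-\frac p2\right\}\le \int_{\mathbb{R}^n}Qe^{nu}\,dx\le \frac{(n-1)!\,|\mathbb{S}^n|}{2}.$$ In particular, if $R_g\ge C$ near infinity for some constant $C>0$, then $$\int_{\mathbb{R}^n}Qe^{nu}\,dx=\frac{(n-1)!\,|\mathbb{S}^n|}{2}.$$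
   Context: For a smooth function $u$ on $\mathbb{R}^n$ ($n\ge4$ even) and $g=e^{2u}|dx|^2$ (with $|dx|^2$ the Euclidean metric), the Q-curvature $Q$ of $g$ is the function defined by $(-\Delta)^{n/2}u=Qe^{nu}$, where $\Delta$ is the Euclidean Laplacian. The metric has finite total Q-curvature if $Qe^{nu}\in L^1(\mathbb{R}^n)$. The scalar curvature of $g$ is $R_g=2(n-1)e^{-2u}\left(-\Delta u-\frac{n-2}{2}|\nabla u|^2\right)$. "Near infinity" means outside some compact set. $|\mathbb{S}^n|$ is the volume of the standard unit $n$-sphere. *)

theory Defs
  imports "HOL-Analysis.Analysis"
begin

section \<open>Smooth functions and differential operators on Euclidean space\<close>

definition partial :: "'n \<Rightarrow> (real ^ 'n \<Rightarrow> real) \<Rightarrow> real ^ 'n::finite \<Rightarrow> real" where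
  "partial i f x = frechet_derivative f (at x) (axis i 1)"

primrec Ck :: "nat \<Rightarrow> (real ^ 'n::finite \<Rightarrow> real) \<Rightarrow> bool" where
  "Ck 0 f \<longleftrightarrow> continuous_on UNIV f"
| "Ck (Suc k) f \<longleftrightarrow> (\<forall>x. f differentiable (at x)) \<and> (\<forall>i. Ck k (partial i f))"

definition smooth :: "(real ^ 'n::finite \<Rightarrow> real) \<Rightarrow> bool" where
  "smooth f \<longleftrightarrow> (\<forall>k. Ck k f)"

definition gradient :: "(real ^ 'n::finite \<Rightarrow> real) \<Rightarrow> real ^ 'n \<Rightarrow> real ^ 'n" where
  "gradient f x = (\<chi> i. partial i f x)"

definition laplacian :: "(real ^ 'n::finite \<Rightarrow> real) \<Rightarrow> real ^ 'n \<Rightarrow> real" where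
  "laplacian f x = (\<Sum>i\<in>UNIV. partial i (partial i f) x)"

section \<open>The conformal metric $g = e^{2u} |dx|^2$\<close>

text \<open>
  The \<open>g\<close>-length of a piecewise \<open>C\<^sup>1\<close> curve is the integral of \<open>e\<^sup>u |\<gamma>'|\<close>. A library
  \<open>valid_path\<close> may have unbounded speed near its finitely many break points, so it need
  not be rectifiable. Stating the length as a relation, via \<open>has_integral\<close>, excludes the
  non-rectifiable curves; with \<open>integral\<close> they would count as curves of length 0.
\<close>

definition has_conf_length ::
    "(real ^ 'n \<Rightarrow> real) \<Rightarrow> (real \<Rightarrow> real ^ 'n::finite) \<Rightarrow> real \<Rightarrow> bool" where
  "has_conf_length u \<gamma> L \<longleftrightarrow>
     ((\<lambda>t. exp (u (\<gamma> t)) * norm (vector_derivative \<gamma> (at t))) has_integral L) {0..1}"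

definition conf_dist :: "(real ^ 'n \<Rightarrow> real) \<Rightarrow> real ^ 'n \<Rightarrow> real ^ 'n::finite \<Rightarrow> real" where
  "conf_dist u x y =
     Inf {L. \<exists>\<gamma>. valid_path \<gamma> \<and> pathstart \<gamma> = x \<and> pathfinish \<gamma> = y \<and> has_conf_length u \<gamma> L}"

text \<open>
  The constant \<open>mcomplete\<close> has its intended meaning only when the locale assumption holds;
  \<open>Metric_space_conf_dist\<close> below proves this for continuous \<open>u\<close>.
\<close>

definition conf_complete :: "(real ^ 'n::finite \<Rightarrow> real) \<Rightarrow> bool" where
  "conf_complete u \<longleftrightarrow> Metric_space.mcomplete UNIV (conf_dist u)"

definition Q_curvature :: "(real ^ 'n::finite \<Rightarrow> real) \<Rightarrow> real ^ 'n \<Rightarrow> real" where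
  "Q_curvature u x =
     ((\<lambda>f y. - laplacian f y) ^^ (CARD('n) div 2)) u x / exp (real CARD('n) * u x)"

definition finite_total_Q :: "(real ^ 'n::finite \<Rightarrow> real) \<Rightarrow> bool" where
  "finite_total_Q u \<longleftrightarrow> integrable lborel (\<lambda>x. Q_curvature u x * exp (real CARD('n) * u x))"

definition total_Q :: "(real ^ 'n::finite \<Rightarrow> real) \<Rightarrow> real" where
  "total_Q u = (\<integral>x. Q_curvature u x * exp (real CARD('n) * u x) \<partial>lborel)"

definition scalar_curvature :: "(real ^ 'n::finite \<Rightarrow> real) \<Rightarrow> real ^ 'n \<Rightarrow> real" where
  "scalar_curvature u x =
     2 * (real CARD('n) - 1) * exp (- 2 * u x) *
       (- laplacian u x - (real CARD('n) - 2) / 2 * (norm (gradient u x))\<^sup>2)"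

definition near_infinity :: "('a::topological_space \<Rightarrow> bool) \<Rightarrow> bool" where
  "near_infinity P \<longleftrightarrow> (\<exists>K. compact K \<and> (\<forall>x. x \<notin> K \<longrightarrow> P x))"

section \<open>The volume of the unit sphere\<close>

text \<open>
  The surface measure on the unit sphere, defined through polar coordinates: \<open>d\<close> times the
  Lebesgue measure of the cone over \<open>A\<close>, where \<open>d\<close> is the dimension of the ambient space.
\<close>

definition surface_measure :: "'a::euclidean_space set \<Rightarrow> real" where
  "surface_measure A = real DIM('a) * measure lborel {r *\<^sub>R a | r a. 0 < r \<and> r \<le> 1 \<and> a \<in> A}"

text \<open>
  The sphere \<open>S\<^sup>n\<close> is realised in the \<open>(n + 1)\<close>-dimensional Euclidean space \<open>\<real>\<^sup>n \<times> \<real>\<close>, whose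
  library norm is the Euclidean one; only \<open>n = CARD('n)\<close> matters.
\<close>

definition sphere_volume :: "'n::finite itself \<Rightarrow> real" where
  "sphere_volume _ = surface_measure (sphere (0 :: (real ^ 'n) \<times> real) 1)"

lemma surface_measure_sphere:
  "surface_measure (sphere (0::'a::euclidean_space) 1) = real DIM('a) * unit_ball_vol (real DIM('a))"
proof -
  have eq: "{r *\<^sub>R a | r a. 0 < r \<and> r \<le> 1 \<and> a \<in> sphere (0::'a) 1} = cball 0 1 - {0}"
  proof (intro set_eqI iffI)
    fix x :: 'a
    assume "x \<in> cball 0 1 - {0}"
    then have "x = norm x *\<^sub>R (x /\<^sub>R norm x)" "0 < norm x" "norm x \<le> 1" "x /\<^sub>R norm x \<in> sphere 0 1"
      by auto
    then show "x \<in> {r *\<^sub>R a | r a. 0 < r \<and> r \<le> 1 \<and> a \<in> sphere (0::'a) 1}" by blast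
  qed auto
  have "measure lborel (cball (0::'a) 1 - {0}) = measure lborel (cball (0::'a) 1)"
    by (rule measure_Diff_null_set) auto
  then show ?thesis
    unfolding surface_measure_def eq by (simp add: content_cball)
qed

lemma sphere_volume_closed_form:
  "sphere_volume TYPE('n::finite) =
     2 * pi powr ((real CARD('n) + 1) / 2) / Gamma ((real CARD('n) + 1) / 2)"
proof -
  define m where "m = (real CARD('n) + 1) / 2"
  have "m > 0" by (simp add: m_def add_nonneg_pos)
  then have "Gamma (m + 1) = m * Gamma m" "Gamma m > 0"
    by (auto simp: Gamma_plus1 Gamma_real_pos nonpos_Ints_def)
  moreover have "sphere_volume TYPE('n) = 2 * m * (pi powr m / Gamma (m + 1))"
  proof -
    have "real DIM((real ^ 'n) \<times> real) = 2 * m" by (simp add: m_def)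
    then show ?thesis
      unfolding sphere_volume_def surface_measure_sphere unit_ball_vol_def by simp
  qed
  ultimately show ?thesis using \<open>m > 0\<close> by (simp add: m_def[symmetric])
qed

section \<open>The conformal distance is a metric\<close>

lemma has_conf_length_nonneg: "has_conf_length u \<gamma> L \<Longrightarrow> 0 \<le> L"
  unfolding has_conf_length_def by (erule has_integral_nonneg) simp

lemma has_conf_length_reversepath:
  assumes "valid_path \<gamma>" "has_conf_length u \<gamma> L"
  shows "has_conf_length u (reversepath \<gamma>) L"
proof -
  obtain S where S: "finite S" "\<gamma> C1_differentiable_on {0..1} - S"
    using assms by (auto simp: valid_path_def piecewise_C1_differentiable_on_def)
  have d: "vector_derivative (\<lambda>x. \<gamma> (1 - x)) (at x) = - vector_derivative \<gamma> (at (1 - x))"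
    if "x \<in> {0..1} - (\<lambda>x. 1 - x) ` S" for x
  proof -
    have "1 - x \<in> {0..1} - S" using that by (auto simp: image_iff)
    then obtain f' where f': "(\<gamma> has_vector_derivative f') (at (1 - x))"
      using S(2) by (force simp: C1_differentiable_on_def)
    have "(\<gamma> \<circ> (\<lambda>x. 1 - x) has_vector_derivative -1 *\<^sub>R f') (at x)"
      by (intro vector_diff_chain_within has_vector_derivative_at_within [OF f'] derivative_eq_intros | simp)+
    then have "((\<lambda>x. \<gamma> (1 - x)) has_vector_derivative -f') (at x)" by (simp add: o_def)
    then show ?thesis using f' by (simp add: vector_derivative_at)
  qed
  have "((\<lambda>x. exp (u (\<gamma> (1 - x))) * norm (vector_derivative \<gamma> (at (1 - x)))) has_integral L) {0..1}"
    using has_integral_affinity01 [where m= "-1" and c=1, OF assms(2)[unfolded has_conf_length_def]]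
    by simp
  then show ?thesis
    unfolding has_conf_length_def reversepath_def
    by (rule has_integral_spike_finite[where S = "(\<lambda>x. 1 - x) ` S", rotated 2]) (use S d in auto)
qed

lemma has_conf_length_join:
  assumes "has_conf_length u g1 i1" "has_conf_length u g2 i2" "valid_path g1" "valid_path g2"
  shows "has_conf_length u (g1 +++ g2) (i1 + i2)"
proof -
  obtain s1 s2
    where s1: "finite s1" "\<forall>x\<in>{0..1} - s1. g1 differentiable at x"
      and s2: "finite s2" "\<forall>x\<in>{0..1} - s2. g2 differentiable at x"
    using assms
    by (auto simp: valid_path_def piecewise_C1_differentiable_on_def C1_differentiable_on_eq)
  note 1 = assms(1)[unfolded has_conf_length_def] and 2 = assms(2)[unfolded has_conf_length_def]
  have i1: "((\<lambda>x. (2*exp (u (g1 (2*x)))) * norm (vector_derivative g1 (at (2*x)))) has_integral i1) {0..1/2}"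
   and i2: "((\<lambda>x. (2*exp (u (g2 (2*x - 1)))) * norm (vector_derivative g2 (at (2*x - 1)))) has_integral i2) {1/2..1}"
    using has_integral_affinity01 [OF 1, where m= 2 and c=0, THEN has_integral_cmul [where c=2]]
          has_integral_affinity01 [OF 2, where m= 2 and c="-1", THEN has_integral_cmul [where c=2]]
    by (simp_all only: image_affinity_atLeastAtMost_div_diff, simp_all add: scaleR_conv_of_real mult_ac)
  have g1: "vector_derivative (\<lambda>x. if x*2 \<le> 1 then g1 (2*x) else g2 (2*x - 1)) (at z) =
            2 *\<^sub>R vector_derivative g1 (at (z*2))"
      if "0 \<le> z" "z*2 < 1" "z*2 \<notin> s1" for z
  proof (rule vector_derivative_at [OF has_vector_derivative_transform_within])
    show "0 < \<bar>z - 1/2\<bar>" using that by auto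
    have "((*) 2 has_vector_derivative 2) (at z)"
      by (simp add: has_vector_derivative_def has_derivative_def bounded_linear_mult_left)
    moreover have "(g1 has_vector_derivative vector_derivative g1 (at (z * 2))) (at (2 * z))"
      using s1 that by (auto simp: algebra_simps vector_derivative_works)
    ultimately
    show "((\<lambda>x. g1 (2 * x)) has_vector_derivative 2 *\<^sub>R vector_derivative g1 (at (z * 2))) (at z)"
      by (intro vector_diff_chain_at [simplified o_def])
  qed (use that in \<open>simp_all add: dist_real_def abs_if split: if_split_asm\<close>)
  have g2: "vector_derivative (\<lambda>x. if x*2 \<le> 1 then g1 (2*x) else g2 (2*x - 1)) (at z) =
            2 *\<^sub>R vector_derivative g2 (at (z*2 - 1))"
           if "1 < z*2" "z \<le> 1" "z*2 - 1 \<notin> s2" for z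
  proof (rule vector_derivative_at [OF has_vector_derivative_transform_within])
    show "0 < \<bar>z - 1/2\<bar>" using that by auto
    have "((\<lambda>x. 2 * x - 1) has_vector_derivative 2) (at z)"
      by (simp add: has_vector_derivative_def has_derivative_def bounded_linear_mult_left)
    moreover have "(g2 has_vector_derivative vector_derivative g2 (at (z * 2 - 1))) (at (2 * z - 1))"
      using s2 that by (auto simp: algebra_simps vector_derivative_works)
    ultimately
    show "((\<lambda>x. g2 (2 * x - 1)) has_vector_derivative 2 *\<^sub>R vector_derivative g2 (at (z * 2 - 1))) (at z)"
      by (intro vector_diff_chain_at [simplified o_def])
  qed (use that in \<open>simp_all add: dist_real_def abs_if split: if_split_asm\<close>)
  let ?F = "\<lambda>x. exp (u ((g1 +++ g2) x)) * norm (vector_derivative (g1 +++ g2) (at x))"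
  have "(?F has_integral i1) {0..1/2}"
  proof (rule has_integral_spike_finite [OF _ _ i1])
    show "finite (insert (1/2) ((*) 2 -` s1))"
      using s1 by (force intro: finite_vimageI [where h = "(*)2"] inj_onI)
  qed (auto simp add: joinpaths_def mult_ac g1)
  moreover have "(?F has_integral i2) {1/2..1}"
  proof (rule has_integral_spike_finite [OF _ _ i2])
    show "finite (insert (1/2) ((\<lambda>x. 2 * x - 1) -` s2))"
      using s2 by (force intro: finite_vimageI [where h = "\<lambda>x. 2*x-1"] inj_onI)
  qed (auto simp add: joinpaths_def mult_ac g2)
  ultimately show ?thesis
    unfolding has_conf_length_def by (simp add: has_integral_combine [where c = "1/2"])
qed

lemma has_conf_length_linepath:
  assumes "continuous_on UNIV u"
  shows "\<exists>L. has_conf_length u (linepath x y) L"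
proof -
  have "continuous_on {0..1} (\<lambda>t. exp (u (linepath x y t)) * norm (y - x))"
    by (intro continuous_intros continuous_on_compose2[OF assms]) auto
  then have "(\<lambda>t. exp (u (linepath x y t)) * norm (y - x)) integrable_on {0..1}"
    by (rule integrable_continuous_real)
  then show ?thesis by (auto simp: has_conf_length_def integrable_on_def)
qed

lemma conf_dist_le:
  assumes "valid_path \<gamma>" "has_conf_length u \<gamma> L"
  shows "conf_dist u (pathstart \<gamma>) (pathfinish \<gamma>) \<le> L"
  unfolding conf_dist_def
  by (rule cInf_lower) (use assms in \<open>auto intro!: bdd_belowI[of _ 0] dest: has_conf_length_nonneg\<close>)

lemma conf_dist_greatest:
  assumes "continuous_on UNIV u"
    and "\<And>\<gamma> L. valid_path \<gamma> \<Longrightarrow> pathstart \<gamma> = x \<Longrightarrow> pathfinish \<gamma> = y \<Longrightarrow> has_conf_length u \<gamma> L \<Longrightarrow> c \<le> L"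
  shows "c \<le> conf_dist u x y"
  unfolding conf_dist_def
proof (rule cInf_greatest)
  show "{L. \<exists>\<gamma>. valid_path \<gamma> \<and> pathstart \<gamma> = x \<and> pathfinish \<gamma> = y \<and> has_conf_length u \<gamma> L} \<noteq> {}"
    using has_conf_length_linepath[OF assms(1), of x y] valid_path_linepath by fastforce
qed (use assms(2) in auto)

lemma conf_dist_nonneg: "continuous_on UNIV u \<Longrightarrow> 0 \<le> conf_dist u x y"
  by (rule conf_dist_greatest) (auto dest: has_conf_length_nonneg)

lemma conf_dist_commute_le: 
  assumes "continuous_on UNIV u"
  shows "conf_dist u x y \<le> conf_dist u y x"
proof (rule conf_dist_greatest[OF assms])
  fix \<gamma> L assume "valid_path \<gamma>" "pathstart \<gamma> = y" "pathfinish \<gamma> = x" "has_conf_length u \<gamma> L"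
  then show "conf_dist u x y \<le> L"
    using conf_dist_le[of "reversepath \<gamma>" u L] has_conf_length_reversepath[of \<gamma> u L]
    by (simp add: valid_path_imp_reverse)
qed

lemma conf_dist_triangle:
  assumes "continuous_on UNIV u"
  shows "conf_dist u x z \<le> conf_dist u x y + conf_dist u y z"
proof -
  have "conf_dist u x z - conf_dist u y z \<le> conf_dist u x y"
  proof (rule conf_dist_greatest[OF assms])
    fix \<gamma>1 L1 assume 1: "valid_path \<gamma>1" "pathstart \<gamma>1 = x" "pathfinish \<gamma>1 = y" "has_conf_length u \<gamma>1 L1"
    have "conf_dist u x z - L1 \<le> conf_dist u y z"
    proof (rule conf_dist_greatest[OF assms])
      fix \<gamma>2 L2 assume 2: "valid_path \<gamma>2" "pathstart \<gamma>2 = y" "pathfinish \<gamma>2 = z" "has_conf_length u \<gamma>2 L2"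
      show "conf_dist u x z - L1 \<le> L2"
        using conf_dist_le[of "\<gamma>1 +++ \<gamma>2" u "L1 + L2"] has_conf_length_join[of u \<gamma>1 L1 \<gamma>2 L2] 1 2
        by (simp add: valid_path_join)
    qed
    then show "conf_dist u x z - conf_dist u y z \<le> L1" by simp
  qed
  then show ?thesis by simp
qed

lemma conf_dist_pos:
  assumes u: "continuous_on UNIV u" and "x \<noteq> y"
  shows "0 < conf_dist u x y"
proof -
  define r where "r = norm (y - x)"
  have r: "r > 0" using assms by (simp add: r_def)
  have "continuous_on (cball x r) (\<lambda>z. exp (u z))"
    by (intro continuous_intros continuous_on_subset[OF u]) auto
  then obtain z where z: "\<And>w. w \<in> cball x r \<Longrightarrow> exp (u z) \<le> exp (u w)"
    using continuous_attains_inf[of "cball x r" "\<lambda>z. exp (u z)"] r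
    by (metis cball_eq_empty compact_cball not_less_iff_gr_or_eq)
  define m where "m = exp (u z)"
  have m: "m > 0" by (simp add: m_def)
  have "m * r \<le> conf_dist u x y"
  proof (rule conf_dist_greatest[OF u])
    fix \<gamma> L assume \<gamma>: "valid_path \<gamma>" "pathstart \<gamma> = x" "pathfinish \<gamma> = y" "has_conf_length u \<gamma> L"
    let ?g = "\<lambda>t. exp (u (\<gamma> t)) * norm (vector_derivative \<gamma> (at t))"
    obtain S where S: "continuous_on {0..1} \<gamma>" "finite S" "\<gamma> C1_differentiable_on {0..1} - S"
      using \<gamma> by (auto simp: valid_path_def piecewise_C1_differentiable_on_def)
    have end01: "\<gamma> 0 = x" "\<gamma> 1 = y" using \<gamma> by (auto simp: pathstart_def pathfinish_def)
    define T where "T = {t \<in> {0..1}. dist x (\<gamma> t) \<in> {r..}}"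
    have "closed T" unfolding T_def
      by (rule continuous_closed_preimage[unfolded vimage_def Int_def, simplified mem_Collect_eq])
         (auto intro!: continuous_intros S)
    moreover have "bounded T" by (rule bounded_subset[of "{0..1}"]) (auto simp: T_def)
    ultimately have "compact T" by (simp add: compact_eq_bounded_closed)
    moreover have "1 \<in> T" by (auto simp: T_def end01 r_def dist_norm norm_minus_commute)
    ultimately obtain s where s: "s \<in> T" "\<And>t. t \<in> T \<Longrightarrow> s \<le> t"
      using compact_attains_inf[of T] by auto
    have s01: "0 \<le> s" "s \<le> 1" "r \<le> dist x (\<gamma> s)" using s(1) by (auto simp: T_def)
    have inball: "\<gamma> t \<in> cball x r" if "t \<in> {0..<s}" for t
      using that s(2)[of t] s01 by (force simp: T_def)
    have ftc: "((\<lambda>t. vector_derivative \<gamma> (at t)) has_integral (\<gamma> s - \<gamma> 0)) {0..s}"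
    proof (rule fundamental_theorem_of_calculus_interior_strong[OF S(2) s01(1)])
      show "continuous_on {0..s} \<gamma>" using s01 by (intro continuous_on_subset[OF S(1)]) auto
      fix t assume "t \<in> {0<..<s} - S"
      then show "(\<gamma> has_vector_derivative vector_derivative \<gamma> (at t)) (at t)"
        using S(3) s01 by (auto simp: C1_differentiable_on_eq vector_derivative_works[symmetric])
    qed
    have gint: "?g integrable_on {0..1}"
      using \<gamma>(4) by (auto simp: has_conf_length_def integrable_on_def)
    have gint': "?g integrable_on {0..s}"
      by (rule integrable_on_subinterval[OF gint]) (use s01 in auto)
    have spike: "((\<lambda>t. if t = s then 0 else vector_derivative \<gamma> (at t)) has_integral (\<gamma> s - \<gamma> 0)) {0..s}"
      by (rule has_integral_spike_finite[OF _ _ ftc, of "{s}"]) auto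
    have "norm (integral {0..s} (\<lambda>t. if t = s then 0 else vector_derivative \<gamma> (at t)))
            \<le> integral {0..s} (\<lambda>t. inverse m * ?g t)"
    proof (rule integral_norm_bound_integral)
      show "(\<lambda>t. if t = s then 0 else vector_derivative \<gamma> (at t)) integrable_on {0..s}"
        using spike by (auto simp: integrable_on_def)
      show "(\<lambda>t. inverse m * ?g t) integrable_on {0..s}"
        by (rule integrable_on_mult_right[OF gint'])
      fix t assume t: "t \<in> {0..s}"
      show "norm (if t = s then 0 else vector_derivative \<gamma> (at t)) \<le> inverse m * ?g t"
      proof (cases "t = s")
        case False
        then have "m \<le> exp (u (\<gamma> t))" using t inball[of t] z[of "\<gamma> t"] by (auto simp: m_def)
        then have "m * norm (vector_derivative \<gamma> (at t)) \<le> ?g t" by (intro mult_right_mono) auto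
        then show ?thesis using False m by (simp add: field_simps)
      qed (use m in auto)
    qed
    also have "\<dots> = inverse m * integral {0..s} ?g" by simp
    also have "\<dots> \<le> inverse m * integral {0..1} ?g"
      using m s01 by (intro mult_left_mono integral_subset_le gint gint') auto
    also have "integral {0..1} ?g = L"
      using \<gamma>(4) by (auto simp: has_conf_length_def)
    finally have "norm (\<gamma> s - \<gamma> 0) \<le> inverse m * L"
      using integral_unique[OF spike] by simp
    then have "r \<le> inverse m * L"
      using s01(3) end01 by (simp add: dist_norm norm_minus_commute)
    then show "m * r \<le> L" using m by (simp add: field_simps)
  qed
  then show ?thesis using m r by (meson mult_pos_pos less_le_trans)
qed

theorem Metric_space_conf_dist:
  assumes u: "continuous_on UNIV u"
  shows "Metric_space UNIV (conf_dist u)"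
proof
  show "0 \<le> conf_dist u x y" for x y by (rule conf_dist_nonneg[OF u])
  show "conf_dist u x y = conf_dist u y x" for x y
    by (intro antisym conf_dist_commute_le u)
  show "conf_dist u x y = 0 \<longleftrightarrow> x = y" for x y
  proof
    assume "x = y"
    have "has_conf_length u (\<lambda>t. x) 0" by (simp add: has_conf_length_def)
    moreover have "valid_path (\<lambda>t::real. x)" by (simp add: valid_path_def C1_differentiable_imp_piecewise)
    ultimately have "conf_dist u x x \<le> 0"
      using conf_dist_le[of "\<lambda>t. x" u 0] by (simp add: pathstart_def pathfinish_def)
    then show "conf_dist u x y = 0" using \<open>x = y\<close> conf_dist_nonneg[OF u, of x x] by simp
  qed (use conf_dist_pos[OF u, of x y] in force)
  show "conf_dist u x z \<le> conf_dist u x y + conf_dist u y z" for x y z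
    by (rule conf_dist_triangle[OF u])
qed

end

theory Submission
  imports Defs "HOL-Probability.Probability_Measure"
begin

text \<open>
  Everything is done with averages over balls centred at the origin. Write \<open>n = 2m\<close> and let
  \<open>h\<^sub>j(r)\<close> be the average of \<open>(-\<Delta>)\<^sup>j u\<close> over the ball of radius \<open>r\<close>. Integration by parts
  shows that \<open>h\<^sub>j\<close> and \<open>h\<^sub>j\<^sub>+\<^sub>1\<close> are linked by the radial Laplace equation in dimension \<open>n + 2\<close>.
  Since \<open>r\<^sup>n h\<^sub>m(r)\<close> tends to a multiple of the total Q-curvature, l'Hopital's rule yields, going
  down in \<open>j\<close>, that \<open>h\<^sub>j\<close> decays like \<open>r\<close> to the power \<open>-2j\<close> with an explicit constant, unless
  at some stage a polynomial part appears. Nonnegative scalar curvature near infinity gives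
  \<open>h\<^sub>0'\<^sup>2 \<le> avg |\<nabla>u|\<^sup>2 \<le> 2/(n-2) h\<^sub>1\<close> up to an error of order \<open>1/r\<^sup>n\<close>, which excludes polynomial
  parts. Hence \<open>r\<^sup>2 h\<^sub>1(r)\<close> tends to \<open>n\<alpha>\<close> and \<open>h\<^sub>0(r) / ln r\<close> to \<open>-\<alpha>\<close>, where \<open>\<alpha>\<close> is the quotient of the
  total Q-curvature by \<open>(n-1)! |S\<^sup>n| / 2\<close>, and \<open>\<alpha> \<ge> 0\<close>.

  If \<open>R\<^sub>g \<ge> C |x|\<close> to the power \<open>-p\<close>, then Jensen's inequality bounds \<open>h\<^sub>1\<close> from below by
  a multiple of \<open>exp (2 h\<^sub>0)\<close> times \<open>r\<close> to the power \<open>-p\<close>; comparing exponents, \<open>p + 2\<alpha> \<ge> 2\<close>.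

  For \<open>\<alpha> \<le> 1\<close>, the energy bound \<open>avg |\<nabla>u|\<^sup>2 = O(1/r\<^sup>2)\<close> and the Poincare inequality on balls
  bound the mean square deviation of \<open>u\<close> from \<open>h\<^sub>0\<close>. A Borel-Cantelli argument over dyadic
  radii then yields a ray along which \<open>u = h\<^sub>0 + o(ln r)\<close>; if \<open>\<alpha> > 1\<close> this ray would have finite
  length, contradicting completeness.
\<close>

section \<open>Averages over the unit ball\<close>

text \<open>A probability measure on the whole space that does not depend on the radius: averages
  over balls of radius \<open>r\<close> become integrals of \<open>f (r *\<^sub>R y)\<close>, so
  that the radius can be differentiated under the integral sign.\<close>

definition unif_ball :: "'a::euclidean_space measure" where
  "unif_ball = density lborel
     (\<lambda>y. ennreal (indicator (cball 0 1) y / unit_ball_vol (real DIM('a))))"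

lemma sets_unif_ball [simp, measurable_cong]: "sets unif_ball = sets borel"
  by (simp add: unif_ball_def)

lemma space_unif_ball [simp]: "space unif_ball = UNIV"
  by (simp add: unif_ball_def)

lemma unit_ball_vol_neq_0 [simp]: "unit_ball_vol (real n) \<noteq> 0"
  using unit_ball_vol_pos[of "real n"] by linarith

lemma measurable_unit_cball [measurable]: "cball (0::'a::euclidean_space) 1 \<in> sets borel"
  by (simp add: borel_closed)

lemma integral_unif_ball:
  fixes f :: "'a::euclidean_space \<Rightarrow> real"
  assumes [measurable]: "f \<in> borel_measurable borel"
  shows "(\<integral>y. f y \<partial>unif_ball) =
    (\<integral>y. indicator (cball 0 1) y * f y \<partial>lborel) / unit_ball_vol (real DIM('a))"
  unfolding unif_ball_def
  by (subst integral_density) (auto simp: divide_simps)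

lemma nn_integral_unif_ball:
  fixes f :: "'a::euclidean_space \<Rightarrow> ennreal"
  assumes [measurable]: "f \<in> borel_measurable borel"
  shows "(\<integral>\<^sup>+y. f y \<partial>unif_ball) =
    (\<integral>\<^sup>+y. indicator (cball 0 1) y * f y \<partial>lborel) / ennreal (unit_ball_vol (real DIM('a)))"
proof -
  have "(\<integral>\<^sup>+y. f y \<partial>unif_ball) =
      (\<integral>\<^sup>+y. ennreal (1 / unit_ball_vol (real DIM('a))) * (indicator (cball 0 1) y * f y) \<partial>lborel)"
    unfolding unif_ball_def
    by (subst nn_integral_density) (auto intro!: nn_integral_cong simp: indicator_def)
  also have "\<dots> = ennreal (1 / unit_ball_vol (real DIM('a))) * (\<integral>\<^sup>+y. indicator (cball 0 1) y * f y \<partial>lborel)"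
    by (rule nn_integral_cmult) auto
  finally show ?thesis
    by (simp add: divide_ennreal_def inverse_ennreal mult.commute divide_inverse)
qed

lemma AE_unif_ball: "AE y in unif_ball. norm y \<le> 1"
  unfolding unif_ball_def by (subst AE_density) (auto simp: indicator_def)

lemma prob_space_unif_ball: "prob_space (unif_ball :: 'a::euclidean_space measure)"
proof
  have "emeasure unif_ball (space (unif_ball :: 'a measure)) = (\<integral>\<^sup>+y. 1 \<partial>(unif_ball :: 'a measure))"
    by simp
  also have "\<dots> = emeasure lborel (cball (0::'a) 1) / ennreal (unit_ball_vol (real DIM('a)))"
    by (subst nn_integral_unif_ball) auto
  also have "\<dots> = 1"
    by (subst emeasure_cball) (auto simp: ennreal_divide_self)
  finally show "emeasure unif_ball (space (unif_ball :: 'a measure)) = 1" .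
qed

interpretation unif_ball: prob_space unif_ball
  by (rule prob_space_unif_ball)

lemma integrable_unif_ball:
  fixes f :: "'a::euclidean_space \<Rightarrow> real"
  assumes "continuous_on UNIV f"
  shows "integrable unif_ball f"
proof -
  have "bounded (f ` cball 0 1)"
    by (intro compact_imp_bounded compact_continuous_image continuous_on_subset[OF assms]) auto
  then obtain B where "\<forall>y\<in>cball 0 1. norm (f y) \<le> B"
    unfolding bounded_iff by auto
  then have "\<And>y. norm y \<le> 1 \<Longrightarrow> norm (f y) \<le> B" by simp
  then show ?thesis
    using AE_unif_ball borel_measurable_continuous_onI[OF assms]
    by (intro unif_ball.integrable_const_bound[where B=B])
       (auto elim!: eventually_mono simp: measurable_cong_sets[OF sets_unif_ball])
qed

text \<open>By the mean value theorem the difference quotients are bounded by the maximum of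
  \<open>F'\<close> over a compact set of parameters and points, so dominated convergence applies
  along every sequence tending to \<open>r\<close>.\<close>

lemma has_derivative_integral_unif_ball:
  fixes F :: "real \<Rightarrow> 'a::euclidean_space \<Rightarrow> real"
  assumes F: "\<And>r. continuous_on UNIV (F r)"
    and F': "\<And>r y. ((\<lambda>r. F r y) has_real_derivative F' r y) (at r)"
    and cont: "continuous_on UNIV (\<lambda>p. F' (fst p) (snd p))"
  shows "((\<lambda>r. \<integral>y. F r y \<partial>unif_ball) has_real_derivative (\<integral>y. F' r y \<partial>unif_ball)) (at r)"
  unfolding has_field_derivative_iff
proof (subst tendsto_at_iff_sequentially, intro allI impI)
  fix X assume X: "\<forall>i. X i \<in> UNIV - {r}" "X \<longlonglongrightarrow> r"
  have F'c: "continuous_on UNIV (F' s)" for s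
    using continuous_on_compose2[OF cont, of UNIV "\<lambda>y. (s, y)"] by (simp add: continuous_intros)
  have "Bseq X" using X(2) by (meson Bseq_def convergent_imp_Bseq convergentI)
  then obtain M where M: "\<And>i. \<bar>X i\<bar> \<le> M" by (auto simp: Bseq_def)
  have rM: "\<bar>r\<bar> \<le> M"
    using X(2) by (intro tendsto_upperbound[OF tendsto_rabs[OF X(2)]]) (auto simp: M)
  \<comment> \<open>The interval \<open>{-M..M}\<close> contains \<open>r\<close> and the whole
    sequence, so one bound \<open>B\<close> serves all quotients.\<close>
  have "bounded ((\<lambda>p. F' (fst p) (snd p)) ` ({-M..M} \<times> cball 0 1))"
    by (intro compact_imp_bounded compact_continuous_image continuous_on_subset[OF cont] compact_Times) auto
  then obtain B where B: "\<And>s y. \<bar>s\<bar> \<le> M \<Longrightarrow> norm y \<le> 1 \<Longrightarrow> norm (F' s y) \<le> B"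
    by (force simp: bounded_iff)
  have quot: "norm ((F (X i) y - F r y) / (X i - r)) \<le> B" if "norm y \<le> 1" for i y
  proof -
    have "norm (F (X i) y - F r y) \<le> B * norm (X i - r)"
      by (rule field_differentiable_bound[of "{-M..M}" "\<lambda>r. F r y" "\<lambda>s. F' s y"])
         (use that B M[of i] rM in \<open>auto intro!: has_field_derivative_at_within F'\<close>)
    then show ?thesis using X(1)[rule_format, of i] by (simp add: divide_le_eq abs_divide)
  qed
  have "(\<lambda>i. \<integral>y. (F (X i) y - F r y) / (X i - r) \<partial>unif_ball) \<longlonglongrightarrow> (\<integral>y. F' r y \<partial>unif_ball)"
  proof (rule integral_dominated_convergence[where w="\<lambda>_. B"])
    show "F' r \<in> borel_measurable unif_ball" 
      using integrable_unif_ball[OF F'c] by blast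
    show "(\<lambda>y. (F (X i) y - F r y) / (X i - r)) \<in> borel_measurable unif_ball" for i
      using integrable_unif_ball[OF F] by measurable
    show "AE y in unif_ball. (\<lambda>i. (F (X i) y - F r y) / (X i - r)) \<longlonglongrightarrow> F' r y"
    proof (rule AE_I2)
      fix y
      show "(\<lambda>i. (F (X i) y - F r y) / (X i - r)) \<longlonglongrightarrow> F' r y"
        using F'[where r=r and y=y] X unfolding has_field_derivative_iff tendsto_at_iff_sequentially by (auto simp: o_def)
    qed
  qed (use AE_unif_ball quot in \<open>auto elim!: eventually_mono\<close>)
  moreover have "(\<integral>y. (F (X i) y - F r y) / (X i - r) \<partial>unif_ball) =
      ((\<integral>y. F (X i) y \<partial>unif_ball) - (\<integral>y. F r y \<partial>unif_ball)) / (X i - r)" for i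
    using Bochner_Integration.integral_diff[OF integrable_unif_ball[OF F] integrable_unif_ball[OF F], of "X i" r] by simp
  ultimately have "(\<lambda>i. ((\<integral>y. F (X i) y \<partial>unif_ball) - (\<integral>y. F r y \<partial>unif_ball)) / (X i - r)) \<longlonglongrightarrow> (\<integral>y. F' r y \<partial>unif_ball)"
    by (simp only:)
  then show "((\<lambda>y. ((\<integral>y'. F y y' \<partial>unif_ball) - (\<integral>y. F r y \<partial>unif_ball)) / (y - r)) \<circ> X) \<longlonglongrightarrow> (\<integral>y. F' r y \<partial>unif_ball)"
    by (simp add: o_def)
qed

text \<open>Translation invariance of Lebesgue measure moves the difference quotient in direction
  \<open>e\<close> from \<open>G\<close> onto the weight \<open>w\<close>, the positive part of
  \<open>1 - |y|^2\<close>. Both sides pass to the limit by dominated convergence, because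
  \<open>w\<close> is bounded, compactly supported and locally Lipschitz. No surface integral
  arises, as \<open>w\<close> is continuous and vanishes outside the ball.\<close>

lemma unif_ball_integration_by_parts:
  fixes G G' :: "'a::euclidean_space \<Rightarrow> real" and e :: 'a
  assumes G: "continuous_on UNIV G" and G': "continuous_on UNIV G'"
    and D: "\<And>y. ((\<lambda>t. G (y + t *\<^sub>R e)) has_real_derivative G' y) (at 0)"
  shows "(\<integral>y. (1 - (norm y)\<^sup>2) * G' y \<partial>unif_ball) = (\<integral>y. 2 * (y \<bullet> e) * G y \<partial>unif_ball)"
proof -
  define w :: "'a \<Rightarrow> real" where "w y = max 0 (1 - (norm y)\<^sup>2)" for y
  have wc: "continuous_on UNIV w" unfolding w_def by (intro continuous_intros)
  note [measurable] = borel_measurable_continuous_onI[OF G] borel_measurable_continuous_onI[OF G']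
     borel_measurable_continuous_onI[OF wc]
  \<comment> \<open>\<open>K\<close> contains the unit ball moved by at most \<open>e\<close>;
    outside it \<open>w\<close> and its translates vanish, so multiples of its indicator dominate
    every integrand below.\<close>
  define K where "K = cball (0::'a) (1 + norm e)"
  have w0: "w y = 0" if "norm y \<ge> 1" for y using that by (simp add: w_def)
  have w01: "0 \<le> w y" "w y \<le> 1" for y by (auto simp: w_def)
  have wlip: "\<bar>w a - w b\<bar> \<le> \<bar>(norm a)\<^sup>2 - (norm b)\<^sup>2\<bar>" for a b unfolding w_def by linarith
  have D': "((\<lambda>t. G (y + t *\<^sub>R e)) has_real_derivative G' (y + t *\<^sub>R e)) (at t)" for y t
  proof -
    have "((\<lambda>s. G ((y + t *\<^sub>R e) + s *\<^sub>R e)) has_real_derivative G' (y + t *\<^sub>R e)) (at 0)" by (rule D)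
    then have "((\<lambda>s. G ((y + t *\<^sub>R e) + (s + (-t)) *\<^sub>R e)) has_real_derivative G' (y + t *\<^sub>R e)) (at t)"
      using DERIV_shift[of "\<lambda>s. G ((y + t *\<^sub>R e) + s *\<^sub>R e)" _ t "-t"] by simp
    then show ?thesis by (simp add: algebra_simps)
  qed
  have Kc: "compact K" by (simp add: K_def)
  have "bounded (G ` K)" "bounded (G' ` K)"
    by (intro compact_imp_bounded compact_continuous_image continuous_on_subset[OF G] continuous_on_subset[OF G'] Kc subset_UNIV)+
  then obtain B B' where B: "\<And>y. y \<in> K \<Longrightarrow> \<bar>G y\<bar> \<le> B" and B': "\<And>y. y \<in> K \<Longrightarrow> \<bar>G' y\<bar> \<le> B'"
    by (auto simp: bounded_iff)
  have Bnn: "0 \<le> B" "0 \<le> B'" using B[of 0] B'[of 0] by (auto simp: K_def intro: order_trans[OF abs_ge_zero])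
  define h where "h i = inverse (real (Suc i))" for i
  have h: "0 < h i" "h i \<le> 1" for i by (auto simp: h_def field_simps)
  have h0: "h \<longlonglongrightarrow> 0" unfolding h_def by (rule LIMSEQ_inverse_real_of_nat)
  have hat: "filterlim h (at 0) sequentially"
    using h0 h(1) by (auto simp: filterlim_at less_imp_neq[symmetric] intro!: always_eventually)
  have int_ind: "integrable lborel (\<lambda>y. c * indicator K y :: real)" for c
    by (intro integrable_mult_right integrable_real_indicator) (auto simp: K_def emeasure_cball)
  have bnd: "integrable lborel f" if "f \<in> borel_measurable borel" "\<And>y. \<bar>f y\<bar> \<le> c * indicator K y" for f :: "'a \<Rightarrow> real" and c
    by (rule Bochner_Integration.integrable_bound[OF int_ind[of c]]) (use that in \<open>auto intro: order_trans[OF _ abs_ge_self]\<close>)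
  have inK: "y + t *\<^sub>R e \<in> K" if "norm y \<le> 1" "\<bar>t\<bar> \<le> 1" for y t
    using that norm_triangle_ineq[of y "t *\<^sub>R e"] mult_right_mono[of "\<bar>t\<bar>" 1 "norm e"] by (auto simp: K_def)
  have notK: "w (y - h i *\<^sub>R e) = 0" "w y = 0" if "y \<notin> K" for y i
  proof -
    have "norm (h i *\<^sub>R e) \<le> norm e" using h[of i] mult_right_mono[of "h i" 1 "norm e"] by simp
    then show "w (y - h i *\<^sub>R e) = 0" "w y = 0" 
      using that norm_triangle_ineq2[of y "h i *\<^sub>R e"] norm_ge_zero[of e]
      by (auto simp: K_def simp del: norm_scaleR norm_ge_zero intro!: w0)
  qed
  have Glip: "\<bar>(G (y + h i *\<^sub>R e) - G y) / h i\<bar> \<le> B'" if "norm y \<le> 1" for y i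
  proof -
    have "norm (G (y + h i *\<^sub>R e) - G (y + 0 *\<^sub>R e)) \<le> B' * norm (h i - 0)"
      by (rule field_differentiable_bound[of "{0..1}" "\<lambda>t. G (y + t *\<^sub>R e)" "\<lambda>t. G' (y + t *\<^sub>R e)"])
         (use that h[of i] in \<open>auto intro!: has_field_derivative_at_within D' B' inK simp: real_norm_def\<close>)
    then show ?thesis using h[of i] by (simp add: divide_le_eq abs_divide)
  qed
  have lim1: "(\<lambda>i. \<integral>y. w y * ((G (y + h i *\<^sub>R e) - G y) / h i) \<partial>lborel) \<longlonglongrightarrow> (\<integral>y. w y * G' y \<partial>lborel)"
  proof (rule integral_dominated_convergence[OF _ _ int_ind[of B']])
    show "AE y in lborel. (\<lambda>i. w y * ((G (y + h i *\<^sub>R e) - G y) / h i)) \<longlonglongrightarrow> w y * G' y"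
      using D by (intro AE_I2 tendsto_intros) (auto simp: has_field_derivative_iff intro: filterlim_compose[OF _ hat])
    show "AE y in lborel. norm (w y * ((G (y + h i *\<^sub>R e) - G y) / h i)) \<le> B' * indicator K y" for i
    proof (rule AE_I2)
      fix y show "norm (w y * ((G (y + h i *\<^sub>R e) - G y) / h i)) \<le> B' * indicator K y"
      proof (cases "norm y < 1")
        case True
        have "\<bar>w y\<bar> * \<bar>(G (y + h i *\<^sub>R e) - G y) / h i\<bar> \<le> 1 * B'"
          using True w01[of y] Bnn by (intro mult_mono Glip) auto
        then show ?thesis using True inK[of y 0] by (simp add: abs_mult)
      qed (use w0[of y] Bnn in auto)
    qed
  qed auto
  have lim2: "(\<lambda>i. \<integral>y. ((w (y - h i *\<^sub>R e) - w y) / h i) * G y \<partial>lborel) \<longlonglongrightarrow>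
     (\<integral>y. indicator (cball 0 1) y * (2 * (y \<bullet> e) * G y) \<partial>lborel)"
  proof (rule integral_dominated_convergence[OF _ _ int_ind[of "norm e * (2 * (1 + norm e) + norm e) * B"]])
    \<comment> \<open>The sphere, where \<open>w\<close> has a kink, is a null set. Inside it the
      quotients of \<open>w\<close> tend to \<open>2 * (y \<bullet> e)\<close>; outside it they are
      eventually zero.\<close>
    have "AE y in lborel. y \<notin> sphere (0::'a) 1"
      using negligible_sphere[of "0::'a" 1] by (intro AE_not_in) (simp add: negligible_iff_null_sets null_sets_completion_iff)
    then show "AE y in lborel. (\<lambda>i. ((w (y - h i *\<^sub>R e) - w y) / h i) * G y) \<longlonglongrightarrow> indicator (cball 0 1) y * (2 * (y \<bullet> e) * G y)"
    proof eventually_elim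
      fix y :: 'a assume y: "y \<notin> sphere 0 1"
      have tend: "(\<lambda>i. norm (y - h i *\<^sub>R e)) \<longlonglongrightarrow> norm (y - 0 *\<^sub>R e)"
        by (intro tendsto_intros h0)
      show "(\<lambda>i. ((w (y - h i *\<^sub>R e) - w y) / h i) * G y) \<longlonglongrightarrow> indicator (cball 0 1) y * (2 * (y \<bullet> e) * G y)"
      proof (cases "norm y < 1")
        case True
        then have "eventually (\<lambda>i. norm (y - h i *\<^sub>R e) < 1) sequentially"
          using order_tendstoD(2)[OF tend] by simp
        then have "eventually (\<lambda>i. (2 * (y \<bullet> e) - h i * (e \<bullet> e)) * G y = ((w (y - h i *\<^sub>R e) - w y) / h i) * G y) sequentially"
        proof eventually_elim
          case (elim i)
          have "(norm (y - h i *\<^sub>R e))\<^sup>2 = (norm y)\<^sup>2 - h i * (2 * (y \<bullet> e) - h i * (e \<bullet> e))"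
            unfolding power2_norm_eq_inner
            by (simp add: inner_diff_left inner_diff_right inner_commute algebra_simps)
          moreover have "(norm (y - h i *\<^sub>R e))\<^sup>2 \<le> 1" "(norm y)\<^sup>2 \<le> 1"
            using True elim by (simp_all add: power_le_one)
          ultimately have "w (y - h i *\<^sub>R e) - w y = h i * (2 * (y \<bullet> e) - h i * (e \<bullet> e))"
            unfolding w_def by linarith
          then show ?case using h(1)[of i] by simp
        qed
        moreover have "(\<lambda>i. (2 * (y \<bullet> e) - h i * (e \<bullet> e)) * G y) \<longlonglongrightarrow> (2 * (y \<bullet> e) - 0 * (e \<bullet> e)) * G y"
          by (intro tendsto_intros h0)
        ultimately show ?thesis using True by (simp add: tendsto_cong)
      next
        case False
        then have "1 < norm y" using y by auto
        then have "eventually (\<lambda>i. 1 < norm (y - h i *\<^sub>R e)) sequentially"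
          using order_tendstoD(1)[OF tend] by simp
        then have "eventually (\<lambda>i. 0 = ((w (y - h i *\<^sub>R e) - w y) / h i) * G y) sequentially"
          by eventually_elim (use \<open>1 < norm y\<close> in \<open>simp add: w0\<close>)
        from tendsto_cong[OF this, of 0] \<open>1 < norm y\<close> show ?thesis by simp
      qed
    qed
    show "AE y in lborel. norm ((w (y - h i *\<^sub>R e) - w y) / h i * G y) \<le> norm e * (2 * (1 + norm e) + norm e) * B * indicator K y" for i
    proof (rule AE_I2)
      fix y show "norm ((w (y - h i *\<^sub>R e) - w y) / h i * G y) \<le> norm e * (2 * (1 + norm e) + norm e) * B * indicator K y"
      proof (cases "y \<in> K")
        case True
        have n: "norm (y - h i *\<^sub>R e) \<le> norm y + norm e"
          using norm_triangle_ineq4[of y "h i *\<^sub>R e"] h[of i] mult_right_mono[of "h i" 1 "norm e"] by auto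
        have "\<bar>w (y - h i *\<^sub>R e) - w y\<bar> \<le> \<bar>(norm (y - h i *\<^sub>R e))\<^sup>2 - (norm y)\<^sup>2\<bar>" by (rule wlip)
        also have "\<dots> = \<bar>norm (y - h i *\<^sub>R e) - norm y\<bar> * (norm (y - h i *\<^sub>R e) + norm y)"
          by (simp add: power2_eq_square square_diff_square_factored abs_mult abs_of_nonneg add_nonneg_nonneg mult.commute)
        \<comment> \<open>The first factor comes from the reverse triangle inequality, the second
          from \<open>norm y \<le> 1 + norm e\<close> on \<open>K\<close> together with
          \<open>n\<close>.\<close>
        also have "\<dots> \<le> (h i * norm e) * (2 * (1 + norm e) + norm e)"
          using norm_triangle_ineq3[of "y - h i *\<^sub>R e" y] h[of i] n True
          by (intro mult_mono) (auto simp: K_def)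
        finally have "\<bar>(w (y - h i *\<^sub>R e) - w y) / h i\<bar> \<le> norm e * (2 * (1 + norm e) + norm e)"
          using h[of i] by (simp add: abs_divide divide_le_eq algebra_simps)
        then have "\<bar>(w (y - h i *\<^sub>R e) - w y) / h i\<bar> * \<bar>G y\<bar> \<le> norm e * (2 * (1 + norm e) + norm e) * B"
          using B[OF True] by (intro mult_mono) auto
        then show ?thesis using True by (simp add: abs_mult)
      qed (use notK in auto)
    qed
  qed auto
  have eq: "(\<integral>y. w y * ((G (y + h i *\<^sub>R e) - G y) / h i) \<partial>lborel) = (\<integral>y. ((w (y - h i *\<^sub>R e) - w y) / h i) * G y \<partial>lborel)" for i
  proof -
    have [measurable]: "(\<lambda>y. w (y - h i *\<^sub>R e)) \<in> borel_measurable borel" "(\<lambda>y. G (y + h i *\<^sub>R e)) \<in> borel_measurable borel"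
      by measurable
    have le: "\<bar>w y * g\<bar> \<le> c * indicator K y" if "norm y \<le> 1 \<Longrightarrow> \<bar>g\<bar> \<le> c" "0 \<le> c" for y g c
    proof (cases "norm y \<le> 1")
      case True
      then have "\<bar>w y\<bar> * \<bar>g\<bar> \<le> 1 * c" using that w01[of y] by (intro mult_mono) auto
      then show ?thesis using True inK[of y 0] by (simp add: abs_mult)
    qed (use that w0[of y] in auto)
    have i1: "integrable lborel (\<lambda>y. w y * G (y + h i *\<^sub>R e))"
      by (rule bnd[of _ B], measurable, rule le) (use h[of i] inK[of _ "h i"] B Bnn in auto)
    have i2: "integrable lborel (\<lambda>y. w y * G y)"
      by (rule bnd[of _ B], measurable, rule le) (use inK[of _ 0] B Bnn in auto)
    have i3: "integrable lborel (\<lambda>y. w (y - h i *\<^sub>R e) * G y)"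
    proof (rule bnd[of _ B])
      show "\<bar>w (y - h i *\<^sub>R e) * G y\<bar> \<le> B * indicator K y" for y
      proof (cases "y \<in> K")
        case True
        have "\<bar>w (y - h i *\<^sub>R e)\<bar> * \<bar>G y\<bar> \<le> 1 * B" using w01 B[OF True] by (intro mult_mono) auto
        then show ?thesis using True by (simp add: abs_mult)
      qed (use notK in auto)
    qed measurable
    \<comment> \<open>The shift by \<open>h i *\<^sub>R e\<close> passes from the weight to
      \<open>G\<close>.\<close>
    have "(\<integral>y. w (y - h i *\<^sub>R e) * G y \<partial>lborel) = (\<integral>y. w (y - h i *\<^sub>R e) * G y \<partial>distr lborel borel ((+) (h i *\<^sub>R e)))"
      by (simp add: lborel_distr_plus)
    also have "\<dots> = (\<integral>y. w y * G (y + h i *\<^sub>R e) \<partial>lborel)"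
      by (subst integral_distr) (auto simp: algebra_simps)
    finally have tr: "(\<integral>y. w (y - h i *\<^sub>R e) * G y \<partial>lborel) = (\<integral>y. w y * G (y + h i *\<^sub>R e) \<partial>lborel)" .
    have "(\<integral>y. w y * ((G (y + h i *\<^sub>R e) - G y) / h i) \<partial>lborel) = (\<integral>y. (w y * G (y + h i *\<^sub>R e) - w y * G y) / h i \<partial>lborel)"
      by (simp add: algebra_simps diff_divide_distrib)
    also have "\<dots> = ((\<integral>y. w y * G (y + h i *\<^sub>R e) \<partial>lborel) - (\<integral>y. w y * G y \<partial>lborel)) / h i"
      using i1 i2 by simp
    also have "\<dots> = (\<integral>y. (w (y - h i *\<^sub>R e) * G y - w y * G y) / h i \<partial>lborel)"
      using i3 i2 by (simp add: tr)
    also have "\<dots> = (\<integral>y. ((w (y - h i *\<^sub>R e) - w y) / h i) * G y \<partial>lborel)"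
      by (simp add: algebra_simps diff_divide_distrib)
    finally show ?thesis .
  qed
  have "(\<integral>y. w y * G' y \<partial>lborel) = (\<integral>y. indicator (cball 0 1) y * (2 * (y \<bullet> e) * G y) \<partial>lborel)"
    using LIMSEQ_unique[OF lim1[unfolded eq] lim2] .
  moreover have "w y * G' y = indicator (cball 0 1) y * ((1 - (norm y)\<^sup>2) * G' y)" for y
    using w0[of y] by (auto simp: indicator_def w_def max_def power_le_one)
  ultimately show ?thesis
    by (simp add: integral_unif_ball)
qed

section \<open>Smooth functions and the radial Laplace equation\<close>

lemma smooth_differentiable: "smooth f \<Longrightarrow> f differentiable (at x)"
  unfolding smooth_def by (metis Ck.simps(2))

lemma smooth_partial: "smooth f \<Longrightarrow> smooth (partial i f)"
  unfolding smooth_def by (metis Ck.simps(2))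

lemma smooth_continuous: "smooth f \<Longrightarrow> continuous_on UNIV f"
  unfolding smooth_def by (metis Ck.simps(1))

lemma smooth_gradient_continuous: "smooth f \<Longrightarrow> continuous_on UNIV (gradient f)"
  unfolding gradient_def[abs_def]
  by (intro continuous_on_vec_lambda smooth_continuous smooth_partial)

lemma smooth_has_derivative:
  assumes "smooth f"
  shows "(f has_derivative (\<lambda>h. gradient f x \<bullet> h)) (at x)"
proof -
  have d: "(f has_derivative frechet_derivative f (at x)) (at x)"
    using smooth_differentiable[OF assms] by (simp add: frechet_derivative_works)
  then have lin: "linear (frechet_derivative f (at x))"
    by (rule has_derivative_linear)
  have "frechet_derivative f (at x) h = gradient f x \<bullet> h" for h
  proof -
    have "frechet_derivative f (at x) h = frechet_derivative f (at x) (\<Sum>i\<in>UNIV. h $ i *\<^sub>R axis i 1)"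
      by (metis (no_types, lifting) basis_expansion scalar_mult_eq_scaleR sum.cong)
    also have "\<dots> = (\<Sum>i\<in>UNIV. h $ i * partial i f x)"
      by (simp add: linear_sum[OF lin] linear_scale[OF lin] partial_def)
    finally show ?thesis by (simp add: inner_vec_def gradient_def mult.commute)
  qed
  then have "frechet_derivative f (at x) = (\<lambda>h. gradient f x \<bullet> h)" by (rule ext)
  with d show ?thesis by simp
qed

lemma smooth_line_derivative:
  assumes "smooth f"
  shows "((\<lambda>t. f (a + t *\<^sub>R b)) has_real_derivative gradient f (a + t *\<^sub>R b) \<bullet> b) (at t)"
proof -
  have "((\<lambda>t. a + t *\<^sub>R b) has_derivative (\<lambda>t. t *\<^sub>R b)) (at t)"
    by (auto intro!: derivative_eq_intros)
  from has_derivative_compose[OF this smooth_has_derivative[OF assms]]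
  show ?thesis
    by (rule has_derivative_imp_has_field_derivative) (simp add: mult.commute)
qed

lemma partial_eq: "smooth f \<Longrightarrow> gradient f x \<bullet> axis i 1 = partial i f x"
  by (simp add: inner_axis gradient_def)

section \<open>Stability of smoothness under sums, negation and the Laplacian\<close>

lemma partial_add:
  assumes "f differentiable (at x)" "g differentiable (at x)"
  shows "partial i (\<lambda>x. f x + g x) x = partial i f x + partial i g x"
proof -
  have "((\<lambda>x. f x + g x) has_derivative
      (\<lambda>h. frechet_derivative f (at x) h + frechet_derivative g (at x) h)) (at x)"
    using assms by (intro has_derivative_add) (simp_all add: frechet_derivative_works)
  from frechet_derivative_at[OF this, symmetric] show ?thesis by (simp add: partial_def)
qed

lemma partial_minus:
  assumes "f differentiable (at x)"
  shows "partial i (\<lambda>x. - f x) x = - partial i f x"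
proof -
  have "((\<lambda>x. - f x) has_derivative (\<lambda>h. - frechet_derivative f (at x) h)) (at x)"
    using assms by (intro has_derivative_minus) (simp_all add: frechet_derivative_works)
  from frechet_derivative_at[OF this, symmetric] show ?thesis by (simp add: partial_def)
qed

lemma Ck_add: "Ck k f \<Longrightarrow> Ck k g \<Longrightarrow> Ck k (\<lambda>x. f x + g x)"
proof (induction k arbitrary: f g)
  case (Suc k)
  then have "partial i (\<lambda>x. f x + g x) = (\<lambda>x. partial i f x + partial i g x)" for i
    by (intro ext partial_add) auto
  with Suc show ?case by simp
qed (simp add: continuous_on_add)

lemma Ck_minus: "Ck k f \<Longrightarrow> Ck k (\<lambda>x. - f x)"
proof (induction k arbitrary: f)
  case (Suc k)
  then have "partial i (\<lambda>x. - f x) = (\<lambda>x. - partial i f x)" for i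
    by (intro ext partial_minus) auto
  with Suc show ?case by simp
qed (simp add: continuous_on_minus)

lemma Ck_zero: "Ck k (\<lambda>x :: real ^ 'n::finite. 0)"
proof (induction k)
  case (Suc k)
  have "partial i (\<lambda>x. 0) = (\<lambda>x::real^'n. 0)" for i :: 'n
    by (auto simp: partial_def)
  with Suc show ?case by simp
qed simp

lemma smooth_laplacian:
  assumes "smooth f"
  shows "smooth (laplacian f)"
proof -
  have "Ck k (\<lambda>x. \<Sum>i\<in>A. partial i (partial i f) x)" if "finite A" for k A
    using that
  proof induction
    case (insert i A)
    have "Ck k (partial i (partial i f))"
      using smooth_partial[OF smooth_partial[OF assms]] by (simp add: smooth_def)
    with insert show ?case by (simp add: Ck_add)
  qed (simp add: Ck_zero)
  then show ?thesis
    by (simp add: smooth_def laplacian_def[abs_def])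
qed

abbreviation neg_lap_pow :: "nat \<Rightarrow> (real ^ 'n::finite \<Rightarrow> real) \<Rightarrow> real ^ 'n \<Rightarrow> real" where
  "neg_lap_pow j \<equiv> (\<lambda>f y. - laplacian f y) ^^ j"

lemma smooth_neg_lap_pow: "smooth f \<Longrightarrow> smooth (neg_lap_pow j f)"
proof (induction j)
  case (Suc j)
  then show ?case
    using smooth_laplacian[of "neg_lap_pow j f"] by (simp add: smooth_def Ck_minus)
qed simp

section \<open>Plain and weighted ball averages as functions of the radius\<close>

definition bmean :: "('a::euclidean_space \<Rightarrow> real) \<Rightarrow> real \<Rightarrow> real" where
  "bmean f r = (\<integral>y. f (r *\<^sub>R y) \<partial>unif_ball)"

text \<open>The gradient of the weight \<open>1 - |y|\<^sup>2\<close> is \<open>-2y\<close> and the weight vanishes on the sphere, so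
  integrating \<open>y \<bullet> \<nabla>f\<close> by parts produces this average of the Laplacian, without boundary term.\<close>

definition kmean :: "('a::euclidean_space \<Rightarrow> real) \<Rightarrow> real \<Rightarrow> real" where
  "kmean f r = (\<integral>y. (1 - (norm y)\<^sup>2) * f (r *\<^sub>R y) \<partial>unif_ball)"

lemma bmean_derivative:
  assumes "smooth f"
  shows "(bmean f has_real_derivative (\<integral>y. gradient f (r *\<^sub>R y) \<bullet> y \<partial>unif_ball)) (at r)"
  unfolding bmean_def[abs_def]
  by (rule has_derivative_integral_unif_ball)
     (use smooth_line_derivative[OF assms, of 0] in
      \<open>auto intro!: continuous_intros continuous_on_compose2[OF smooth_continuous[OF assms]]
        continuous_on_compose2[OF smooth_gradient_continuous[OF assms]]\<close>)

lemma kmean_derivative: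
  assumes "smooth f"
  shows "(kmean f has_real_derivative
    (\<integral>y. (1 - (norm y)\<^sup>2) * (gradient f (r *\<^sub>R y) \<bullet> y) \<partial>unif_ball)) (at r)"
  unfolding kmean_def[abs_def]
  by (rule has_derivative_integral_unif_ball)
     (use smooth_line_derivative[OF assms, of 0] in
      \<open>auto intro!: continuous_intros continuous_on_compose2[OF smooth_continuous[OF assms]]
        continuous_on_compose2[OF smooth_gradient_continuous[OF assms]] DERIV_cmult\<close>)

text \<open>Each \<open>partial i f (r *\<^sub>R y)\<close> is integrated by parts against
  \<open>y $ i\<close>; the chain rule supplies the factor \<open>r\<close>, the gradient of the
  weight the factor 1/2. This is the first half of the radial system.\<close>

lemma bmean_derivative_eq:
  fixes f :: "real ^ 'n::finite \<Rightarrow> real"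
  assumes "smooth f"
  shows "(\<integral>y. gradient f (r *\<^sub>R y) \<bullet> y \<partial>unif_ball) = r / 2 * kmean (laplacian f) r"
proof -
  note c = continuous_on_compose2[OF smooth_continuous[OF smooth_partial[OF assms]]]
    continuous_on_compose2[OF smooth_continuous[OF smooth_partial[OF smooth_partial[OF assms]]]]
  have i1: "integrable unif_ball (\<lambda>y. partial i f (r *\<^sub>R y) * y $ i)" for i
    by (intro integrable_unif_ball continuous_intros c) auto
  have i2: "integrable unif_ball (\<lambda>y. (1 - (norm y)\<^sup>2) * partial i (partial i f) (r *\<^sub>R y))" for i
    by (intro integrable_unif_ball continuous_intros c) auto
  have "(\<integral>y. 2 * (y \<bullet> axis i 1) * partial i f (r *\<^sub>R y) \<partial>unif_ball)
      = (\<integral>y. (1 - (norm y)\<^sup>2) * (r * partial i (partial i f) (r *\<^sub>R y)) \<partial>unif_ball)" for i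
  proof (rule unif_ball_integration_by_parts[symmetric])
    fix y :: "real ^ 'n"
    show "((\<lambda>t. partial i f (r *\<^sub>R (y + t *\<^sub>R axis i 1))) has_real_derivative
        r * partial i (partial i f) (r *\<^sub>R y)) (at 0)"
      using smooth_line_derivative[OF smooth_partial[OF assms, of i], of "r *\<^sub>R y" "r *\<^sub>R axis i 1" 0]
      by (simp add: partial_eq smooth_partial assms scaleR_add_right mult.commute)
  qed (intro continuous_intros c; simp)+
  then have *: "2 * (\<integral>y. partial i f (r *\<^sub>R y) * y $ i \<partial>unif_ball) 
      = r * (\<integral>y. (1 - (norm y)\<^sup>2) * partial i (partial i f) (r *\<^sub>R y) \<partial>unif_ball)" for i
    unfolding integral_mult_right_zero[symmetric] by (simp add: inner_axis ac_simps)
  have "(\<integral>y. gradient f (r *\<^sub>R y) \<bullet> y \<partial>unif_ball) = (\<Sum>i\<in>UNIV. \<integral>y. partial i f (r *\<^sub>R y) * y $ i \<partial>unif_ball)"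
    unfolding inner_vec_def gradient_def by (simp add: i1)
  also have "\<dots> = r / 2 * (\<Sum>i\<in>UNIV. \<integral>y. (1 - (norm y)\<^sup>2) * partial i (partial i f) (r *\<^sub>R y) \<partial>unif_ball)"
    unfolding sum_distrib_left by (intro sum.cong refl) (use * in \<open>simp add: field_simps\<close>)
  also have "(\<Sum>i\<in>UNIV. \<integral>y. (1 - (norm y)\<^sup>2) * partial i (partial i f) (r *\<^sub>R y) \<partial>unif_ball)
      = kmean (laplacian f) r"
    unfolding kmean_def laplacian_def sum_distrib_left by (simp add: i2)
  finally show ?thesis .
qed

text \<open>Integrating \<open>y $ i * f (r *\<^sub>R y)\<close> by parts and summing over
  \<open>i\<close> turns twice the average of \<open>|y|^2 f\<close> into
  \<open>n kmean + r kmean'\<close>, where the \<open>n\<close> comes from differentiating the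
  coordinates. Since \<open>|y|^2 = 1 - (1 - |y|^2)\<close>, the left side is
  \<open>2 (bmean - kmean)\<close>, which accounts for the shift of the dimension to
  \<open>n + 2\<close>.\<close>

lemma kmean_derivative_eq:
  fixes f :: "real ^ 'n::finite \<Rightarrow> real"
  assumes "smooth f"
  shows "r * (\<integral>y. (1 - (norm y)\<^sup>2) * (gradient f (r *\<^sub>R y) \<bullet> y) \<partial>unif_ball)
    = 2 * bmean f r - (real CARD('n) + 2) * kmean f r"
proof -
  note c = continuous_on_compose2[OF smooth_continuous[OF assms]]
    continuous_on_compose2[OF smooth_continuous[OF smooth_partial[OF assms]]]
    continuous_on_compose2[OF smooth_gradient_continuous[OF assms]]
  have i1: "integrable unif_ball (\<lambda>y. (1 - (norm y)\<^sup>2) * f (r *\<^sub>R y))"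
    by (intro integrable_unif_ball continuous_intros c) auto
  have i2: "integrable unif_ball (\<lambda>y. (1 - (norm y)\<^sup>2) * (partial i f (r *\<^sub>R y) * y $ i))" for i
    by (intro integrable_unif_ball continuous_intros c) auto
  have i3: "integrable unif_ball (\<lambda>y. (y $ i * y $ i) * f (r *\<^sub>R y))" for i
    by (intro integrable_unif_ball continuous_intros c) auto
  have i4: "integrable unif_ball (\<lambda>y. f (r *\<^sub>R y))"
    by (intro integrable_unif_ball continuous_intros c) auto
  have "(\<integral>y. 2 * (y \<bullet> axis i 1) * (y $ i * f (r *\<^sub>R y)) \<partial>unif_ball)
      = (\<integral>y. (1 - (norm y)\<^sup>2) * (f (r *\<^sub>R y) + y $ i * (r * partial i f (r *\<^sub>R y))) \<partial>unif_ball)" for i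
  proof (rule unif_ball_integration_by_parts[symmetric])
    fix y :: "real ^ 'n"
    have 1: "((\<lambda>t. f (r *\<^sub>R (y + t *\<^sub>R axis i 1))) has_real_derivative
        r * partial i f (r *\<^sub>R y)) (at 0)"
      using smooth_line_derivative[OF assms, of "r *\<^sub>R y" "r *\<^sub>R axis i 1" 0]
      by (simp add: partial_eq assms scaleR_add_right mult.commute)
    have 2: "((\<lambda>t. (y + t *\<^sub>R axis i 1) $ i) has_real_derivative 1) (at 0)"
      by (auto intro!: derivative_eq_intros)
    show "((\<lambda>t. (y + t *\<^sub>R axis i 1) $ i * f (r *\<^sub>R (y + t *\<^sub>R axis i 1))) has_real_derivative
        f (r *\<^sub>R y) + y $ i * (r * partial i f (r *\<^sub>R y))) (at 0)"
      using DERIV_mult[OF 2 1] by (simp add: algebra_simps)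
  qed (intro continuous_intros c; simp)+
  then have *: "2 * (\<integral>y. (y $ i * y $ i) * f (r *\<^sub>R y) \<partial>unif_ball) 
      = kmean f r + r * (\<integral>y. (1 - (norm y)\<^sup>2) * (partial i f (r *\<^sub>R y) * y $ i) \<partial>unif_ball)" for i
  proof -
    assume a: "\<And>i. (\<integral>y. 2 * (y \<bullet> axis i 1) * (y $ i * f (r *\<^sub>R y)) \<partial>unif_ball)
      = (\<integral>y. (1 - (norm y)\<^sup>2) * (f (r *\<^sub>R y) + y $ i * (r * partial i f (r *\<^sub>R y))) \<partial>unif_ball)"
    have "2 * (\<integral>y. (y $ i * y $ i) * f (r *\<^sub>R y) \<partial>unif_ball) = (\<integral>y. 2 * (y \<bullet> axis i 1) * (y $ i * f (r *\<^sub>R y)) \<partial>unif_ball)"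
      unfolding integral_mult_right_zero[symmetric] by (simp add: inner_axis ac_simps)
    also have "\<dots> = (\<integral>y. (1 - (norm y)\<^sup>2) * f (r *\<^sub>R y) + r * ((1 - (norm y)\<^sup>2) * (partial i f (r *\<^sub>R y) * y $ i)) \<partial>unif_ball)"
      by (subst a) (simp add: algebra_simps)
    also have "\<dots> = kmean f r + r * (\<integral>y. (1 - (norm y)\<^sup>2) * (partial i f (r *\<^sub>R y) * y $ i) \<partial>unif_ball)"
      unfolding kmean_def by (subst Bochner_Integration.integral_add) (auto intro!: i1 i2)
    finally show ?thesis .
  qed
  have "2 * (bmean f r - kmean f r) = 2 * (\<integral>y. f (r *\<^sub>R y) - (1 - (norm y)\<^sup>2) * f (r *\<^sub>R y) \<partial>unif_ball)"
    unfolding bmean_def kmean_def by (simp add: i1 i4)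
  also have "(\<lambda>y::real^'n. f (r *\<^sub>R y) - (1 - (norm y)\<^sup>2) * f (r *\<^sub>R y)) = (\<lambda>y. \<Sum>i\<in>UNIV. (y $ i * y $ i) * f (r *\<^sub>R y))"
    unfolding sum_distrib_right[symmetric] by (simp add: power2_norm_eq_inner inner_vec_def algebra_simps)
  also have "2 * (\<integral>y. (\<Sum>i\<in>UNIV. (y $ i * y $ i) * f (r *\<^sub>R y)) \<partial>unif_ball) = (\<Sum>i\<in>UNIV. 2 * (\<integral>y. (y $ i * y $ i) * f (r *\<^sub>R y) \<partial>unif_ball))"
    by (simp add: i3 sum_distrib_left)
  also have "\<dots> = real CARD('n) * kmean f r + r * (\<Sum>i\<in>UNIV. \<integral>y. (1 - (norm y)\<^sup>2) * (partial i f (r *\<^sub>R y) * y $ i) \<partial>unif_ball)"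
    by (simp add: * sum.distrib sum_distrib_left)
  also have "(\<Sum>i\<in>UNIV. \<integral>y. (1 - (norm y)\<^sup>2) * (partial i f (r *\<^sub>R y) * y $ i) \<partial>unif_ball)
     = (\<integral>y. (1 - (norm y)\<^sup>2) * (gradient f (r *\<^sub>R y) \<bullet> y) \<partial>unif_ball)"
    unfolding inner_vec_def gradient_def sum_distrib_left by (simp add: i2)
  finally show ?thesis by (simp add: algebra_simps)
qed

section \<open>Asymptotics of the radial system\<close>

text \<open>The equation for \<open>k\<close> says that \<open>(r^d k)' = 2 r^(d-1) h\<close>.
  L'Hopital's rule compares \<open>r^d k\<close> with \<open>r^(d-q)\<close>, which tends to
  infinity because \<open>q < d\<close>.\<close>

lemma radial_step_decay:
  fixes h k :: "real \<Rightarrow> real" and d q :: nat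
  assumes k: "\<And>r. r > 0 \<Longrightarrow> (k has_real_derivative (2 * h r - real d * k r) / r) (at r)"
    and "q < d" and h: "((\<lambda>r. r ^ q * h r) \<longlongrightarrow> L) at_top"
  shows "((\<lambda>r. r ^ q * k r) \<longlongrightarrow> 2 * L / (real d - real q)) at_top"
proof -
  have "((\<lambda>r. (r ^ d * k r) / r ^ (d - q)) \<longlongrightarrow> 2 * L / (real d - real q)) at_top"
  proof (rule lhospital_at_top_at_top)
    show "filterlim (\<lambda>r::real. r ^ (d - q)) at_top at_top"
      using \<open>q < d\<close> by (intro filterlim_pow_at_top filterlim_ident) auto
    show "\<forall>\<^sub>F r in at_top. real (d - q) * r ^ (d - q - 1) \<noteq> 0"
      using eventually_gt_at_top[of 0] by eventually_elim (use \<open>q < d\<close> in auto)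
    show "\<forall>\<^sub>F r in at_top. ((\<lambda>r. r ^ d * k r) has_real_derivative 2 * r ^ (d - 1) * h r) (at r)"
      using eventually_gt_at_top[of 0]
    proof eventually_elim
      case (elim r)
      show ?case
        by (rule DERIV_cong[OF DERIV_mult[OF DERIV_pow k[OF elim]]])
           (use \<open>q < d\<close> elim in \<open>cases d; simp add: field_simps\<close>)
    qed
    show "\<forall>\<^sub>F r in at_top. ((\<lambda>r. r ^ (d - q)) has_real_derivative real (d - q) * r ^ (d - q - 1)) (at r)"
      by (intro always_eventually allI) (auto intro!: derivative_eq_intros)
    have "\<forall>\<^sub>F r in at_top. 2 / (real d - real q) * (r ^ q * h r) = 2 * r ^ (d - 1) * h r / (real (d - q) * r ^ (d - q - 1))"
      using eventually_gt_at_top[of 0]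
    proof eventually_elim
      case (elim r)
      have "r ^ (d - 1) = r ^ q * r ^ (d - q - 1)" using \<open>q < d\<close> by (simp flip: power_add)
      then show ?case using elim \<open>q < d\<close> by (simp add: of_nat_diff)
    qed
    moreover have "((\<lambda>r. 2 / (real d - real q) * (r ^ q * h r)) \<longlongrightarrow> 2 / (real d - real q) * L) at_top"
      by (intro tendsto_intros h)
    ultimately show "((\<lambda>r. 2 * r ^ (d - 1) * h r / (real (d - q) * r ^ (d - q - 1))) \<longlongrightarrow> 2 * L / (real d - real q)) at_top"
      by (simp add: tendsto_cong)
  qed
  moreover have "\<forall>\<^sub>F r in at_top. (r ^ d * k r) / r ^ (d - q) = r ^ q * k r"
    using eventually_gt_at_top[of 0]
  proof eventually_elim
    case (elim r)
    have "r ^ d = r ^ q * r ^ (d - q)" using \<open>q < d\<close> by (simp flip: power_add)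
    then show ?case using elim by simp
  qed
  ultimately show ?thesis by (simp add: tendsto_cong)
qed

text \<open>The same integrating factor as in \<open>radial_step_decay\<close>, now compared with
  \<open>r^(d+q)\<close>.\<close>

lemma radial_step_growth:
  fixes h k :: "real \<Rightarrow> real" and d q :: nat
  assumes k: "\<And>r. r > 0 \<Longrightarrow> (k has_real_derivative (2 * h r - real d * k r) / r) (at r)"
    and "0 < d" and h: "((\<lambda>r. h r / r ^ q) \<longlongrightarrow> L) at_top"
  shows "((\<lambda>r. k r / r ^ q) \<longlongrightarrow> 2 * L / (real d + real q)) at_top"
proof -
  have "((\<lambda>r. (r ^ d * k r) / r ^ (d + q)) \<longlongrightarrow> 2 * L / (real d + real q)) at_top"
  proof (rule lhospital_at_top_at_top)
    show "filterlim (\<lambda>r::real. r ^ (d + q)) at_top at_top"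
      using \<open>0 < d\<close> by (intro filterlim_pow_at_top filterlim_ident) auto
    show "\<forall>\<^sub>F r in at_top. real (d + q) * r ^ (d + q - 1) \<noteq> 0"
      using eventually_gt_at_top[of 0] by eventually_elim (use \<open>0 < d\<close> in auto)
    show "\<forall>\<^sub>F r in at_top. ((\<lambda>r. r ^ d * k r) has_real_derivative 2 * r ^ (d - 1) * h r) (at r)"
      using eventually_gt_at_top[of 0]
    proof eventually_elim
      case (elim r)
      show ?case
        by (rule DERIV_cong[OF DERIV_mult[OF DERIV_pow k[OF elim]]])
           (use \<open>0 < d\<close> elim in \<open>cases d; simp add: field_simps\<close>)
    qed
    show "\<forall>\<^sub>F r in at_top. ((\<lambda>r. r ^ (d + q)) has_real_derivative real (d + q) * r ^ (d + q - 1)) (at r)"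
      by (intro always_eventually allI) (auto intro!: derivative_eq_intros)
    have "\<forall>\<^sub>F r in at_top. 2 / (real d + real q) * (h r / r ^ q) = 2 * r ^ (d - 1) * h r / (real (d + q) * r ^ (d + q - 1))"
      using eventually_gt_at_top[of 0]
    proof eventually_elim
      case (elim r)
      have "r ^ (d + q - 1) = r ^ q * r ^ (d - 1)" using \<open>0 < d\<close> by (simp add: add.commute flip: power_add)
      then show ?case using elim by simp
    qed
    moreover have "((\<lambda>r. 2 / (real d + real q) * (h r / r ^ q)) \<longlongrightarrow> 2 / (real d + real q) * L) at_top"
      by (intro tendsto_intros h)
    ultimately show "((\<lambda>r. 2 * r ^ (d - 1) * h r / (real (d + q) * r ^ (d + q - 1))) \<longlongrightarrow> 2 * L / (real d + real q)) at_top"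
      by (simp add: tendsto_cong)
  qed
  moreover have "\<forall>\<^sub>F r in at_top. (r ^ d * k r) / r ^ (d + q) = k r / r ^ q"
    using eventually_gt_at_top[of 0] by eventually_elim (simp add: power_add)
  ultimately show ?thesis by (simp add: tendsto_cong)
qed

text \<open>The limit \<open>c\<close> is not known beforehand. Subtracting the expected tail
  \<open>L / r^q\<close> leaves a function \<open>F\<close> with derivative
  \<open>o(r^-(q+1))\<close>, so its variation beyond \<open>r\<close> is \<open>o(r^-q)\<close>.
  Hence \<open>F\<close> converges, and its limit is the integration constant.\<close>

lemma antiderivative_decay:
  fixes h h' :: "real \<Rightarrow> real" and q :: nat
  assumes h: "\<And>r. r > 0 \<Longrightarrow> (h has_real_derivative h' r) (at r)"
    and lim: "((\<lambda>r. r ^ (q + 1) * h' r) \<longlongrightarrow> M) at_top" and "0 < q"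
  obtains c where "(h \<longlongrightarrow> c) at_top" "((\<lambda>r. r ^ q * (h r - c)) \<longlongrightarrow> - M / real q) at_top"
proof -
  define L where "L = - M / real q"
  define g :: "real \<Rightarrow> real" where "g r = 1 / r ^ q" for r
  define F where "F r = h r - L * g r" for r
  have g: "(g has_real_derivative - real q / r ^ (q + 1)) (at r)" if "r > 0" for r
    unfolding g_def[abs_def] using that \<open>0 < q\<close>
    by (auto intro!: derivative_eq_intros simp: field_simps simp flip: power_Suc power_add)
  have F: "(F has_real_derivative (r ^ (q + 1) * h' r - M) / r ^ (q + 1)) (at r)" if "r > 0" for r
    unfolding F_def[abs_def]
    by (rule DERIV_cong[OF DERIV_diff[OF h DERIV_cmult[OF g]]])
       (use that \<open>0 < q\<close> in \<open>auto simp: L_def field_simps\<close>)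
  have key: "\<exists>R\<ge>1. \<forall>r s. R \<le> r \<longrightarrow> r \<le> s \<longrightarrow> \<bar>F s - F r\<bar> \<le> \<epsilon> / r ^ q" if "\<epsilon> > 0" for \<epsilon>
  proof -
    have "\<forall>\<^sub>F r in at_top. \<bar>r ^ (q + 1) * h' r - M\<bar> < \<epsilon> * real q"
      using tendstoD[OF lim, of "\<epsilon> * real q"] that \<open>0 < q\<close> by (simp add: dist_real_def)
    then obtain R where R: "\<And>r. R \<le> r \<Longrightarrow> \<bar>r ^ (q + 1) * h' r - M\<bar> < \<epsilon> * real q"
      by (auto simp: eventually_at_top_linorder)
    have "\<bar>F s - F r\<bar> \<le> \<epsilon> / r ^ q" if rs: "max 1 R \<le> r" "r \<le> s" for r s
    proof -
      have b: "\<bar>(x ^ (q + 1) * h' x - M) / x ^ (q + 1)\<bar> \<le> \<epsilon> * real q / x ^ (q + 1)" if "r \<le> x" for x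
        using R[of x] rs that by (simp add: abs_divide divide_right_mono)
      \<comment> \<open>\<open>g\<close> is \<open>1 / r^q\<close>, whose derivative matches the
        bound \<open>b\<close>; hence \<open>F + \<epsilon> g\<close> decreases and
        \<open>F - \<epsilon> g\<close> increases, which confines the variation of
        \<open>F\<close>.\<close>
      have "F s + \<epsilon> * g s \<le> F r + \<epsilon> * g r"
      proof (rule DERIV_nonpos_imp_nonincreasing[OF rs(2)])
        fix x assume x: "r \<le> x" "x \<le> s"
        then have x0: "x > 0" using rs by auto
        have D: "((\<lambda>x. F x + \<epsilon> * g x) has_real_derivative (x ^ (q + 1) * h' x - M) / x ^ (q + 1) + \<epsilon> * (- real q / x ^ (q + 1))) (at x)"
          by (intro DERIV_add DERIV_cmult F g x0)
        moreover have "(x ^ (q + 1) * h' x - M) / x ^ (q + 1) + \<epsilon> * (- real q / x ^ (q + 1)) \<le> 0"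
          using b[OF x(1)] unfolding mult_minus_right minus_divide_left[symmetric] times_divide_eq_right by linarith
        ultimately show "\<exists>y. ((\<lambda>x. F x + \<epsilon> * g x) has_real_derivative y) (at x) \<and> y \<le> 0"
          by blast
      qed
      moreover have "F r - \<epsilon> * g r \<le> F s - \<epsilon> * g s"
      proof (rule DERIV_nonneg_imp_nondecreasing[OF rs(2)])
        fix x assume x: "r \<le> x" "x \<le> s"
        then have x0: "x > 0" using rs by auto
        have D: "((\<lambda>x. F x - \<epsilon> * g x) has_real_derivative (x ^ (q + 1) * h' x - M) / x ^ (q + 1) - \<epsilon> * (- real q / x ^ (q + 1))) (at x)"
          by (intro DERIV_diff DERIV_cmult F g x0)
        moreover have "0 \<le> (x ^ (q + 1) * h' x - M) / x ^ (q + 1) - \<epsilon> * (- real q / x ^ (q + 1))"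
          using b[OF x(1)] unfolding mult_minus_right minus_divide_left[symmetric] times_divide_eq_right by linarith
        ultimately show "\<exists>y. ((\<lambda>x. F x - \<epsilon> * g x) has_real_derivative y) (at x) \<and> 0 \<le> y"
          by blast
      qed
      moreover have "0 \<le> \<epsilon> * g s" "\<epsilon> * g r = \<epsilon> / r ^ q" using rs \<open>\<epsilon> > 0\<close> by (auto simp: g_def)
      ultimately show ?thesis by linarith
    qed
    then show ?thesis by (intro exI[of _ "max 1 R"]) auto
  qed
  \<comment> \<open>The limit \<open>c\<close> is taken along the integers; \<open>key\<close> then
    controls \<open>F\<close> at every real radius.\<close>
  have "Cauchy (\<lambda>n. F (real n))"
  proof (rule metric_CauchyI)
    fix e :: real assume "e > 0"
    obtain R where R: "R \<ge> 1" "\<And>r s. R \<le> r \<Longrightarrow> r \<le> s \<Longrightarrow> \<bar>F s - F r\<bar> \<le> e / 4 / r ^ q"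
      using key[of "e / 4"] \<open>e > 0\<close> by auto
    obtain N where N: "R \<le> real N" using real_arch_simple by blast
    have "dist (F (real m)) (F (real n)) < e" if "m \<ge> N" "n \<ge> N" for m n
    proof -
      have "1 \<le> real N ^ q" using N R(1) by (intro one_le_power) auto
      then have "e / 4 / real N ^ q \<le> e / 4"
        using \<open>e > 0\<close> by (simp add: divide_le_eq)
      moreover have "\<bar>F (real m) - F (real N)\<bar> \<le> e / 4 / real N ^ q" "\<bar>F (real n) - F (real N)\<bar> \<le> e / 4 / real N ^ q"
        using that N by (intro R(2); simp)+
      ultimately show ?thesis using \<open>e > 0\<close> unfolding dist_real_def by linarith
    qed
    then show "\<exists>M. \<forall>m\<ge>M. \<forall>n\<ge>M. dist (F (real m)) (F (real n)) < e" by blast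
  qed
  then obtain c where c: "(\<lambda>n. F (real n)) \<longlonglongrightarrow> c"
    using convergent_eq_Cauchy by blast
  have "((\<lambda>r. r ^ q * (h r - c)) \<longlongrightarrow> L) at_top"
  proof (rule tendstoI)
    fix e :: real assume "e > 0"
    obtain R where R: "R \<ge> 1" "\<And>r s. R \<le> r \<Longrightarrow> r \<le> s \<Longrightarrow> \<bar>F s - F r\<bar> \<le> e / 2 / r ^ q"
      using key[of "e / 2"] \<open>e > 0\<close> by auto
    have "dist (r ^ q * (h r - c)) L < e" if "r \<ge> R" for r
    proof -
      have "(\<lambda>n. \<bar>F (real n) - F r\<bar>) \<longlonglongrightarrow> \<bar>c - F r\<bar>" by (intro tendsto_intros c)
      moreover have "\<forall>\<^sub>F n in sequentially. \<bar>F (real n) - F r\<bar> \<le> e / 2 / r ^ q"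
        using eventually_ge_at_top[of "nat \<lceil>r\<rceil>"] by eventually_elim (intro R(2) that; linarith)
      ultimately have "\<bar>c - F r\<bar> \<le> e / 2 / r ^ q"
        by (intro tendsto_upperbound) auto
      then have "r ^ q * \<bar>c - F r\<bar> \<le> e / 2"
        using that R(1) by (simp add: field_simps)
      moreover have "r ^ q * (h r - c) - L = - (r ^ q * (c - F r))"
        using that R(1) by (simp add: F_def g_def field_simps)
      moreover have "\<bar>r ^ q * (c - F r)\<bar> = r ^ q * \<bar>c - F r\<bar>" using that R(1) by (simp add: abs_mult)
      ultimately show ?thesis using \<open>e > 0\<close> unfolding dist_real_def by simp
    qed
    then show "\<forall>\<^sub>F r in at_top. dist (r ^ q * (h r - c)) L < e"
      by (auto simp: eventually_at_top_linorder)
  qed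
  moreover have "(h \<longlongrightarrow> c) at_top"
  proof -
    have "((\<lambda>r::real. 1 / r ^ q) \<longlongrightarrow> 0) at_top"
      using \<open>0 < q\<close>
      by (intro tendsto_divide_0[OF tendsto_const] filterlim_at_top_imp_at_infinity filterlim_pow_at_top filterlim_ident)
    from tendsto_add[OF tendsto_mult[OF this calculation] tendsto_const[of c]]
    have "((\<lambda>r. 1 / r ^ q * (r ^ q * (h r - c)) + c) \<longlongrightarrow> c) at_top" by simp
    moreover have "\<forall>\<^sub>F r in at_top. 1 / r ^ q * (r ^ q * (h r - c)) + c = h r"
      using eventually_gt_at_top[of 0] by eventually_elim simp
    ultimately show ?thesis by (simp add: tendsto_cong)
  qed
  ultimately show thesis using that by (simp add: L_def)
qed

lemma antiderivative_growth:
  fixes h h' :: "real \<Rightarrow> real" and q :: nat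
  assumes h: "\<And>r. r > 0 \<Longrightarrow> (h has_real_derivative h' r) (at r)"
    and lim: "((\<lambda>r. h' r / r ^ q) \<longlongrightarrow> M) at_top"
  shows "((\<lambda>r. h r / r ^ (q + 1)) \<longlongrightarrow> M / (real q + 1)) at_top"
proof (rule lhospital_at_top_at_top)
  show "filterlim (\<lambda>r::real. r ^ (q + 1)) at_top at_top"
    by (intro filterlim_pow_at_top filterlim_ident) auto
  show "\<forall>\<^sub>F r in at_top. (real q + 1) * r ^ q \<noteq> 0"
    using eventually_gt_at_top[of 0] by eventually_elim auto
  show "\<forall>\<^sub>F r in at_top. (h has_real_derivative h' r) (at r)"
    using eventually_gt_at_top[of 0] by eventually_elim (rule h)
  show "\<forall>\<^sub>F r in at_top. ((\<lambda>r. r ^ (q + 1)) has_real_derivative (real q + 1) * r ^ q) (at r)"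
    by (intro always_eventually allI) (rule DERIV_cong[OF DERIV_pow], simp)
  have "((\<lambda>r. h' r / r ^ q / (real q + 1)) \<longlongrightarrow> M / (real q + 1)) at_top"
    by (intro tendsto_intros lim) auto
  then show "((\<lambda>r. h' r / ((real q + 1) * r ^ q)) \<longlongrightarrow> M / (real q + 1)) at_top"
    by (simp add: mult.commute)
qed

lemma antiderivative_log:
  fixes h h' :: "real \<Rightarrow> real"
  assumes h: "\<And>r. r > 0 \<Longrightarrow> (h has_real_derivative h' r) (at r)"
    and lim: "((\<lambda>r. r * h' r) \<longlongrightarrow> M) at_top"
  shows "((\<lambda>r. h r / ln r) \<longlongrightarrow> M) at_top"
proof (rule lhospital_at_top_at_top)
  show "filterlim (ln :: real \<Rightarrow> real) at_top at_top" by (rule ln_at_top)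
  show "\<forall>\<^sub>F r in at_top. 1 / r \<noteq> (0::real)"
    using eventually_gt_at_top[of 0] by eventually_elim auto
  show "\<forall>\<^sub>F r in at_top. (h has_real_derivative h' r) (at r)"
    using eventually_gt_at_top[of 0] by eventually_elim (rule h)
  show "\<forall>\<^sub>F r in at_top. (ln has_real_derivative 1 / r) (at (r::real))"
    using eventually_gt_at_top[of 0] by eventually_elim (auto intro!: derivative_eq_intros)
  show "((\<lambda>r. h' r / (1 / r)) \<longlongrightarrow> M) at_top"
    using lim by (simp add: mult.commute)
qed

text \<open>The first alternative is that an integration constant, hence a polynomial part, appears.\<close>

lemma radial_system_asymptotics:
  fixes H K :: "nat \<Rightarrow> real \<Rightarrow> real" and m :: nat
  assumes H: "\<And>j r. r > 0 \<Longrightarrow> (H j has_real_derivative - (r / 2) * K (Suc j) r) (at r)"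
    and K: "\<And>j r. r > 0 \<Longrightarrow> (K j has_real_derivative (2 * H j r - real (2 * m + 2) * K j r) / r) (at r)"
    and A: "((\<lambda>r. r ^ (2 * m) * H m r) \<longlongrightarrow> A) at_top"
    and j: "1 \<le> j" "j \<le> m"
  shows "(\<exists>q c. c \<noteq> 0 \<and> ((\<lambda>r. H j r / r ^ q) \<longlongrightarrow> c) at_top) \<or>
    ((\<lambda>r. r ^ (2 * j) * H j r) \<longlongrightarrow>
       A / (\<Prod>i\<in>{Suc j..m}. real ((2 * m + 2 - 2 * i) * (2 * i - 2)))) at_top"
  using j(2,1)
\<comment> \<open>Downward induction from \<open>m\<close>: each step inverts one Laplacian, first
  through the equation for \<open>K\<close>, then through the one for \<open>H\<close>.\<close>
proof (induction j rule: inc_induct)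
  case base
  then show ?case using A by simp
next
  case (step j)
  define B where "B = A / (\<Prod>i\<in>{Suc (Suc j)..m}. real ((2 * m + 2 - 2 * i) * (2 * i - 2)))"
  from step have "(\<exists>q c. c \<noteq> 0 \<and> ((\<lambda>r. H (Suc j) r / r ^ q) \<longlongrightarrow> c) at_top) \<or>
    ((\<lambda>r. r ^ (2 * Suc j) * H (Suc j) r) \<longlongrightarrow> B) at_top" by (simp add: B_def)
  then show ?case
  proof
    assume "\<exists>q c. c \<noteq> 0 \<and> ((\<lambda>r. H (Suc j) r / r ^ q) \<longlongrightarrow> c) at_top"
    then obtain q c where c: "c \<noteq> 0" "((\<lambda>r. H (Suc j) r / r ^ q) \<longlongrightarrow> c) at_top" by blast
    \<comment> \<open>Growth of degree \<open>q\<close> at level \<open>Suc j\<close> becomes growth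
      of degree \<open>q + 2\<close> at level \<open>j\<close>, again with a nonzero coefficient; an
      integration constant is of lower order.\<close>
    define c1 where "c1 = 2 * c / (real (2 * m + 2) + real q)"
    have "((\<lambda>r. K (Suc j) r / r ^ q) \<longlongrightarrow> c1) at_top"
      unfolding c1_def by (rule radial_step_growth[OF K _ c(2)]) auto
    then have "((\<lambda>r. - (1 / 2) * (K (Suc j) r / r ^ q)) \<longlongrightarrow> - (1 / 2) * c1) at_top"
      by (intro tendsto_intros)
    moreover have "\<forall>\<^sub>F r in at_top. - (1 / 2) * (K (Suc j) r / r ^ q) = - (r / 2) * K (Suc j) r / r ^ (q + 1)"
      using eventually_gt_at_top[of 0] by eventually_elim simp
    ultimately have "((\<lambda>r. - (r / 2) * K (Suc j) r / r ^ (q + 1)) \<longlongrightarrow> - (1 / 2) * c1) at_top"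
      by (rule Lim_transform_eventually)
    from antiderivative_growth[OF H this]
    have "((\<lambda>r. H j r / r ^ (q + 1 + 1)) \<longlongrightarrow> - (1 / 2) * c1 / (real (q + 1) + 1)) at_top" .
    moreover have "- (1 / 2) * c1 / (real (q + 1) + 1) \<noteq> 0" using c(1) by (auto simp: c1_def)
    ultimately show ?thesis by blast
  next
    assume l: "((\<lambda>r. r ^ (2 * Suc j) * H (Suc j) r) \<longlongrightarrow> B) at_top"
    \<comment> \<open>The equation for \<open>K\<close> contributes the denominator
      \<open>2 * m + 2 - 2 * Suc j\<close> and the integration the denominator \<open>2 * j\<close>.
      For \<open>i = Suc j\<close> these are the two factors that the product acquires.\<close>
    define c1 where "c1 = 2 * B / (real (2 * m + 2) - real (2 * Suc j))"
    have "((\<lambda>r. r ^ (2 * Suc j) * K (Suc j) r) \<longlongrightarrow> c1) at_top"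
      unfolding c1_def by (rule radial_step_decay[OF K _ l]) (use step in auto)
    then have "((\<lambda>r. - (1 / 2) * (r ^ (2 * Suc j) * K (Suc j) r)) \<longlongrightarrow> - (1 / 2) * c1) at_top"
      by (intro tendsto_intros)
    then have "((\<lambda>r. r ^ (2 * j + 1) * (- (r / 2) * K (Suc j) r)) \<longlongrightarrow> - (1 / 2) * c1) at_top"
      by (simp add: mult_ac)
    from antiderivative_decay[OF H this] obtain c where
      c: "(H j \<longlongrightarrow> c) at_top" "((\<lambda>r. r ^ (2 * j) * (H j r - c)) \<longlongrightarrow> - (- (1 / 2) * c1) / real (2 * j)) at_top"
      using step by auto
    \<comment> \<open>The integration constant \<open>c\<close> decides the alternative: a nonzero
      one is polynomial growth of degree 0.\<close>
    show ?thesis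
    proof (cases "c = 0")
      case True
      have "- (- (1 / 2) * c1) / real (2 * j) = A / (\<Prod>i\<in>{Suc j..m}. real ((2 * m + 2 - 2 * i) * (2 * i - 2)))"
      proof -
        have "(\<Prod>i\<in>{Suc j..m}. real ((2 * m + 2 - 2 * i) * (2 * i - 2))) =
           real ((2 * m + 2 - 2 * Suc j) * (2 * Suc j - 2)) * (\<Prod>i\<in>{Suc (Suc j)..m}. real ((2 * m + 2 - 2 * i) * (2 * i - 2)))"
          using step by (subst prod.atLeast_Suc_atMost) auto
        moreover have "real (2 * m + 2 - 2 * Suc j) = real (2 * m + 2) - real (2 * Suc j)"
          using step by (subst of_nat_diff) auto
        ultimately show ?thesis
          by (simp add: c1_def B_def)
      qed
      then show ?thesis using c(2) True by simp
    next
      case False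
      then show ?thesis using c(1) by (intro disjI1 exI[of _ 0] exI[of _ c]) simp
    qed
  qed
qed

section \<open>Asymptotics of the ball averages of \<open>u\<close>\<close>

lemma integral_lborel_affine:
  fixes f :: "'a::euclidean_space \<Rightarrow> real"
  assumes [measurable]: "f \<in> borel_measurable borel" and "c \<noteq> 0"
  shows "(\<integral>x. f x \<partial>lborel) = \<bar>c\<bar> ^ DIM('a) * (\<integral>x. f (t + c *\<^sub>R x) \<partial>lborel)"
proof -
  have "(\<integral>x. f x \<partial>lborel) = (\<integral>x. f x \<partial>density (distr lborel borel (\<lambda>x. t + c *\<^sub>R x)) (\<lambda>_. ennreal (\<bar>c\<bar> ^ DIM('a))))"
    by (rule arg_cong[where f="\<lambda>M. integral\<^sup>L M f", OF lborel_affine[OF \<open>c \<noteq> 0\<close>, of t]])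
  also have "\<dots> = (\<integral>x. \<bar>c\<bar> ^ DIM('a) *\<^sub>R f x \<partial>distr lborel borel (\<lambda>x. t + c *\<^sub>R x))"
    by (rule integral_density) auto
  also have "\<dots> = (\<integral>x. \<bar>c\<bar> ^ DIM('a) *\<^sub>R f (t + c *\<^sub>R x) \<partial>lborel)"
    by (rule integral_distr) auto
  finally show ?thesis by simp
qed

lemma bmean_scale:
  fixes f :: "'a::euclidean_space \<Rightarrow> real"
  assumes [measurable]: "f \<in> borel_measurable borel" and "r > 0"
  shows "r ^ DIM('a) * bmean f r =
    (\<integral>z. indicator (cball 0 r) z * f z \<partial>lborel) / unit_ball_vol (real DIM('a))"
proof -
  have [measurable]: "cball (0::'a) r \<in> sets borel" by (simp add: borel_closed)
  have "(\<integral>z. indicator (cball 0 r) z * f z \<partial>lborel) =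
    r ^ DIM('a) * (\<integral>y. indicator (cball 0 r) (0 + r *\<^sub>R y) * f (0 + r *\<^sub>R y) \<partial>lborel)"
    using \<open>r > 0\<close> by (subst integral_lborel_affine[where c=r and t=0]) auto
  also have "(\<lambda>y::'a. indicator (cball 0 r) (0 + r *\<^sub>R y) * f (0 + r *\<^sub>R y))
     = (\<lambda>y. indicator (cball 0 1) y * f (r *\<^sub>R y))"
    using \<open>r > 0\<close> by (auto simp: indicator_def)
  finally show ?thesis
    unfolding bmean_def by (subst integral_unif_ball) auto
qed

lemma bmean_scaled_limit:
  fixes f :: "'a::euclidean_space \<Rightarrow> real"
  assumes f: "integrable lborel f"
  shows "((\<lambda>r. r ^ DIM('a) * bmean f r) \<longlongrightarrow>
    (\<integral>z. f z \<partial>lborel) / unit_ball_vol (real DIM('a))) at_top"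
proof -
  have [measurable]: "f \<in> borel_measurable borel" using f by simp
  have [measurable]: "cball (0::'a) r \<in> sets borel" for r by (simp add: borel_closed)
  have "((\<lambda>r. \<integral>z. indicator (cball 0 r) z * f z \<partial>lborel) \<longlongrightarrow> (\<integral>z. f z \<partial>lborel)) at_top"
  proof (rule integral_dominated_convergence_at_top[where w="\<lambda>z. norm (f z)"])
    show "AE z in lborel. ((\<lambda>r. indicator (cball 0 r) z * f z) \<longlongrightarrow> f z) at_top"
    proof (rule AE_I2, rule tendsto_eventually)
      fix z :: 'a
      show "\<forall>\<^sub>F r in at_top. indicator (cball 0 r) z * f z = f z"
        using eventually_ge_at_top[of "norm z"] by eventually_elim simp
    qed
    show "integrable lborel (\<lambda>z. norm (f z))" by (rule integrable_norm[OF f])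
    show "\<forall>\<^sub>F r in at_top. AE z in lborel. norm (indicator (cball 0 r) z * f z) \<le> norm (f z)"
      by (intro always_eventually allI AE_I2) (simp add: indicator_def)
  qed measurable
  then have "((\<lambda>r. (\<integral>z. indicator (cball 0 r) z * f z \<partial>lborel) / unit_ball_vol (real DIM('a)))
     \<longlongrightarrow> (\<integral>z. f z \<partial>lborel) / unit_ball_vol (real DIM('a))) at_top"
    by (rule tendsto_divide) (rule tendsto_const, simp)
  moreover have "\<forall>\<^sub>F r in at_top. (\<integral>z. indicator (cball 0 r) z * f z \<partial>lborel) / unit_ball_vol (real DIM('a))
      = r ^ DIM('a) * bmean f r"
    using eventually_gt_at_top[of 0] by eventually_elim (rule bmean_scale[symmetric], measurable)
  ultimately show ?thesis by (rule Lim_transform_eventually)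
qed

lemma integrable_bmean:
  fixes f :: "'a::euclidean_space \<Rightarrow> real"
  shows "continuous_on UNIV f \<Longrightarrow> integrable unif_ball (\<lambda>y. f (r *\<^sub>R y))"
  by (rule integrable_unif_ball, erule continuous_on_compose2) (auto intro!: continuous_intros)

text \<open>Curvature bounds hold only outside some ball of radius \<open>R\<close>. This ball fills
  at most the fraction \<open>(R / r)^n\<close> of the ball of radius \<open>r\<close>, so the lack
  of information inside it costs at most \<open>B\<close> times that fraction.\<close>

lemma bmean_ge:
  fixes f :: "'a::euclidean_space \<Rightarrow> real"
  assumes f: "continuous_on UNIV f" and "B \<ge> 0" "R > 0" "r > 0"
    and far: "\<And>z. R < norm z \<Longrightarrow> norm z \<le> r \<Longrightarrow> 0 \<le> f z"
    and near: "\<And>z. norm z \<le> R \<Longrightarrow> - B \<le> f z"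
  shows "- B * R ^ DIM('a) / r ^ DIM('a) \<le> bmean f r"
proof -
  have [measurable]: "cball (0::'a) r \<in> sets borel" for r by (simp add: borel_closed)
  have "r ^ DIM('a) * bmean (indicator (cball (0::'a) R)) r =
     (\<integral>z. indicator (cball 0 r) z * indicator (cball (0::'a) R) z \<partial>lborel) / unit_ball_vol (real DIM('a))"
    by (rule bmean_scale) (use \<open>r > 0\<close> in auto)
  also have "(\<lambda>z. indicator (cball 0 r) z * indicator (cball (0::'a) R) z :: real) = indicator (cball 0 (min r R))"
    by (auto simp: indicator_def)
  also have "(\<integral>z. indicator (cball (0::'a) (min r R)) z \<partial>lborel) / unit_ball_vol (real DIM('a)) = min r R ^ DIM('a)"
    using \<open>R > 0\<close> \<open>r > 0\<close> by (simp add: content_cball)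
  also have "\<dots> \<le> R ^ DIM('a)"
    using \<open>R > 0\<close> \<open>r > 0\<close> by (intro power_mono) auto
  finally have ind: "bmean (indicator (cball (0::'a) R)) r \<le> R ^ DIM('a) / r ^ DIM('a)"
    using \<open>r > 0\<close> by (simp add: field_simps)
  have "- B * bmean (indicator (cball (0::'a) R)) r = (\<integral>y. - B * indicator (cball (0::'a) R) (r *\<^sub>R y) \<partial>unif_ball)"
    by (simp add: bmean_def)
  also have "\<dots> \<le> bmean f r"
    unfolding bmean_def
  proof (rule integral_mono_AE)
    show "integrable unif_ball (\<lambda>y. - B * indicator (cball (0::'a) R) (r *\<^sub>R y) :: real)"
      by (rule unif_ball.integrable_const_bound[where B=B])
         (use \<open>B \<ge> 0\<close> in \<open>auto simp: indicator_def\<close>)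
    show "AE y in unif_ball. - B * indicator (cball (0::'a) R) (r *\<^sub>R y) \<le> f (r *\<^sub>R y)"
      using AE_unif_ball
    proof eventually_elim
      case (elim y)
      then have "norm (r *\<^sub>R y) \<le> r" using \<open>r > 0\<close> by simp
      then show ?case using far[of "r *\<^sub>R y"] near[of "r *\<^sub>R y"] by (cases "norm (r *\<^sub>R y) \<le> R") auto
    qed
  qed (rule integrable_bmean[OF f])
  finally show ?thesis
    using mult_left_mono[OF ind \<open>B \<ge> 0\<close>] by simp
qed

lemma continuous_lower_bound_cball:
  fixes f :: "'a::euclidean_space \<Rightarrow> real"
  assumes "continuous_on UNIV f"
  obtains B where "B \<ge> 0" "\<And>z. norm z \<le> R \<Longrightarrow> - B \<le> f z"
proof -
  have "bounded (f ` cball 0 R)"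
    by (intro compact_imp_bounded compact_continuous_image continuous_on_subset[OF assms]) auto
  then obtain B where B: "B > 0" "\<forall>y\<in>cball 0 R. norm (f y) \<le> B"
    unfolding bounded_pos by auto
  show thesis
  proof (rule that[of B])
    fix z :: 'a assume "norm z \<le> R"
    then have "norm (f z) \<le> B" using B by simp
    then show "- B \<le> f z" by simp
  qed (use B in simp)
qed

section \<open>Jensen's inequality for squares and exponentials\<close>

lemma measure_unif_ball_UNIV [simp]: "measure unif_ball UNIV = 1"
  using unif_ball.prob_space by simp

lemma square_integral_le:
  fixes f :: "'a::euclidean_space \<Rightarrow> real"
  assumes "continuous_on UNIV f"
  shows "(\<integral>y. f y \<partial>unif_ball)\<^sup>2 \<le> (\<integral>y. (f y)\<^sup>2 \<partial>unif_ball)"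
proof -
  define M where "M = (\<integral>y. f y \<partial>unif_ball)"
  have i: "integrable unif_ball f" "integrable unif_ball (\<lambda>y. (f y)\<^sup>2)"
    by (intro integrable_unif_ball continuous_intros assms)+
  have "0 \<le> (\<integral>y. (f y - M)\<^sup>2 \<partial>unif_ball)" by simp
  also have "\<dots> = (\<integral>y. (f y)\<^sup>2 - 2 * M * f y + M\<^sup>2 \<partial>unif_ball)"
    by (simp add: power2_diff algebra_simps)
  also have "\<dots> = (\<integral>y. (f y)\<^sup>2 \<partial>unif_ball) - 2 * M * M + M\<^sup>2"
    using i by (simp add: M_def)
  finally show ?thesis unfolding M_def by (simp add: power2_eq_square)
qed

lemma exp_integral_le:
  fixes f :: "'a::euclidean_space \<Rightarrow> real"
  assumes "continuous_on UNIV f"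
  shows "exp (\<integral>y. f y \<partial>unif_ball) \<le> (\<integral>y. exp (f y) \<partial>unif_ball)"
proof -
  define M where "M = (\<integral>y. f y \<partial>unif_ball)"
  have i: "integrable unif_ball f" "integrable unif_ball (\<lambda>y. exp (f y))"
    by (intro integrable_unif_ball continuous_intros assms)+
  \<comment> \<open>The tangent line of the exponential at the mean \<open>M\<close> lies below its
    graph, and its average is \<open>exp M\<close>.\<close>
  have "(\<integral>y. exp M * (1 - M) + exp M * f y \<partial>unif_ball) \<le> (\<integral>y. exp (f y) \<partial>unif_ball)"
  proof (rule integral_mono)
    fix y
    have "exp M * (1 + (f y - M)) \<le> exp M * exp (f y - M)"
      by (intro mult_left_mono exp_ge_add_one_self) auto
    then show "exp M * (1 - M) + exp M * f y \<le> exp (f y)"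
      by (simp add: algebra_simps flip: exp_add)
  qed (use i in auto)
  also have "(\<integral>y. exp M * (1 - M) + exp M * f y \<partial>unif_ball) = exp M * (1 - M) + exp M * M"
    using i by (simp add: M_def)
  finally show ?thesis by (simp add: M_def algebra_simps)
qed

lemma near_infinity_norm:
  fixes P :: "'a::real_normed_vector \<Rightarrow> bool"
  assumes "near_infinity P"
  obtains R where "R > 0" "\<And>x. R < norm x \<Longrightarrow> P x"
proof -
  obtain K where K: "compact K" "\<And>x. x \<notin> K \<Longrightarrow> P x" using assms by (auto simp: near_infinity_def)
  then obtain R where R: "R > 0" "\<forall>x\<in>K. norm x \<le> R"
    using compact_imp_bounded bounded_pos by metis
  show thesis
  proof (rule that[OF R(1)])
    show "P x" if "R < norm x" for x using that K(2)[of x] R(2) by fastforce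
  qed
qed

section \<open>The normalising constant in even dimension\<close>

lemma prod_even_factors:
  "(\<Prod>i\<in>{2..m}. real ((2 * m + 2 - 2 * i) * (2 * i - 2))) = 4 ^ (m - 1) * (fact (m - 1))\<^sup>2"
proof -
  have A: "(\<Prod>i\<in>{2..m}. real (2 * i - 2)) = 2 ^ (m - 1) * fact (m - 1)"
  proof (induction m)
    case (Suc m)
    then show ?case
      by (cases m) (simp_all add: prod.nat_ivl_Suc' algebra_simps)
  qed simp
  \<comment> \<open>The reflection of \<open>i\<close> to \<open>m + 2 - i\<close> exchanges the two
    kinds of factors.\<close>
  have "(\<Prod>i\<in>{2..m}. real (2 * m + 2 - 2 * i)) = (\<Prod>i\<in>{2..m}. real (2 * i - 2))"
    by (subst prod.atLeastAtMost_rev) (intro prod.cong refl, auto)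
  then have "(\<Prod>i\<in>{2..m}. real ((2 * m + 2 - 2 * i) * (2 * i - 2))) = (2 ^ (m - 1) * fact (m - 1)) * (2 ^ (m - 1) * fact (m - 1))"
    unfolding of_nat_mult prod.distrib A by simp
  also have "\<dots> = (2 * 2) ^ (m - 1) * (fact (m - 1) * fact (m - 1))"
    unfolding power_mult_distrib by (simp only: mult_ac)
  finally show ?thesis by (simp add: power2_eq_square)
qed

text \<open>The sphere bounds a ball of odd dimension \<open>2 * m + 1\<close>, whose volume is a
  rational multiple of \<open>pi ^ m\<close>. The right side is the factor that turns the limit of
  \<open>r^2\<close> times the average of \<open>-\<Delta>u\<close>, divided by \<open>n\<close>,
  back into the total Q-curvature.\<close>

lemma sphere_volume_even:
  assumes "CARD('n::finite) = 2 * m" "m \<ge> 1"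
  shows "fact (CARD('n) - 1) * sphere_volume TYPE('n) / 2
    = real (2 * m) * unit_ball_vol (real (2 * m)) * (4 ^ (m - 1) * (fact (m - 1))\<^sup>2)"
proof -
  obtain k where m: "m = Suc k" using assms by (cases m) auto
  have d: "DIM((real ^ 'n) \<times> real) = 2 * m + 1" using assms by simp
  have "sphere_volume TYPE('n) = real (2 * m + 1) * unit_ball_vol (real (2 * m + 1))"
    unfolding sphere_volume_def surface_measure_sphere d ..
  also have "unit_ball_vol (real (2 * m + 1)) = 2 ^ (2 * Suc m) * fact (Suc m) / fact (2 * Suc m) * pi ^ m"
    by (rule unit_ball_vol_odd)
  finally have sv: "sphere_volume TYPE('n) = real (2 * m + 1) * (2 ^ (2 * Suc m) * fact (Suc m) / fact (2 * Suc m) * pi ^ m)" .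
  have f: "fact (2 * Suc m) = (2 * real m + 2) * (2 * real m + 1) * (2 * real m) * fact (2 * m - 1)"
    by (simp add: m fact_Suc algebra_simps)
  have f': "fact (Suc m) = (real m + 1) * real m * fact (m - 1)" "fact m = real m * fact (m - 1)"
    by (simp_all add: m fact_Suc algebra_simps)
  have p: "(2::real) ^ (2 * Suc m) = 16 * 4 ^ (m - 1)" by (simp add: m power_mult)
  \<comment> \<open>Once the factorials are reduced to \<open>fact (2 * m - 1)\<close> and
    \<open>fact (m - 1)\<close>, the claim is an identity of rational functions in these five
    quantities.\<close>
  define N X F P q where "N = real m" "X = (fact (2 * m - 1) :: real)" "F = (fact (m - 1) :: real)"
    "P = pi ^ m" "q = (4::real) ^ (m - 1)"
  have pos: "N > 0" "X > 0" "F > 0" using assms by (auto simp: N_X_F_P_q_def)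
  have "X * ((2 * N + 1) * (16 * q * ((N + 1) * N * F) / ((2 * N + 2) * (2 * N + 1) * (2 * N) * X) * P)) / 2
    = 2 * N * (P / (N * F)) * (q * F\<^sup>2)"
  proof -
    have "X * ((2 * N + 1) * (16 * q * ((N + 1) * N * F) / ((2 * N + 2) * (2 * N + 1) * (2 * N) * X) * P))
      = (((N + 1) * ((2 * N + 1) * (N * X))) * (16 * q * F * P)) / (((N + 1) * ((2 * N + 1) * (N * X))) * 4)"
      by (simp add: algebra_simps)
    also have "\<dots> = 4 * q * F * P" using pos by (subst mult_divide_mult_cancel_left) auto
    finally show ?thesis using pos by (simp add: power2_eq_square)
  qed
  then show ?thesis
    unfolding sv f p f' assms(1) unit_ball_vol_even N_X_F_P_q_def
    by (simp only: of_nat_mult of_nat_add of_nat_numeral of_nat_1)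
qed

section \<open>From curvature bounds to radial asymptotics\<close>

lemma scalar_curvature_lower_bound:
  fixes u :: "real ^ 'n::finite \<Rightarrow> real"
  assumes "CARD('n) \<ge> 2" "scalar_curvature u x \<ge> c"
  shows "c / (2 * (real CARD('n) - 1)) * exp (2 * u x) \<le>
    - laplacian u x - (real CARD('n) - 2) / 2 * (norm (gradient u x))\<^sup>2"
proof -
  define X where "X = - laplacian u x - (real CARD('n) - 2) / 2 * (norm (gradient u x))\<^sup>2"
  have pos: "2 * (real CARD('n) - 1) > 0" using assms(1) by simp
  have "c \<le> 2 * (real CARD('n) - 1) * exp (- 2 * u x) * X"
    using assms(2) by (simp add: scalar_curvature_def X_def)
  then have "c * exp (2 * u x) \<le> (2 * (real CARD('n) - 1) * exp (- 2 * u x) * X) * exp (2 * u x)"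
    by (intro mult_right_mono) auto
  also have "\<dots> = 2 * (real CARD('n) - 1) * X * (exp (- 2 * u x) * exp (2 * u x))"
    by (simp only: mult_ac)
  also have "exp (- 2 * u x) * exp (2 * u x) = 1" by (simp flip: exp_add)
  finally have "c * exp (2 * u x) \<le> X * (2 * (real CARD('n) - 1))" by (simp add: mult.commute)
  then show ?thesis
    unfolding X_def[symmetric] using pos by (simp add: pos_divide_le_eq)
qed

lemma Q_times_volume:
  "Q_curvature u x * exp (real CARD('n) * u x) = neg_lap_pow (CARD('n) div 2) u x"
  for u :: "real ^ 'n::finite \<Rightarrow> real"
  by (simp add: Q_curvature_def)

text \<open>The averaged inequality \<open>far\<close> does three things: it rules out the
  polynomial alternative of the radial system, it gives the sign of \<open>\<alpha>\<close>, and it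
  bounds the energy on large balls. The behaviour of \<open>bmean u\<close> then follows by one more
  pass through the system, from \<open>H 1\<close> to \<open>H 0\<close>.\<close>

lemma radial_asymptotics:
  fixes u :: "real ^ 'n::finite \<Rightarrow> real"
  assumes n: "CARD('n) \<ge> 4" "even CARD('n)" and u: "smooth u" and Q: "finite_total_Q u"
    and "R > 0" and far: "\<And>x. R < norm x \<Longrightarrow> (real CARD('n) - 2) / 2 * (norm (gradient u x))\<^sup>2 \<le> - laplacian u x"
  obtains \<alpha> M S where "0 \<le> \<alpha>"
    "total_Q u = \<alpha> * (fact (CARD('n) - 1) * sphere_volume TYPE('n) / 2)"
    "((\<lambda>r. r\<^sup>2 * bmean (\<lambda>x. - laplacian u x) r) \<longlongrightarrow> real CARD('n) * \<alpha>) at_top"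
    "((\<lambda>r. bmean u r / ln r) \<longlongrightarrow> - \<alpha>) at_top"
    "\<And>r. S \<le> r \<Longrightarrow> r\<^sup>2 * bmean (\<lambda>x. (norm (gradient u x))\<^sup>2) r \<le> M"
proof -
  obtain m where m: "CARD('n) = 2 * m" using n(2) by blast
  have m2: "m \<ge> 2" using n m by simp
  then have m1: "0 \<le> real m - 1" by simp
  define H where "H j = bmean (neg_lap_pow j u)" for j
  define K where "K j = kmean (neg_lap_pow j u)" for j
  define E where "E = bmean (\<lambda>x. (norm (gradient u x))\<^sup>2)"
  have H': "(H j has_real_derivative - (r / 2) * K (Suc j) r) (at r)" for j r
  proof -
    have "K (Suc j) r = - kmean (laplacian (neg_lap_pow j u)) r"
      by (simp add: K_def kmean_def)
    then show ?thesis
      using bmean_derivative[OF smooth_neg_lap_pow[OF u], of j r]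
      by (simp add: H_def bmean_derivative_eq[OF smooth_neg_lap_pow[OF u]])
  qed
  have K': "(K j has_real_derivative (2 * H j r - real (2 * m + 2) * K j r) / r) (at r)" if "r > 0" for j r
    unfolding K_def
  proof (rule DERIV_cong[OF kmean_derivative[OF smooth_neg_lap_pow[OF u]]])
    show "(\<integral>y. (1 - (norm y)\<^sup>2) * (gradient (neg_lap_pow j u) (r *\<^sub>R y) \<bullet> y) \<partial>unif_ball) =
      (2 * H j r - real (2 * m + 2) * kmean (neg_lap_pow j u) r) / r"
      using kmean_derivative_eq[OF smooth_neg_lap_pow[OF u], of r j] that m
      by (simp add: H_def field_simps)
  qed
  define A where "A = total_Q u / unit_ball_vol (real (2 * m))"
  have HA: "((\<lambda>r. r ^ (2 * m) * H m r) \<longlongrightarrow> A) at_top"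
  proof -
    have "integrable lborel (neg_lap_pow m u)"
      using Q unfolding finite_total_Q_def Q_times_volume by (simp add: m)
    from bmean_scaled_limit[OF this] show ?thesis
      unfolding A_def total_Q_def Q_times_volume by (simp add: m H_def)
  qed
  define A1 where "A1 = A / (4 ^ (m - 1) * (fact (m - 1))\<^sup>2)"
  have sys: "(\<exists>q c. c \<noteq> 0 \<and> ((\<lambda>r. H 1 r / r ^ q) \<longlongrightarrow> c) at_top) \<or> ((\<lambda>r. r ^ 2 * H 1 r) \<longlongrightarrow> A1) at_top"
  proof -
    have "(\<exists>q c. c \<noteq> 0 \<and> ((\<lambda>r. H 1 r / r ^ q) \<longlongrightarrow> c) at_top) \<or>
      ((\<lambda>r. r ^ (2 * 1) * H 1 r) \<longlongrightarrow> A / (\<Prod>i\<in>{Suc 1..m}. real ((2 * m + 2 - 2 * i) * (2 * i - 2)))) at_top"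
      by (rule radial_system_asymptotics[OF H' K' HA]) (use m2 in auto)
    moreover have "{Suc 1..m} = {2..m}" by auto
    ultimately show ?thesis unfolding A1_def by (simp only: prod_even_factors mult_1_right)
  qed
  have H1: "H 1 = bmean (\<lambda>x. - laplacian u x)" by (simp add: H_def)
  have cg: "continuous_on UNIV (gradient u)" by (rule smooth_gradient_continuous[OF u])
  have cl: "continuous_on UNIV (laplacian u)" by (rule smooth_continuous[OF smooth_laplacian[OF u]])
  have cg2: "continuous_on UNIV (\<lambda>x. (norm (gradient u x))\<^sup>2)"
    by (intro continuous_intros cg)
  have cf: "continuous_on UNIV (\<lambda>x. - laplacian u x - (real CARD('n) - 2) / 2 * (norm (gradient u x))\<^sup>2)"
    by (intro continuous_intros cg cl)
  obtain B where B: "B \<ge> 0" "\<And>z. norm z \<le> R \<Longrightarrow> - B \<le> - laplacian u z - (real CARD('n) - 2) / 2 * (norm (gradient u z))\<^sup>2"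
    using continuous_lower_bound_cball[OF cf] by blast
  define D where "D = B * R ^ (2 * m)"
  have e1: "(real m - 1) * E r \<le> H 1 r + D / r ^ (2 * m)" if "r > 0" for r
  proof -
    have "- B * R ^ DIM(real ^ 'n) / r ^ DIM(real ^ 'n) \<le> bmean (\<lambda>x. - laplacian u x - (real CARD('n) - 2) / 2 * (norm (gradient u x))\<^sup>2) r"
      by (rule bmean_ge[OF cf B(1) \<open>R > 0\<close> that _ B(2)]) (use far in auto)
    also have "\<dots> = H 1 r - (real CARD('n) - 2) / 2 * E r"
      unfolding H1 E_def bmean_def
      using integrable_bmean[OF cl, of r] integrable_bmean[OF cg2, of r] by simp
    finally show ?thesis by (simp add: m D_def diff_divide_distrib)
  qed
  have E0: "0 \<le> E r" for r unfolding E_def bmean_def by simp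
  \<comment> \<open>Up to sign, \<open>r / 2 * K 1 r\<close> is the derivative of
    \<open>bmean u\<close>, hence an average of
    \<open>gradient u (r *\<^sub>R y) \<bullet> y\<close>; Jensen and Cauchy-Schwarz with
    \<open>norm y \<le> 1\<close> bound its square.\<close>
  have e2: "(r / 2 * K 1 r)\<^sup>2 \<le> E r" for r
  proof -
    have c1: "continuous_on UNIV (\<lambda>y. gradient u (r *\<^sub>R y) \<bullet> y)"
      by (intro continuous_on_inner continuous_on_compose2[OF cg]) (auto intro!: continuous_intros)
    have "(- (r / 2) * K 1 r) = (\<integral>y. gradient u (r *\<^sub>R y) \<bullet> y \<partial>unif_ball)"
      using DERIV_unique[OF H'[of 0 r] bmean_derivative[OF smooth_neg_lap_pow[OF u], of 0 r, folded H_def]]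
      by simp
    then have "(- (r / 2) * K 1 r)\<^sup>2 \<le> (\<integral>y. (gradient u (r *\<^sub>R y) \<bullet> y)\<^sup>2 \<partial>unif_ball)"
      using square_integral_le[OF c1] by simp
    also have "\<dots> \<le> E r"
      unfolding E_def bmean_def
    proof (rule integral_mono_AE)
      show "integrable unif_ball (\<lambda>y. (gradient u (r *\<^sub>R y) \<bullet> y)\<^sup>2)"
        by (intro integrable_unif_ball continuous_on_power c1)
      show "AE y in unif_ball. (gradient u (r *\<^sub>R y) \<bullet> y)\<^sup>2 \<le> (norm (gradient u (r *\<^sub>R y)))\<^sup>2"
        using AE_unif_ball
      proof eventually_elim
        case (elim y)
        have "\<bar>gradient u (r *\<^sub>R y) \<bullet> y\<bar> \<le> norm (gradient u (r *\<^sub>R y)) * norm y"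
          by (rule Cauchy_Schwarz_ineq2)
        also have "\<dots> \<le> norm (gradient u (r *\<^sub>R y))" using elim by (simp add: mult_left_le)
        finally show ?case by (metis abs_ge_zero power_mono power2_abs)
      qed
    qed (rule integrable_bmean[OF cg2])
    finally show ?thesis by (simp add: power_mult_distrib)
  qed
  have inv0: "((\<lambda>r. c / r ^ k) \<longlongrightarrow> 0) at_top" if "k > 0" for c :: real and k :: nat
    using that by (intro tendsto_divide_0[OF tendsto_const] filterlim_at_top_imp_at_infinity filterlim_pow_at_top filterlim_ident)
  have decay: "((\<lambda>r. r ^ 2 * H 1 r) \<longlongrightarrow> A1) at_top"
  proof (rule ccontr)
    assume "\<not> ?thesis"
    then obtain q c where c: "c \<noteq> 0" "((\<lambda>r. H 1 r / r ^ q) \<longlongrightarrow> c) at_top" using sys by blast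
    \<comment> \<open>If \<open>H 1\<close> behaved like \<open>c r^q\<close>, then
      \<open>K 1\<close> would behave like \<open>\<kappa> r^q\<close>, and
      \<open>(r / 2 * K 1 r)^2\<close> would grow like \<open>r^(2q+2)\<close>, faster than
      \<open>H 1\<close>. Dividing by that power gives a positive limit that is at most 0.\<close>
    define \<kappa> where "\<kappa> = 2 * c / (real (2 * m + 2) + real q)"
    have \<kappa>: "((\<lambda>r. K 1 r / r ^ q) \<longlongrightarrow> \<kappa>) at_top"
      unfolding \<kappa>_def by (rule radial_step_growth[OF K' _ c(2)]) auto
    have "((\<lambda>r. (real m - 1) * (K 1 r / r ^ q / 2)\<^sup>2) \<longlongrightarrow> (real m - 1) * (\<kappa> / 2)\<^sup>2) at_top"
      by (intro tendsto_intros \<kappa>) auto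
    moreover have "((\<lambda>r. (H 1 r / r ^ q) * (1 / r ^ (q + 2)) + D / r ^ (2 * m + 2 * q + 2)) \<longlongrightarrow> c * 0 + 0) at_top"
      by (intro tendsto_intros c inv0) auto
    moreover have "\<forall>\<^sub>F r in at_top. (real m - 1) * (K 1 r / r ^ q / 2)\<^sup>2 \<le> (H 1 r / r ^ q) * (1 / r ^ (q + 2)) + D / r ^ (2 * m + 2 * q + 2)"
      using eventually_gt_at_top[of 0]
    proof eventually_elim
      case (elim r)
      have "(real m - 1) * (r / 2 * K 1 r)\<^sup>2 \<le> H 1 r + D / r ^ (2 * m)"
        using e1[OF elim] mult_left_mono[OF e2[of r] m1] by linarith
      then have "(real m - 1) * (r / 2 * K 1 r)\<^sup>2 / r ^ (2 * q + 2) \<le> (H 1 r + D / r ^ (2 * m)) / r ^ (2 * q + 2)"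
        using elim by (intro divide_right_mono) auto
      moreover have "(real m - 1) * (r / 2 * K 1 r)\<^sup>2 / r ^ (2 * q + 2) = (real m - 1) * (K 1 r / r ^ q / 2)\<^sup>2"
      proof -
        have "2 * q + 2 = (q + 1) * 2" by simp
        then have "r ^ (2 * q + 2) = (r ^ (q + 1))\<^sup>2" by (simp only: power_mult)
        then have "(r / 2 * K 1 r)\<^sup>2 / r ^ (2 * q + 2) = (r / 2 * K 1 r / r ^ (q + 1))\<^sup>2" by (simp only: power_divide)
        also have "r / 2 * K 1 r / r ^ (q + 1) = K 1 r / r ^ q / 2" using elim by simp
        finally show ?thesis by (metis times_divide_eq_right)
      qed
      moreover have "(H 1 r + D / r ^ (2 * m)) / r ^ (2 * q + 2) = (H 1 r / r ^ q) * (1 / r ^ (q + 2)) + D / r ^ (2 * m + 2 * q + 2)"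
        using elim by (simp add: add_divide_distrib power_add mult_2 mult_2_right mult_ac)
      ultimately show ?case by simp
    qed
    ultimately have "(real m - 1) * (\<kappa> / 2)\<^sup>2 \<le> c * 0 + 0"
      by (intro tendsto_le[OF trivial_limit_at_top_linorder])
    moreover have "(real m - 1) * (\<kappa> / 2)\<^sup>2 > 0" using m2 c(1) by (auto simp: \<kappa>_def)
    ultimately show False by simp
  qed
  \<comment> \<open>Normalised so that \<open>r\<close> times the derivative of
    \<open>bmean u\<close> tends to \<open>-\<alpha>\<close>: the limit of
    \<open>r^2 * K 1 r\<close> is \<open>A1 / m\<close>, and the equation for \<open>H 0\<close>
    contributes the factor \<open>-1/2\<close>.\<close>
  define \<alpha> where "\<alpha> = A1 / real (2 * m)"
  have A1: "A1 = real CARD('n) * \<alpha>" using m2 by (simp add: \<alpha>_def m)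
  have t2: "total_Q u = \<alpha> * (fact (CARD('n) - 1) * sphere_volume TYPE('n) / 2)"
    using m2 unit_ball_vol_neq_0[of "2 * m"] by (subst sphere_volume_even[OF m]) (auto simp: \<alpha>_def A1_def A_def)
  have t3: "((\<lambda>r. r\<^sup>2 * bmean (\<lambda>x. - laplacian u x) r) \<longlongrightarrow> real CARD('n) * \<alpha>) at_top"
    using decay unfolding H1 A1 .
  have "((\<lambda>r. r ^ 2 * K 1 r) \<longlongrightarrow> 2 * A1 / (real (2 * m + 2) - real 2)) at_top"
    by (rule radial_step_decay[OF K' _ decay]) (use m2 in auto)
  then have "((\<lambda>r. - (1 / 2) * (r ^ 2 * K 1 r)) \<longlongrightarrow> - (1 / 2) * (2 * A1 / (real (2 * m + 2) - real 2))) at_top"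
    by (intro tendsto_intros)
  then have "((\<lambda>r. r * (- (r / 2) * K (Suc 0) r)) \<longlongrightarrow> - \<alpha>) at_top"
    by (simp add: \<alpha>_def power2_eq_square mult_ac)
  from antiderivative_log[OF H' this] have t4: "((\<lambda>r. bmean u r / ln r) \<longlongrightarrow> - \<alpha>) at_top"
    by (simp add: H_def)
  have lim2: "((\<lambda>r. r ^ 2 * H 1 r + D / r ^ (2 * m - 2)) \<longlongrightarrow> A1 + 0) at_top"
    by (intro tendsto_intros decay inv0) (use m2 in auto)
  \<comment> \<open>This is \<open>e1\<close> times \<open>r^2\<close>. Its left side is
    nonnegative, which gives \<open>0 \<le> A1\<close>; as \<open>real m - 1 \<ge> 1\<close>, it
    also yields the energy bound.\<close>
  have ge: "(real m - 1) * (r\<^sup>2 * E r) \<le> r ^ 2 * H 1 r + D / r ^ (2 * m - 2)" if "r > 0" for r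
  proof -
    have "r\<^sup>2 * ((real m - 1) * E r) \<le> r\<^sup>2 * (H 1 r + D / r ^ (2 * m))"
      by (intro mult_left_mono e1 that) auto
    also have "r ^ (2 * m) = r\<^sup>2 * r ^ (2 * m - 2)"
    proof -
      have "2 * m = 2 + (2 * m - 2)" using m2 by simp
      then show ?thesis by (metis power_add)
    qed
    also have "r\<^sup>2 * (H 1 r + D / (r\<^sup>2 * r ^ (2 * m - 2))) = r ^ 2 * H 1 r + D / r ^ (2 * m - 2)"
      using that by (simp add: distrib_left)
    finally show ?thesis by (simp only: mult.left_commute)
  qed
  have "0 \<le> A1 + 0"
  proof (rule tendsto_lowerbound[OF lim2])
    show "\<forall>\<^sub>F r in at_top. 0 \<le> r ^ 2 * H 1 r + D / r ^ (2 * m - 2)"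
      using eventually_gt_at_top[of 0]
    proof eventually_elim
      case (elim r)
      have "0 \<le> (real m - 1) * (r\<^sup>2 * E r)" using m2 E0[of r] by simp
      then show ?case using ge[OF elim] by linarith
    qed
  qed simp
  then have t1: "0 \<le> \<alpha>" by (simp add: \<alpha>_def)
  have "\<forall>\<^sub>F r in at_top. r ^ 2 * H 1 r + D / r ^ (2 * m - 2) < A1 + 1"
    using order_tendstoD(2)[OF lim2, of "A1 + 1"] by simp
  then obtain S where S: "\<And>r. S \<le> r \<Longrightarrow> r ^ 2 * H 1 r + D / r ^ (2 * m - 2) < A1 + 1"
    by (auto simp: eventually_at_top_linorder)
  have t5: "r\<^sup>2 * bmean (\<lambda>x. (norm (gradient u x))\<^sup>2) r \<le> A1 + 1" if "max 1 S \<le> r" for r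
  proof -
    have "1 * (r\<^sup>2 * E r) \<le> (real m - 1) * (r\<^sup>2 * E r)"
      using m2 E0[of r] by (intro mult_right_mono) auto
    then show ?thesis using ge[of r] S[of r] that unfolding E_def by linarith
  qed
  show thesis by (rule that[OF t1 t2 t3 t4 t5])
qed

text \<open>Averaging \<open>far\<close> and applying Jensen to the exponential bounds
  \<open>r^2\<close> times the average of \<open>-\<Delta>u\<close> from below by about
  \<open>c r^(2-p) exp (2 bmean u r)\<close>, which is roughly \<open>r^(2-p-2\<alpha>)\<close>. A
  positive exponent would contradict the finite limit \<open>L\<close>.\<close>

lemma decay_exponent_lower_bound:
  fixes u :: "real ^ 'n::finite \<Rightarrow> real"
  assumes n: "CARD('n) \<ge> 2" and u: "smooth u"
    and "R > 0" "c > 0" "p \<ge> 0" and far: "\<And>x. R < norm x \<Longrightarrow> c * norm x powr (- p) * exp (2 * u x) \<le> - laplacian u x"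
    and L: "((\<lambda>r. r\<^sup>2 * bmean (\<lambda>x. - laplacian u x) r) \<longlongrightarrow> L) at_top"
    and \<alpha>: "((\<lambda>r. bmean u r / ln r) \<longlongrightarrow> - \<alpha>) at_top"
  shows "2 \<le> p + 2 * \<alpha>"
proof (rule ccontr)
  assume neg: "\<not> ?thesis"
  \<comment> \<open>With this choice
    \<open>2 - p - 2 * (\<alpha> + \<epsilon>) = 2 * \<epsilon>\<close>, so the exponent stays
    positive after the loss of \<open>\<epsilon>\<close> in the limit of
    \<open>bmean u r / ln r\<close>.\<close>
  define \<epsilon> where "\<epsilon> = (2 - p - 2 * \<alpha>) / 4"
  have \<epsilon>: "\<epsilon> > 0" using neg by (simp add: \<epsilon>_def)
  have cl: "continuous_on UNIV (laplacian u)" by (rule smooth_continuous[OF smooth_laplacian[OF u]])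
  have cu: "continuous_on UNIV u" by (rule smooth_continuous[OF u])
  have ce: "continuous_on UNIV (\<lambda>x. exp (2 * u x))" by (intro continuous_intros cu)
  have cf: "continuous_on UNIV (\<lambda>x. - laplacian u x - s * exp (2 * u x))" for s
    by (intro continuous_intros cl cu)
  \<comment> \<open>This function minorises \<open>- laplacian u x - s * exp (2 * u x)\<close> for
    every \<open>s\<close> between 0 and \<open>c\<close>, so the bound \<open>B\<close> does not
    depend on \<open>r\<close>.\<close>
  have cf0: "continuous_on UNIV (\<lambda>x. - \<bar>laplacian u x\<bar> - c * exp (2 * u x))"
    by (intro continuous_intros cl cu)
  obtain B where B: "B \<ge> 0" "\<And>z. norm z \<le> R \<Longrightarrow> - B \<le> - \<bar>laplacian u z\<bar> - c * exp (2 * u z)"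
    using continuous_lower_bound_cball[OF cf0] by blast
  define D where "D = B * R ^ CARD('n)"
  have ineq: "c * (r powr (- p) * exp (2 * bmean u r)) - D / r ^ CARD('n) \<le> bmean (\<lambda>x. - laplacian u x) r"
    if "r \<ge> 1" for r
  proof -
    \<comment> \<open>On the ball of radius \<open>r\<close> the weight
      \<open>norm z powr (- p)\<close> is at least \<open>r powr (- p)\<close>, so a constant can
      replace it; \<open>r \<ge> 1\<close> gives \<open>s \<le> c\<close>.\<close>
    define s where "s = c * r powr (- p)"
    have s: "0 \<le> s" "s \<le> c" 
      using \<open>c > 0\<close> \<open>p \<ge> 0\<close> that by (auto simp: s_def powr_minus_divide ge_one_powr_ge_zero divide_le_eq)
    have "- B * R ^ DIM(real ^ 'n) / r ^ DIM(real ^ 'n) \<le> bmean (\<lambda>x. - laplacian u x - s * exp (2 * u x)) r"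
    proof (rule bmean_ge[OF cf B(1) \<open>R > 0\<close>])
      show "r > 0" using that by simp
      fix z :: "real ^ 'n"
      show "0 \<le> - laplacian u z - s * exp (2 * u z)" if z: "R < norm z" "norm z \<le> r"
      proof -
        have "r powr (- p) \<le> norm z powr (- p)"
          using z \<open>R > 0\<close> \<open>p \<ge> 0\<close> by (intro powr_mono2') auto
        then have "s * exp (2 * u z) \<le> c * norm z powr (- p) * exp (2 * u z)"
          unfolding s_def using \<open>c > 0\<close> by (intro mult_right_mono mult_left_mono) auto
        then show ?thesis using far[OF z(1)] by linarith
      qed
      show "- B \<le> - laplacian u z - s * exp (2 * u z)" if "norm z \<le> R"
      proof -
        have "s * exp (2 * u z) \<le> c * exp (2 * u z)" using s by (intro mult_right_mono) auto
        then show ?thesis using B(2)[OF that] by linarith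
      qed
    qed
    also have "\<dots> = bmean (\<lambda>x. - laplacian u x) r - s * (\<integral>y. exp (2 * u (r *\<^sub>R y)) \<partial>unif_ball)"
      unfolding bmean_def
      using integrable_bmean[OF cl, of r] integrable_bmean[OF ce, of r] by simp
    finally have 1: "s * (\<integral>y. exp (2 * u (r *\<^sub>R y)) \<partial>unif_ball) - D / r ^ CARD('n) \<le> bmean (\<lambda>x. - laplacian u x) r"
      by (simp add: D_def)
    have "continuous_on UNIV (\<lambda>y. 2 * u (r *\<^sub>R y))"
      by (intro continuous_on_mult continuous_on_const continuous_on_compose2[OF cu]) (auto intro!: continuous_intros)
    from exp_integral_le[OF this] have "exp (2 * bmean u r) \<le> (\<integral>y. exp (2 * u (r *\<^sub>R y)) \<partial>unif_ball)"
      by (simp add: bmean_def)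
    from mult_left_mono[OF this s(1)] show ?thesis using 1 by (simp add: s_def mult.assoc)
  qed
  have le: "\<forall>\<^sub>F r in at_top. c * r powr (2 * \<epsilon>) \<le> r\<^sup>2 * bmean (\<lambda>x. - laplacian u x) r + D"
  proof -
    have "\<forall>\<^sub>F r in at_top. - \<alpha> - \<epsilon> < bmean u r / ln r"
      using \<epsilon> by (intro order_tendstoD(1)[OF \<alpha>]) auto
    then show ?thesis
      using eventually_gt_at_top[of 1]
    proof eventually_elim
      case (elim r)
      have ln: "ln r > 0" using elim by simp
      then have "(- \<alpha> - \<epsilon>) * ln r \<le> bmean u r" using elim by (simp add: field_simps)
      then have "exp (2 * ((- \<alpha> - \<epsilon>) * ln r)) \<le> exp (2 * bmean u r)" by simp
      moreover have "exp (2 * ((- \<alpha> - \<epsilon>) * ln r)) = r powr (2 * (- \<alpha> - \<epsilon>))"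
        using elim by (simp add: powr_def mult.assoc)
      ultimately have "c * (r powr (- p) * r powr (2 * (- \<alpha> - \<epsilon>))) - D / r ^ CARD('n) \<le> c * (r powr (- p) * exp (2 * bmean u r)) - D / r ^ CARD('n)"
        using \<open>c > 0\<close> by (intro diff_right_mono mult_left_mono) auto
      also have "\<dots> \<le> bmean (\<lambda>x. - laplacian u x) r" using elim by (intro ineq) auto
      finally have "c * (r powr (- p) * r powr (2 * (- \<alpha> - \<epsilon>))) \<le> bmean (\<lambda>x. - laplacian u x) r + D / r ^ CARD('n)" by simp
      then have "r\<^sup>2 * (c * (r powr (- p) * r powr (2 * (- \<alpha> - \<epsilon>)))) \<le> r\<^sup>2 * (bmean (\<lambda>x. - laplacian u x) r + D / r ^ CARD('n))"
        by (intro mult_left_mono) auto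
      moreover have "r\<^sup>2 * (c * (r powr (- p) * r powr (2 * (- \<alpha> - \<epsilon>)))) = c * r powr (2 * \<epsilon>)"
      proof -
        have "r\<^sup>2 = r powr 2" using elim by simp
        then have "r\<^sup>2 * (c * (r powr (- p) * r powr (2 * (- \<alpha> - \<epsilon>)))) = c * r powr (2 + (- p) + 2 * (- \<alpha> - \<epsilon>))"
          unfolding powr_add by (simp only: mult_ac)
        also have "2 + (- p) + 2 * (- \<alpha> - \<epsilon>) = 2 * \<epsilon>" by (simp add: \<epsilon>_def field_simps)
        finally show ?thesis .
      qed
      moreover have "r\<^sup>2 * (D / r ^ CARD('n)) \<le> D"
      proof -
        have "r\<^sup>2 \<le> r ^ CARD('n)" using elim n by (intro power_increasing) auto
        then have "r\<^sup>2 * D \<le> r ^ CARD('n) * D" using B \<open>R > 0\<close> by (intro mult_right_mono) (auto simp: D_def)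
        then show ?thesis using elim by (simp add: field_simps)
      qed
      ultimately show ?case unfolding distrib_left by linarith
    qed
  qed
  have tend: "((\<lambda>r. r\<^sup>2 * bmean (\<lambda>x. - laplacian u x) r + D) \<longlongrightarrow> L + D) at_top"
    by (intro tendsto_intros L)
  have "filterlim (\<lambda>r. c * r powr (2 * \<epsilon>)) at_top at_top"
  proof -
    have "filterlim (\<lambda>r. c * exp (2 * \<epsilon> * ln r)) at_top at_top"
      using \<epsilon> \<open>c > 0\<close>
      by (intro filterlim_tendsto_pos_mult_at_top[OF tendsto_const] filterlim_compose[OF exp_at_top] ln_at_top) auto
    moreover have "\<forall>\<^sub>F r in at_top. c * exp (2 * \<epsilon> * ln r) = c * r powr (2 * \<epsilon>)"
      using eventually_gt_at_top[of 0] by eventually_elim (simp add: powr_def)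
    ultimately show ?thesis by (rule filterlim_cong[OF refl refl, THEN iffD1, rotated])
  qed
  from filterlim_at_top_imp_at_infinity[OF filterlim_at_top_mono[OF this le]]
  show False
    by (rule not_tendsto_and_filterlim_at_infinity[OF trivial_limit_at_top_linorder tend])
qed

section \<open>Escape to infinity in the conformal distance\<close>

lemma conf_dist_linepath_le:
  fixes u :: "real ^ 'n::finite \<Rightarrow> real"
  assumes u: "continuous_on UNIV u" and b: "\<And>t. 0 \<le> t \<Longrightarrow> t \<le> 1 \<Longrightarrow> u (linepath x y t) \<le> b"
  shows "conf_dist u x y \<le> exp b * norm (y - x)"
proof -
  obtain L where L: "has_conf_length u (linepath x y) L"
    using has_conf_length_linepath[OF u] by blast
  have "L \<le> exp b * norm (y - x)"
  proof (rule has_integral_le[OF L[unfolded has_conf_length_def]])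
    show "((\<lambda>t. exp b * norm (y - x)) has_integral exp b * norm (y - x)) {0..1::real}"
      using has_integral_const_real[of "exp b * norm (y - x)" 0 1] by simp
    show "exp (u (linepath x y t)) * norm (vector_derivative (linepath x y) (at t)) \<le> exp b * norm (y - x)"
      if "t \<in> {0..1}" for t
      using b[of t] that by (auto intro!: mult_right_mono)
  qed
  then show ?thesis
    using conf_dist_le[OF valid_path_linepath L] by simp
qed

text \<open>A curve that leaves the unit ball around \<open>x\<close> already has a definite length by the time it exits.\<close>

lemma conf_dist_far:
  fixes u :: "real ^ 'n::finite \<Rightarrow> real"
  assumes u: "continuous_on UNIV u"
  obtains c where "c > 0" "\<And>z. 1 \<le> dist x z \<Longrightarrow> c \<le> conf_dist u x z"
proof -
  obtain B where B: "\<And>z. norm z \<le> norm x + 1 \<Longrightarrow> - B \<le> u z"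
    using continuous_lower_bound_cball[OF u] by blast
  have "exp (- B) \<le> conf_dist u x z" if xz: "1 \<le> dist x z" for z
  proof (rule conf_dist_greatest[OF u])
    fix \<gamma> L
    assume \<gamma>: "valid_path \<gamma>" "pathstart \<gamma> = x" "pathfinish \<gamma> = z" "has_conf_length u \<gamma> L"
    define v where "v t = vector_derivative \<gamma> (at t)" for t
    have len: "((\<lambda>t. exp (u (\<gamma> t)) * norm (v t)) has_integral L) {0..1}"
      using \<gamma>(4) by (simp add: has_conf_length_def v_def)
    obtain S where S: "continuous_on {0..1} \<gamma>" "finite S" "\<gamma> C1_differentiable_on {0..1} - S"
      using \<gamma>(1) by (auto simp: valid_path_def piecewise_C1_differentiable_on_def)
    define T where "T = {0..1} \<inter> (\<lambda>t. dist x (\<gamma> t)) -` {1..}"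
    have "closed T"
      unfolding T_def by (rule continuous_closed_preimage) (auto intro!: continuous_intros S(1))
    moreover have "bounded T"
      by (rule bounded_subset[of "{0..1}"]) (auto simp: T_def)
    ultimately have "compact T" by (simp add: compact_eq_bounded_closed)
    moreover have "1 \<in> T" using \<gamma>(3) xz by (simp add: T_def pathfinish_def)
    ultimately obtain s where s: "s \<in> T" "\<And>t. t \<in> T \<Longrightarrow> s \<le> t"
      using compact_attains_inf[of T] by auto
    then have s01: "0 \<le> s" "s \<le> 1" "1 \<le> dist x (\<gamma> s)" by (auto simp: T_def)
    have below: "exp (- B) \<le> exp (u (\<gamma> t))" if "0 \<le> t" "t < s" for t
    proof -
      have "dist x (\<gamma> t) < 1" using s(2)[of t] that s01 by (force simp: T_def)
      then have "norm (\<gamma> t) \<le> norm x + 1"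
        using norm_triangle_ineq2[of "\<gamma> t" x] by (simp add: dist_norm norm_minus_commute)
      then show ?thesis using B by simp
    qed
    have ftc: "(v has_integral (\<gamma> s - \<gamma> 0)) {0..s}"
    proof (rule fundamental_theorem_of_calculus_interior_strong[OF S(2) s01(1)])
      show "(\<gamma> has_vector_derivative v t) (at t)" if "t \<in> {0<..<s} - S" for t
        using that S(3) s01 by (auto simp: v_def C1_differentiable_on_eq vector_derivative_works[symmetric])
      show "continuous_on {0..s} \<gamma>" using s01 by (intro continuous_on_subset[OF S(1)]) auto
    qed
    have int: "(\<lambda>t. exp (u (\<gamma> t)) * norm (v t)) integrable_on {0..1}"
      using len by blast
    have int_s: "(\<lambda>t. exp (u (\<gamma> t)) * norm (v t)) integrable_on {0..s}"
      by (rule integrable_on_subinterval[OF int]) (use s01 in auto)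
    \<comment> \<open>The bound \<open>below\<close> does not cover the exit time \<open>s\<close>
      itself; changing the integrand at one point leaves the integral unchanged.\<close>
    have "((\<lambda>t. if t = s then 0 else exp (- B) *\<^sub>R v t) has_integral exp (- B) *\<^sub>R (\<gamma> s - \<gamma> 0)) {0..s}"
      by (rule has_integral_spike_finite[OF _ _ has_integral_cmul[OF ftc], of "{s}"]) auto
    moreover have "norm (if t = s then 0 else exp (- B) *\<^sub>R v t) \<le> exp (u (\<gamma> t)) * norm (v t)" if "t \<in> {0..s}" for t
      using that below[of t] by (auto intro!: mult_right_mono)
    ultimately have "norm (exp (- B) *\<^sub>R (\<gamma> s - \<gamma> 0)) \<le> integral {0..s} (\<lambda>t. exp (u (\<gamma> t)) * norm (v t))"
      using integral_norm_bound_integral[OF _ int_s] by (metis (no_types, lifting) has_integral_integrable_integral)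
    also have "\<dots> \<le> integral {0..1} (\<lambda>t. exp (u (\<gamma> t)) * norm (v t))"
      using s01 by (intro integral_subset_le int int_s) auto
    also have "\<dots> = L" using len by blast
    finally have "exp (- B) * dist x (\<gamma> s) \<le> L"
      using \<gamma>(2) by (simp add: dist_norm norm_minus_commute pathstart_def)
    moreover have "exp (- B) * 1 \<le> exp (- B) * dist x (\<gamma> s)"
      using s01 by (intro mult_left_mono) auto
    ultimately show "exp (- B) \<le> L" by linarith
  qed
  then show thesis by (intro that[of "exp (- B)"]) auto
qed

text \<open>Geometrically small steps make \<open>X\<close> a Cauchy sequence for
  \<open>conf_dist u\<close>, so it has a limit \<open>x\<close>. By \<open>conf_dist_far\<close>
  the points at Euclidean distance at least 1 from \<open>x\<close> stay away from \<open>x\<close>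
  in the conformal distance too, so \<open>X\<close> cannot escape to infinity.\<close>

lemma conf_complete_no_short_escape:
  fixes u :: "real ^ 'n::finite \<Rightarrow> real" and X :: "nat \<Rightarrow> real ^ 'n"
  assumes u: "continuous_on UNIV u" and "conf_complete u"
    and "q \<ge> 0" "q < 1" and step: "\<And>k. N \<le> k \<Longrightarrow> conf_dist u (X k) (X (Suc k)) \<le> q ^ k"
    and esc: "filterlim (\<lambda>k. norm (X k)) at_top sequentially"
  shows False
proof -
  interpret Metric_space UNIV "conf_dist u" by (rule Metric_space_conf_dist[OF u])
  have tele: "conf_dist u (X k) (X (k + i)) \<le> (\<Sum>j\<in>{k..<k + i}. q ^ j)" if "N \<le> k" for k i
  proof (induction i)
    case (Suc i)
    have "conf_dist u (X k) (X (k + Suc i)) \<le> conf_dist u (X k) (X (k + i)) + conf_dist u (X (k + i)) (X (Suc (k + i)))"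
      using conf_dist_triangle[OF u] by simp
    also have "\<dots> \<le> (\<Sum>j\<in>{k..<k + i}. q ^ j) + q ^ (k + i)"
      using that by (intro add_mono Suc step) auto
    finally show ?case by simp
  qed simp
  have geo: "(\<Sum>j\<in>{k..<k + i}. q ^ j) \<le> q ^ k / (1 - q)" for k i
  proof -
    have "(\<Sum>j\<in>{k..<k + i}. q ^ j) = q ^ k * (\<Sum>j<i. q ^ j)"
      by (simp add: sum_distrib_left power_add sum.shift_bounds_nat_ivl[of _ 0 k i, simplified add_0] atLeast0LessThan add.commute mult.commute flip: atLeast0LessThan)
    also have "\<dots> \<le> q ^ k * (1 / (1 - q))"
      using \<open>q \<ge> 0\<close> \<open>q < 1\<close> by (intro mult_left_mono) (auto simp: sum_gp_strict divide_right_mono)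
    finally show ?thesis by simp
  qed
  have "MCauchy X"
    unfolding MCauchy_def
  proof (intro conjI allI impI)
    fix \<epsilon> :: real assume "\<epsilon> > 0"
    have "(\<lambda>k. q ^ k / (1 - q)) \<longlonglongrightarrow> 0 / (1 - q)"
      using \<open>q \<ge> 0\<close> \<open>q < 1\<close> by (intro tendsto_intros LIMSEQ_realpow_zero) auto
    then have "\<forall>\<^sub>F k in sequentially. q ^ k / (1 - q) < \<epsilon>"
      using \<open>\<epsilon> > 0\<close> by (intro order_tendstoD(2)) auto
    then obtain K where K: "\<And>k. K \<le> k \<Longrightarrow> q ^ k / (1 - q) < \<epsilon>" by (auto simp: eventually_sequentially)
    have "conf_dist u (X k) (X l) < \<epsilon>" if "max K N \<le> k" "k \<le> l" for k l
      using tele[of k "l - k"] geo[of k "l - k"] K[of k] that by simp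
    then have "conf_dist u (X k) (X l) < \<epsilon>" if "max K N \<le> k" "max K N \<le> l" for k l
      using that commute[of "X k" "X l"] by (metis nat_le_linear)
    then show "\<exists>N. \<forall>n n'. N \<le> n \<longrightarrow> N \<le> n' \<longrightarrow> conf_dist u (X n) (X n') < \<epsilon>" by blast
  qed simp
  then obtain x where x: "limitin mtopology X x sequentially"
    using \<open>conf_complete u\<close> unfolding conf_complete_def mcomplete_def by blast
  obtain c where c: "c > 0" "\<And>z. 1 \<le> dist x z \<Longrightarrow> c \<le> conf_dist u x z"
    using conf_dist_far[OF u] by blast
  from x c(1) have "\<forall>\<^sub>F k in sequentially. conf_dist u (X k) x < c"
    unfolding limitin_metric by (auto elim!: allE eventually_mono)
  moreover have "\<forall>\<^sub>F k in sequentially. norm x + 1 \<le> norm (X k)"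
    using esc by (auto simp: filterlim_at_top)
  ultimately have "\<forall>\<^sub>F k in sequentially. False"
  proof eventually_elim
    case (elim k)
    have "1 \<le> dist x (X k)"
      using elim(2) norm_triangle_ineq2[of "X k" x] by (simp add: dist_norm norm_minus_commute)
    from c(2)[OF this] show ?case using elim(1) commute[of "X k" x] by simp
  qed
  then show False by simp
qed

section \<open>The Poincare inequality on the ball\<close>

lemma nn_integral_lborel_affine:
  fixes f :: "'a::euclidean_space \<Rightarrow> ennreal"
  assumes [measurable]: "f \<in> borel_measurable borel" and "c \<noteq> 0"
  shows "(\<integral>\<^sup>+x. f x \<partial>lborel) = ennreal (\<bar>c\<bar> ^ DIM('a)) * (\<integral>\<^sup>+x. f (t + c *\<^sub>R x) \<partial>lborel)"
proof -
  have "(\<integral>\<^sup>+x. f x \<partial>lborel) = (\<integral>\<^sup>+x. f x \<partial>density (distr lborel borel (\<lambda>x. t + c *\<^sub>R x)) (\<lambda>_. ennreal (\<bar>c\<bar> ^ DIM('a))))"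
    by (rule arg_cong[where f="\<lambda>M. integral\<^sup>N M f", OF lborel_affine[OF \<open>c \<noteq> 0\<close>, of t]])
  also have "\<dots> = (\<integral>\<^sup>+x. ennreal (\<bar>c\<bar> ^ DIM('a)) * f x \<partial>distr lborel borel (\<lambda>x. t + c *\<^sub>R x))"
    by (rule nn_integral_density) auto
  also have "\<dots> = (\<integral>\<^sup>+x. ennreal (\<bar>c\<bar> ^ DIM('a)) * f (t + c *\<^sub>R x) \<partial>lborel)"
    by (rule nn_integral_distr) auto
  also have "\<dots> = ennreal (\<bar>c\<bar> ^ DIM('a)) * (\<integral>\<^sup>+x. f (t + c *\<^sub>R x) \<partial>lborel)"
    by (rule nn_integral_cmult) auto
  finally show ?thesis .
qed

text \<open>Contracting the ball towards one of its points by a factor \<open>t \<ge> 1/2\<close> keeps it inside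
  and multiplies volumes by at least \<open>2\<^sup>-\<^sup>n\<close>.\<close>

lemma nn_integral_unif_ball_contraction:
  fixes g :: "'a::euclidean_space \<Rightarrow> ennreal"
  assumes [measurable]: "g \<in> borel_measurable borel" and a: "norm a \<le> 1" and t: "1 / 2 \<le> t" "t \<le> 1"
  shows "(\<integral>\<^sup>+y. g ((1 - t) *\<^sub>R a + t *\<^sub>R y) \<partial>unif_ball) \<le> 2 ^ DIM('a) * (\<integral>\<^sup>+y. g y \<partial>unif_ball)"
proof -
  let ?n = "DIM('a)"
  have ball: "norm ((1 - t) *\<^sub>R a + t *\<^sub>R y) \<le> 1" if "norm y \<le> 1" for y
    using convexD[OF convex_cball[of "0::'a" 1], of a y "1 - t" t] a t that by simp
  have "(\<integral>\<^sup>+y. indicator (cball 0 1) y * g ((1 - t) *\<^sub>R a + t *\<^sub>R y) \<partial>lborel)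
     \<le> (\<integral>\<^sup>+y. indicator (cball 0 1) ((1 - t) *\<^sub>R a + t *\<^sub>R y) * g ((1 - t) *\<^sub>R a + t *\<^sub>R y) \<partial>lborel)"
    using ball by (intro nn_integral_mono mult_right_mono) (auto simp: indicator_def)
  also have "\<dots> \<le> ennreal (2 ^ ?n) * (ennreal (\<bar>t\<bar> ^ ?n) * \<dots>)" (is "?I \<le> _")
  proof -
    have "1 \<le> (2 * \<bar>t\<bar>) ^ ?n" using t by (intro one_le_power) auto
    then have "1 \<le> ennreal (2 ^ ?n * \<bar>t\<bar> ^ ?n)" by (simp add: power_mult_distrib)
    then have "1 * ?I \<le> ennreal (2 ^ ?n * \<bar>t\<bar> ^ ?n) * ?I" by (rule mult_right_mono) simp
    then show ?thesis by (simp add: ennreal_mult mult.assoc)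
  qed
  also have "ennreal (\<bar>t\<bar> ^ ?n) *
      (\<integral>\<^sup>+y. indicator (cball 0 1) ((1 - t) *\<^sub>R a + t *\<^sub>R y) * g ((1 - t) *\<^sub>R a + t *\<^sub>R y) \<partial>lborel)
    = (\<integral>\<^sup>+y. indicator (cball 0 1) y * g y \<partial>lborel)"
    using t by (intro nn_integral_lborel_affine[symmetric]) auto
  also have "ennreal (2 ^ ?n) = 2 ^ ?n" by (simp flip: ennreal_power)
  finally have "(\<integral>\<^sup>+y. indicator (cball 0 1) y * g ((1 - t) *\<^sub>R a + t *\<^sub>R y) \<partial>lborel) / ennreal (unit_ball_vol (real ?n))
     \<le> 2 ^ ?n * (\<integral>\<^sup>+y. indicator (cball 0 1) y * g y \<partial>lborel) / ennreal (unit_ball_vol (real ?n))"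
    by (rule divide_right_mono_ennreal)
  then show ?thesis
    by (simp add: nn_integral_unif_ball ennreal_times_divide)
qed

text \<open>Cauchy-Schwarz along an interval. The right side is a nonnegative Lebesgue integral so
  that Tonelli's theorem can be applied to it when the endpoints are averaged.\<close>

lemma square_increment_le:
  fixes \<phi> :: "real \<Rightarrow> real"
  assumes d: "\<And>t. (\<phi> has_real_derivative \<phi>' t) (at t)" and c: "continuous_on UNIV \<phi>'" and "a \<le> b"
  shows "ennreal ((\<phi> b - \<phi> a)\<^sup>2) \<le> ennreal (b - a) * (\<integral>\<^sup>+t. indicator {a..b} t * ennreal ((\<phi>' t)\<^sup>2) \<partial>lborel)"
proof (cases "a = b")
  case False
  then have "a < b" using \<open>a \<le> b\<close> by simp
  define m where "m = (\<phi> b - \<phi> a) / (b - a)"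
  have ftc: "(\<phi>' has_integral (\<phi> b - \<phi> a)) {a..b}"
    using d \<open>a \<le> b\<close> by (intro fundamental_theorem_of_calculus)
      (auto simp: has_real_derivative_iff_has_vector_derivative[symmetric] intro: has_field_derivative_at_within)
  have c2: "continuous_on {a..b} (\<lambda>t. (\<phi>' t)\<^sup>2)" by (intro continuous_intros continuous_on_subset[OF c]) auto
  define J where "J = integral {a..b} (\<lambda>t. (\<phi>' t)\<^sup>2)"
  have J: "((\<lambda>t. (\<phi>' t)\<^sup>2) has_integral J) {a..b}"
    unfolding J_def by (intro integrable_integral integrable_continuous_real c2)
  \<comment> \<open>The integrand is \<open>(\<phi>' t - m)^2\<close> with \<open>m\<close> the mean
    slope; its integral being nonnegative is the whole inequality.\<close>
  have "((\<lambda>t. (\<phi>' t)\<^sup>2 - 2 * m * \<phi>' t + m\<^sup>2) has_integral (J - 2 * m * (\<phi> b - \<phi> a) + m\<^sup>2 * (b - a))) {a..b}"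
    using has_integral_add[OF has_integral_diff[OF J has_integral_mult_right[OF ftc, of "2 * m"]] has_integral_const_real[of "m\<^sup>2" a b]]
      \<open>a \<le> b\<close> by (simp add: mult.commute)
  then have "0 \<le> J - 2 * m * (\<phi> b - \<phi> a) + m\<^sup>2 * (b - a)"
  proof (rule has_integral_nonneg)
    fix t
    have "(\<phi>' t)\<^sup>2 - 2 * m * \<phi>' t + m\<^sup>2 = (\<phi>' t - m)\<^sup>2" by (simp add: power2_diff)
    then show "0 \<le> (\<phi>' t)\<^sup>2 - 2 * m * \<phi>' t + m\<^sup>2" by simp
  qed
  moreover have "\<phi> b - \<phi> a = m * (b - a)" using \<open>a < b\<close> by (simp add: m_def)
  ultimately have "m\<^sup>2 * (b - a) \<le> J" by (simp add: power2_eq_square algebra_simps)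
  then have "(b - a) * (m\<^sup>2 * (b - a)) \<le> (b - a) * J" using \<open>a < b\<close> by (intro mult_left_mono) auto
  then have "(\<phi> b - \<phi> a)\<^sup>2 \<le> (b - a) * J"
    unfolding \<open>\<phi> b - \<phi> a = m * (b - a)\<close> by (simp add: power2_eq_square mult_ac)
  then have "ennreal ((\<phi> b - \<phi> a)\<^sup>2) \<le> ennreal (b - a) * ennreal J"
    using \<open>a < b\<close> J by (subst ennreal_mult[symmetric]) (auto intro: ennreal_leI has_integral_nonneg[OF J])
  also have "ennreal J = (\<integral>\<^sup>+t. ennreal (indicator {a..b} t * (\<phi>' t)\<^sup>2) \<partial>lborel)"
  proof (rule nn_integral_has_integral_lborel[symmetric])
    show "((\<lambda>t. indicator {a..b} t * (\<phi>' t)\<^sup>2) has_integral J) UNIV"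
    proof -
      have "(\<lambda>t. indicator {a..b} t * (\<phi>' t)\<^sup>2) = (\<lambda>t. if t \<in> {a..b} then (\<phi>' t)\<^sup>2 else 0)"
        by (auto simp: indicator_def)
      then show ?thesis using J by (simp only: has_integral_restrict_UNIV)
    qed
    show "(\<lambda>t. indicator {a..b} t * (\<phi>' t)\<^sup>2) \<in> borel_measurable borel"
      using borel_measurable_continuous_onI[OF c] by measurable
  qed simp
  finally show ?thesis by (simp add: ennreal_mult' ennreal_indicator)
qed simp

interpretation unif_ball_pair: pair_sigma_finite unif_ball unif_ball
  by (intro pair_sigma_finite.intro unif_ball.sigma_finite_measure_axioms)

interpretation unif_ball_lborel: pair_sigma_finite unif_ball lborel
  by (intro pair_sigma_finite.intro unif_ball.sigma_finite_measure_axioms sigma_finite_lborel)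

text \<open>For \<open>t \<ge> 1/2\<close> the inner integral is a contraction towards
  \<open>x\<close>. For smaller \<open>t\<close> the order of integration is exchanged, and the
  contraction is towards \<open>y\<close> with factor \<open>1 - t\<close>.\<close>

lemma nn_integral_pair_unif_ball_le:
  fixes g :: "'a::euclidean_space \<Rightarrow> ennreal"
  assumes [measurable]: "g \<in> borel_measurable borel" and t: "0 \<le> t" "t \<le> 1"
  shows "(\<integral>\<^sup>+x. \<integral>\<^sup>+y. g ((1 - t) *\<^sub>R x + t *\<^sub>R y) \<partial>unif_ball \<partial>unif_ball)
    \<le> 2 ^ DIM('a) * (\<integral>\<^sup>+y. g y \<partial>unif_ball)"
proof -
  have *: "(\<integral>\<^sup>+x. \<integral>\<^sup>+y. g ((1 - s) *\<^sub>R x + s *\<^sub>R y) \<partial>unif_ball \<partial>unif_ball)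
    \<le> 2 ^ DIM('a) * (\<integral>\<^sup>+y. g y \<partial>unif_ball)" if "1 / 2 \<le> s" "s \<le> 1" for s
  proof -
    have "(\<integral>\<^sup>+x. \<integral>\<^sup>+y. g ((1 - s) *\<^sub>R x + s *\<^sub>R y) \<partial>unif_ball \<partial>unif_ball)
       \<le> (\<integral>\<^sup>+(x::'a). 2 ^ DIM('a) * (\<integral>\<^sup>+y. g y \<partial>unif_ball) \<partial>unif_ball)"
      using AE_unif_ball
      by (intro nn_integral_mono_AE) (auto elim!: eventually_mono intro!: nn_integral_unif_ball_contraction that)
    then show ?thesis by (simp add: unif_ball.emeasure_space_1[simplified])
  qed
  show ?thesis
  proof (cases "1 / 2 \<le> t")
    case False
    have "(\<integral>\<^sup>+x. \<integral>\<^sup>+y. g ((1 - t) *\<^sub>R x + t *\<^sub>R y) \<partial>unif_ball \<partial>unif_ball)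
       = (\<integral>\<^sup>+y. \<integral>\<^sup>+x. g ((1 - t) *\<^sub>R x + t *\<^sub>R y) \<partial>unif_ball \<partial>unif_ball)"
      by (rule unif_ball_pair.Fubini') measurable
    also have "\<dots> \<le> 2 ^ DIM('a) * (\<integral>\<^sup>+y. g y \<partial>unif_ball)"
      using *[of "1 - t"] False t by (simp add: add.commute)
    finally show ?thesis .
  qed (use * t in auto)
qed

text \<open>The increment \<open>f y - f x\<close> is controlled by \<open>D\<close> along the
  segment, with the factor 4 because \<open>norm (y - x) \<le> 2\<close>. Tonelli moves the segment
  parameter \<open>t\<close> outermost, and for fixed \<open>t\<close> the point
  \<open>(1 - t) *\<^sub>R x + t *\<^sub>R y\<close> has a law dominated by
  \<open>2 ^ DIM('a)\<close> times the uniform one.\<close>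

lemma poincare_unif_ball:
  fixes f :: "'a::euclidean_space \<Rightarrow> real" and D :: "'a \<Rightarrow> 'a"
  assumes f: "\<And>a b t. ((\<lambda>t. f (a + t *\<^sub>R b)) has_real_derivative D (a + t *\<^sub>R b) \<bullet> b) (at t)"
    and D: "continuous_on UNIV D" 
  shows "(\<integral>\<^sup>+x. \<integral>\<^sup>+y. ennreal ((f y - f x)\<^sup>2) \<partial>unif_ball \<partial>unif_ball)
    \<le> 4 * 2 ^ DIM('a) * (\<integral>\<^sup>+y. ennreal ((norm (D y))\<^sup>2) \<partial>unif_ball)"
proof -
  define g where "g y = ennreal ((norm (D y))\<^sup>2)" for y
  have [measurable]: "D \<in> borel_measurable borel" by (rule borel_measurable_continuous_onI[OF D])
  have [measurable]: "g \<in> borel_measurable borel" unfolding g_def by measurable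
  let ?I = "\<lambda>t. indicator {0..1::real} t :: ennreal"
  have pt: "ennreal ((f y - f x)\<^sup>2) \<le> 4 * (\<integral>\<^sup>+t. ?I t * g ((1 - t) *\<^sub>R x + t *\<^sub>R y) \<partial>lborel)"
    if xy: "norm x \<le> 1" "norm y \<le> 1" for x y
  proof -
    have "ennreal ((f (x + 1 *\<^sub>R (y - x)) - f (x + 0 *\<^sub>R (y - x)))\<^sup>2)
       \<le> ennreal (1 - 0) * (\<integral>\<^sup>+t. ?I t * ennreal ((D (x + t *\<^sub>R (y - x)) \<bullet> (y - x))\<^sup>2) \<partial>lborel)"
      by (rule square_increment_le[OF f])
         (auto intro!: continuous_intros continuous_on_compose2[OF D])
    also have "\<dots> \<le> (\<integral>\<^sup>+t. 4 * (?I t * g ((1 - t) *\<^sub>R x + t *\<^sub>R y)) \<partial>lborel)"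
      unfolding ennreal_1 diff_zero mult_1
    proof (intro nn_integral_mono)
      fix t
      have eq: "x + t *\<^sub>R (y - x) = (1 - t) *\<^sub>R x + t *\<^sub>R y" by (simp add: algebra_simps)
      have "norm (y - x) \<le> 2" using norm_triangle_ineq4[of y x] xy by simp
      then have "\<bar>D (x + t *\<^sub>R (y - x)) \<bullet> (y - x)\<bar> \<le> norm (D (x + t *\<^sub>R (y - x))) * 2"
        by (intro order_trans[OF Cauchy_Schwarz_ineq2] mult_left_mono) auto
      then have "(D (x + t *\<^sub>R (y - x)) \<bullet> (y - x))\<^sup>2 \<le> (norm (D (x + t *\<^sub>R (y - x))) * 2)\<^sup>2"
        by (metis abs_ge_zero power_mono power2_abs)
      also have "\<dots> = 4 * (norm (D ((1 - t) *\<^sub>R x + t *\<^sub>R y)))\<^sup>2"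
        by (simp add: power_mult_distrib eq)
      finally have "ennreal ((D (x + t *\<^sub>R (y - x)) \<bullet> (y - x))\<^sup>2) \<le> 4 * g ((1 - t) *\<^sub>R x + t *\<^sub>R y)"
        unfolding g_def by (subst ennreal_numeral[symmetric], subst ennreal_mult[symmetric]) (auto intro: ennreal_leI)
      then show "?I t * ennreal ((D (x + t *\<^sub>R (y - x)) \<bullet> (y - x))\<^sup>2) \<le> 4 * (?I t * g ((1 - t) *\<^sub>R x + t *\<^sub>R y))"
        by (auto simp: indicator_def)
    qed
    also have "\<dots> = 4 * (\<integral>\<^sup>+t. ?I t * g ((1 - t) *\<^sub>R x + t *\<^sub>R y) \<partial>lborel)"
      by (rule nn_integral_cmult) measurable
    finally show ?thesis by simp
  qed
  have "(\<integral>\<^sup>+x. \<integral>\<^sup>+y. ennreal ((f y - f x)\<^sup>2) \<partial>unif_ball \<partial>unif_ball)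
     \<le> (\<integral>\<^sup>+x. \<integral>\<^sup>+y. 4 * (\<integral>\<^sup>+t. ?I t * g ((1 - t) *\<^sub>R x + t *\<^sub>R y) \<partial>lborel) \<partial>unif_ball \<partial>unif_ball)"
  proof (rule nn_integral_mono_AE)
    show "AE x in unif_ball. (\<integral>\<^sup>+y. ennreal ((f y - f x)\<^sup>2) \<partial>unif_ball)
       \<le> (\<integral>\<^sup>+y. 4 * (\<integral>\<^sup>+t. ?I t * g ((1 - t) *\<^sub>R x + t *\<^sub>R y) \<partial>lborel) \<partial>unif_ball)"
      using AE_unif_ball
    proof eventually_elim
      case (elim x)
      show ?case
        using AE_unif_ball by (intro nn_integral_mono_AE) (auto elim!: eventually_mono intro!: pt elim)
    qed
  qed
  also have "\<dots> = 4 * (\<integral>\<^sup>+x. \<integral>\<^sup>+y. \<integral>\<^sup>+t. ?I t * g ((1 - t) *\<^sub>R x + t *\<^sub>R y) \<partial>lborel \<partial>unif_ball \<partial>unif_ball)"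
    by (subst nn_integral_cmult, measurable)+
  also have "(\<integral>\<^sup>+x. \<integral>\<^sup>+y. \<integral>\<^sup>+t. ?I t * g ((1 - t) *\<^sub>R x + t *\<^sub>R y) \<partial>lborel \<partial>unif_ball \<partial>unif_ball)
     = (\<integral>\<^sup>+x. \<integral>\<^sup>+t. \<integral>\<^sup>+y. ?I t * g ((1 - t) *\<^sub>R x + t *\<^sub>R y) \<partial>unif_ball \<partial>lborel \<partial>unif_ball)"
    by (intro nn_integral_cong unif_ball_lborel.Fubini'[symmetric]) measurable
  also have "\<dots> = (\<integral>\<^sup>+t. \<integral>\<^sup>+x. \<integral>\<^sup>+y. ?I t * g ((1 - t) *\<^sub>R x + t *\<^sub>R y) \<partial>unif_ball \<partial>unif_ball \<partial>lborel)"
    by (rule unif_ball_lborel.Fubini'[symmetric]) measurable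
  also have "\<dots> = (\<integral>\<^sup>+t. ?I t * (\<integral>\<^sup>+x. \<integral>\<^sup>+y. g ((1 - t) *\<^sub>R x + t *\<^sub>R y) \<partial>unif_ball \<partial>unif_ball) \<partial>lborel)"
    by (intro nn_integral_cong) (subst nn_integral_cmult, measurable)+
  also have "\<dots> \<le> (\<integral>\<^sup>+t. ?I t * (2 ^ DIM('a) * (\<integral>\<^sup>+y. g y \<partial>unif_ball)) \<partial>lborel)"
    by (intro nn_integral_mono) (auto simp: indicator_def intro!: nn_integral_pair_unif_ball_le)
  also have "\<dots> = 2 ^ DIM('a) * (\<integral>\<^sup>+y. g y \<partial>unif_ball)"
    by (simp add: nn_integral_multc)
  finally show ?thesis by (simp add: g_def mult_left_mono mult.assoc)
qed

text \<open>By Jensen the squared distance of \<open>f x\<close> from the mean is at most its mean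
  squared distance from the other values, to which the Poincare inequality applies.\<close>

lemma variance_unif_ball_le:
  fixes f :: "'a::euclidean_space \<Rightarrow> real" and D :: "'a \<Rightarrow> 'a"
  assumes f: "\<And>a b t. ((\<lambda>t. f (a + t *\<^sub>R b)) has_real_derivative D (a + t *\<^sub>R b) \<bullet> b) (at t)"
    and D: "continuous_on UNIV D" and cf: "continuous_on UNIV f"
  shows "(\<integral>\<^sup>+y. ennreal ((f y - (\<integral>x. f x \<partial>unif_ball))\<^sup>2) \<partial>unif_ball)
    \<le> 4 * 2 ^ DIM('a) * (\<integral>\<^sup>+y. ennreal ((norm (D y))\<^sup>2) \<partial>unif_ball)"
proof -
  have "ennreal ((f x - (\<integral>y. f y \<partial>unif_ball))\<^sup>2) \<le> (\<integral>\<^sup>+y. ennreal ((f y - f x)\<^sup>2) \<partial>unif_ball)" for x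
  proof -
    have c: "continuous_on UNIV (\<lambda>y. f y - f x)" "continuous_on UNIV (\<lambda>y. (f y - f x)\<^sup>2)"
      by (intro continuous_intros cf)+
    have "(f x - (\<integral>y. f y \<partial>unif_ball))\<^sup>2 = (\<integral>y. f y - f x \<partial>unif_ball)\<^sup>2"
      using integrable_unif_ball[OF cf] by (simp add: power2_commute)
    also have "\<dots> \<le> (\<integral>y. (f y - f x)\<^sup>2 \<partial>unif_ball)" by (rule square_integral_le[OF c(1)])
    finally show ?thesis
      using integrable_unif_ball[OF c(2)] by (subst nn_integral_eq_integral) (auto intro: ennreal_leI)
  qed
  then have "(\<integral>\<^sup>+x. ennreal ((f x - (\<integral>y. f y \<partial>unif_ball))\<^sup>2) \<partial>unif_ball)
     \<le> (\<integral>\<^sup>+x. \<integral>\<^sup>+y. ennreal ((f y - f x)\<^sup>2) \<partial>unif_ball \<partial>unif_ball)"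
    by (rule nn_integral_mono)
  also note poincare_unif_ball[OF f D]
  finally show ?thesis .
qed

section \<open>Completeness and the exponent\<close>

text \<open>The quantity \<open>V j y\<close> controls the deviation of \<open>u\<close> from its
  mean on the segment from \<open>2 ^ j *\<^sub>R y\<close> to \<open>2 ^ Suc j *\<^sub>R y\<close>,
  and its expectation is bounded uniformly in large \<open>j\<close>. Summability of the weighted
  expectations makes \<open>V j y = o(j^2)\<close> for almost every \<open>y\<close>, and one such
  \<open>y\<close> serves every \<open>\<delta>\<close>.\<close>

lemma ray_of_slow_deviation:
  fixes u :: "real ^ 'n::finite \<Rightarrow> real"
  assumes u: "smooth u"
    and energy: "\<And>r. S \<le> r \<Longrightarrow> r\<^sup>2 * bmean (\<lambda>x. (norm (gradient u x))\<^sup>2) r \<le> M"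
  obtains y where "y \<noteq> 0" "norm y \<le> 1"
    "\<And>\<delta>. 0 < \<delta> \<Longrightarrow> \<forall>\<^sub>F j in sequentially. \<forall>t\<in>{2 ^ j..2 ^ Suc j}.
        u (t *\<^sub>R y) \<le> bmean u (2 ^ j) + \<delta> * (real j + 1)"
proof -
  define E where "E = bmean (\<lambda>x. (norm (gradient u x))\<^sup>2)"
  define g where "g x = ennreal ((norm (gradient u x))\<^sup>2)" for x
  have cu: "continuous_on UNIV u" by (rule smooth_continuous[OF u])
  have cg: "continuous_on UNIV (gradient u)" by (rule smooth_gradient_continuous[OF u])
  have cg2: "continuous_on UNIV (\<lambda>x. (norm (gradient u x))\<^sup>2)" by (intro continuous_intros cg)
  have [measurable]: "u \<in> borel_measurable borel" by (rule borel_measurable_continuous_onI[OF cu])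
  have [measurable]: "g \<in> borel_measurable borel"
    unfolding g_def by (intro measurable_compose[OF borel_measurable_continuous_onI[OF cg2]]) auto
  have E0: "0 \<le> E r" for r unfolding E_def bmean_def by simp
  have M0: "0 \<le> M"
    using energy[of S] E0[of S] zero_le_power2[of S] by (metis E_def mult_nonneg_nonneg order_refl order_trans)
  have Eg: "(\<integral>\<^sup>+y. g (t *\<^sub>R y) \<partial>unif_ball) = ennreal (E t)" for t
    unfolding g_def E_def bmean_def by (intro nn_integral_eq_integral integrable_bmean[OF cg2]) auto
  \<comment> \<open>The first term measures the deviation at the dyadic radius, the second bounds
    the squared increment of \<open>u\<close> along the ray up to the next dyadic radius.\<close>
  define V where "V j y = ennreal ((u (2 ^ j *\<^sub>R y) - bmean u (2 ^ j))\<^sup>2) +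
     ennreal (2 ^ j) * (\<integral>\<^sup>+t. indicator {2 ^ j..2 ^ Suc j} t * g (t *\<^sub>R y) \<partial>lborel)" for j and y :: "real ^ 'n"
  have Vm [measurable]: "V j \<in> borel_measurable borel" for j
    unfolding V_def by measurable
  obtain k0 :: nat where k0: "S \<le> 2 ^ k0"
    using real_arch_pow[of 2 S] by (auto intro: less_imp_le)
  \<comment> \<open>The first summand comes from the Poincare inequality at
    \<open>r = 2 ^ j\<close>. The second is \<open>r * r * (M / r^2)\<close>: the prefactor of
    \<open>V\<close>, the length of \<open>{r..2 * r}\<close> and the energy bound there.\<close>
  define C where "C = 4 * 2 ^ CARD('n) * M + M"
  have EV: "(\<integral>\<^sup>+y. V j y \<partial>unif_ball) \<le> ennreal C" if "k0 \<le> j" for j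
  proof -
    define r :: real where "r = 2 ^ j"
    have r: "r > 0" "S \<le> r"
      using order_trans[OF k0 power_increasing[OF that, of "2::real"]] by (auto simp: r_def)
    have cur: "continuous_on UNIV (\<lambda>y. u (r *\<^sub>R y))"
      by (intro continuous_on_compose2[OF cu]) (auto intro!: continuous_intros)
    have "(\<integral>\<^sup>+y. ennreal ((u (r *\<^sub>R y) - (\<integral>x. u (r *\<^sub>R x) \<partial>unif_ball))\<^sup>2) \<partial>unif_ball)
       \<le> 4 * 2 ^ DIM(real ^ 'n) * (\<integral>\<^sup>+y. ennreal ((norm (r *\<^sub>R gradient u (r *\<^sub>R y)))\<^sup>2) \<partial>unif_ball)"
    proof (rule variance_unif_ball_le[OF _ _ cur])
      show "((\<lambda>t. u (r *\<^sub>R (a + t *\<^sub>R b))) has_real_derivative r *\<^sub>R gradient u (r *\<^sub>R (a + t *\<^sub>R b)) \<bullet> b) (at t)" for a b t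
        using smooth_line_derivative[OF u, of "r *\<^sub>R a" "r *\<^sub>R b" t] by (simp add: scaleR_add_right mult.commute)
      show "continuous_on UNIV (\<lambda>y. r *\<^sub>R gradient u (r *\<^sub>R y))"
        by (intro continuous_on_scaleR continuous_on_const continuous_on_compose2[OF cg]) (auto intro!: continuous_intros)
    qed
    also have "(\<integral>\<^sup>+y. ennreal ((norm (r *\<^sub>R gradient u (r *\<^sub>R y)))\<^sup>2) \<partial>unif_ball) = (\<integral>\<^sup>+y. ennreal (r\<^sup>2) * g (r *\<^sub>R y) \<partial>unif_ball)"
      by (simp add: g_def power_mult_distrib ennreal_mult)
    also have "\<dots> = ennreal (r\<^sup>2) * ennreal (E r)"
      by (subst nn_integral_cmult) (simp_all add: Eg)
    also have "\<dots> = ennreal (r\<^sup>2 * E r)" by (simp add: ennreal_mult E0)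
    also have "4 * 2 ^ DIM(real ^ 'n) * ennreal (r\<^sup>2 * E r) \<le> 4 * 2 ^ DIM(real ^ 'n) * ennreal M"
      using energy[OF r(2)] by (intro mult_left_mono ennreal_leI) (auto simp: E_def)
    also have "\<dots> = ennreal (4 * 2 ^ CARD('n) * M)"
      using M0 by (simp add: ennreal_mult ennreal_power[symmetric])
    finally have 1: "(\<integral>\<^sup>+y. ennreal ((u (r *\<^sub>R y) - bmean u r)\<^sup>2) \<partial>unif_ball) \<le> ennreal (4 * 2 ^ CARD('n) * M)"
      by (simp add: bmean_def)
    have "(\<integral>\<^sup>+y. ennreal r * (\<integral>\<^sup>+t. indicator {r..2 * r} t * g (t *\<^sub>R y) \<partial>lborel) \<partial>unif_ball)
      = ennreal r * (\<integral>\<^sup>+(y::real^'n). \<integral>\<^sup>+t. indicator {r..2 * r} t * g (t *\<^sub>R y) \<partial>lborel \<partial>unif_ball)"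
      by (rule nn_integral_cmult) measurable
    also have "(\<integral>\<^sup>+(y::real^'n). \<integral>\<^sup>+t. indicator {r..2 * r} t * g (t *\<^sub>R y) \<partial>lborel \<partial>unif_ball)
      = (\<integral>\<^sup>+t. \<integral>\<^sup>+(y::real^'n). indicator {r..2 * r} t * g (t *\<^sub>R y) \<partial>unif_ball \<partial>lborel)"
      by (rule unif_ball_lborel.Fubini'[symmetric]) measurable
    also have "\<dots> \<le> (\<integral>\<^sup>+t. ennreal (M / r\<^sup>2) * indicator {r..2 * r} t \<partial>lborel)"
    proof (rule nn_integral_mono)
      fix t
      have "(\<integral>\<^sup>+(y::real^'n). indicator {r..2 * r} t * g (t *\<^sub>R y) \<partial>unif_ball) = indicator {r..2 * r} t * ennreal (E t)"
        by (subst nn_integral_cmult) (simp_all add: Eg)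
      also have "\<dots> \<le> ennreal (M / r\<^sup>2) * indicator {r..2 * r} t"
      proof (cases "t \<in> {r..2 * r}")
        case True
        have "r\<^sup>2 * E t \<le> t\<^sup>2 * E t" using True r E0 by (intro mult_right_mono power_mono) auto
        also have "\<dots> \<le> M" using energy[of t] True r by (simp add: E_def)
        finally have "E t \<le> M / r\<^sup>2" using r by (simp add: pos_le_divide_eq mult.commute)
        then show ?thesis using True by (simp add: ennreal_leI)
      qed simp
      finally show "(\<integral>\<^sup>+(y::real^'n). indicator {r..2 * r} t * g (t *\<^sub>R y) \<partial>unif_ball) \<le> ennreal (M / r\<^sup>2) * indicator {r..2 * r} t" .
    qed
    also have "\<dots> = ennreal (M / r\<^sup>2) * ennreal r"
      using r by (subst nn_integral_cmult_indicator) auto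
    also have "ennreal r * (ennreal (M / r\<^sup>2) * ennreal r) = ennreal M"
      using r M0 by (simp add: power2_eq_square flip: ennreal_mult)
    finally have 2: "(\<integral>\<^sup>+(y::real^'n). ennreal r * (\<integral>\<^sup>+t. indicator {r..2 * r} t * g (t *\<^sub>R y) \<partial>lborel) \<partial>unif_ball) \<le> ennreal M"
      by (simp add: mult_left_mono)
    have "(\<integral>\<^sup>+y. V j y \<partial>unif_ball) = (\<integral>\<^sup>+y. ennreal ((u (r *\<^sub>R y) - bmean u r)\<^sup>2) \<partial>unif_ball) +
       (\<integral>\<^sup>+(y::real^'n). ennreal r * (\<integral>\<^sup>+t. indicator {r..2 * r} t * g (t *\<^sub>R y) \<partial>lborel) \<partial>unif_ball)"
      unfolding V_def by (subst nn_integral_add) (measurable, simp add: r_def)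
    also have "\<dots> \<le> ennreal (4 * 2 ^ CARD('n) * M) + ennreal M" by (intro add_mono 1 2)
    also have "\<dots> = ennreal C" using M0 by (simp add: C_def ennreal_plus)
    finally show ?thesis .
  qed
  \<comment> \<open>Summable, but with only quadratic decay: that \<open>w k\<close> times
    \<open>V\<close> tends to 0 still forces deviations of order \<open>o(k)\<close>, which is
    \<open>o(ln r)\<close> at dyadic radii.\<close>
  define w :: "nat \<Rightarrow> real" where "w k = 1 / (real (Suc k))\<^sup>2" for k
  have w0: "0 < w k" for k by (simp add: w_def)
  have sw: "summable w"
    unfolding w_def using inverse_power_summable[of 2, where 'a=real]
    by (subst summable_Suc_iff) (simp add: inverse_eq_divide power_one_over[symmetric] power_inverse)
  have "(\<integral>\<^sup>+y. (\<Sum>k. ennreal (w k) * V (k + k0) y) \<partial>unif_ball) = (\<Sum>k. \<integral>\<^sup>+y. ennreal (w k) * V (k + k0) y \<partial>unif_ball)"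
    by (rule nn_integral_suminf) measurable
  also have "\<dots> \<le> (\<Sum>k. ennreal (w k * C))"
  proof (rule suminf_le)
    show "(\<integral>\<^sup>+y. ennreal (w k) * V (k + k0) y \<partial>unif_ball) \<le> ennreal (w k * C)" for k
    proof -
      have "(\<integral>\<^sup>+y. ennreal (w k) * V (k + k0) y \<partial>unif_ball) = ennreal (w k) * (\<integral>\<^sup>+y. V (k + k0) y \<partial>unif_ball)"
        by (rule nn_integral_cmult) measurable
      also have "\<dots> \<le> ennreal (w k) * ennreal C" by (intro mult_left_mono EV) auto
      finally show ?thesis using w0[of k] M0 by (simp add: ennreal_mult C_def)
    qed
  qed auto
  also have "\<dots> < \<infinity>"
  proof -
    have "(\<Sum>k. ennreal (w k * C)) = ennreal (\<Sum>k. w k * C)"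
      using w0 M0 by (intro suminf_ennreal2 summable_mult2 sw) (auto simp: C_def less_imp_le)
    then show ?thesis by simp
  qed
  finally have fin: "(\<integral>\<^sup>+y. (\<Sum>k. ennreal (w k) * V (k + k0) y) \<partial>unif_ball) \<noteq> \<infinity>"
    by simp
  have "AE y in unif_ball. (\<Sum>k. ennreal (w k) * V (k + k0) y) \<noteq> \<infinity>"
    by (rule nn_integral_PInf_AE[OF _ fin]) measurable
  moreover have "AE y in unif_ball. y \<noteq> (0 :: real ^ 'n)"
    unfolding unif_ball_def using AE_lborel_singleton[of "0 :: real ^ 'n"]
    by (subst AE_density) auto
  ultimately have "AE y in unif_ball. (\<Sum>k. ennreal (w k) * V (k + k0) y) \<noteq> \<infinity> \<and> y \<noteq> 0 \<and> norm y \<le> 1"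
    using AE_unif_ball by eventually_elim auto
  then obtain y where y: "(\<Sum>k. ennreal (w k) * V (k + k0) y) \<noteq> \<infinity>" "y \<noteq> 0" "norm y \<le> 1"
    using eventually_happens'[OF unif_ball.ae_filter_bot] by blast
  \<comment> \<open>\<open>enn2real\<close> would send infinity to 0; finiteness of the sum at
    \<open>y\<close> excludes that value.\<close>
  define f where "f k = enn2real (ennreal (w k) * V (k + k0) y)" for k
  have f: "ennreal (f k) = ennreal (w k) * V (k + k0) y" for k
  proof -
    have "ennreal (w k) * V (k + k0) y \<le> (\<Sum>k. ennreal (w k) * V (k + k0) y)"
      using sum_le_suminf[of "\<lambda>k. ennreal (w k) * V (k + k0) y" "{k}"] by simp
    also have "\<dots> < \<infinity>" using y(1) by (simp add: less_top)
    finally show ?thesis by (simp add: f_def)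
  qed
  have "summable f"
    by (rule summable_suminf_not_top) (use y(1) in \<open>simp_all add: f, simp add: f_def\<close>)
  then have flim: "f \<longlonglongrightarrow> 0" by (rule summable_LIMSEQ_zero)
  have V_f: "V (k + k0) y = ennreal ((real (Suc k))\<^sup>2 * f k)" for k
  proof -
    have "ennreal ((real (Suc k))\<^sup>2 * f k) = ennreal ((real (Suc k))\<^sup>2) * (ennreal (w k) * V (k + k0) y)"
      unfolding f[symmetric] by (rule ennreal_mult) (auto simp: f_def)
    also have "\<dots> = ennreal ((real (Suc k))\<^sup>2 * w k) * V (k + k0) y"
      using w0[of k] by (simp add: ennreal_mult mult.assoc)
    also have "(real (Suc k))\<^sup>2 * w k = 1" by (simp add: w_def)
    finally show ?thesis by simp
  qed
  show thesis
  proof (rule that[OF y(2,3)])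
    fix \<delta> :: real assume "\<delta> > 0"
    \<comment> \<open>The threshold cancels the factor 2 in
      \<open>(a + b)^2 \<le> 2 * (a^2 + b^2)\<close>, where \<open>a\<close> is the deviation at the
      dyadic radius and \<open>b\<close> the increment along the ray.\<close>
    have "\<forall>\<^sub>F k in sequentially. f k < \<delta>\<^sup>2 / 2"
      using \<open>\<delta> > 0\<close> by (intro order_tendstoD(2)[OF flim]) auto
    then have "\<forall>\<^sub>F k in sequentially. \<forall>t\<in>{2 ^ (k + k0)..2 ^ Suc (k + k0)}.
        u (t *\<^sub>R y) \<le> bmean u (2 ^ (k + k0)) + \<delta> * (real (k + k0) + 1)"
    proof eventually_elim
      case (elim k)
      show ?case
      proof
        fix t :: real assume t: "t \<in> {2 ^ (k + k0)..2 ^ Suc (k + k0)}"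
        define r :: real where "r = 2 ^ (k + k0)"
        have r: "r > 0" "r \<le> t" "t \<le> 2 * r" using t by (auto simp: r_def)
        define a b where "a = u (r *\<^sub>R y) - bmean u r" and "b = u (t *\<^sub>R y) - u (r *\<^sub>R y)"
        have line: "((\<lambda>s. u (s *\<^sub>R y)) has_real_derivative gradient u (s *\<^sub>R y) \<bullet> y) (at s)" for s
          using smooth_line_derivative[OF u, of 0 y s] by simp
        have "ennreal (b\<^sup>2) \<le> ennreal (t - r) * (\<integral>\<^sup>+s. indicator {r..t} s * ennreal ((gradient u (s *\<^sub>R y) \<bullet> y)\<^sup>2) \<partial>lborel)"
          unfolding b_def by (rule square_increment_le[OF line _ r(2)])
            (auto intro!: continuous_intros continuous_on_compose2[OF cg])
        also have "\<dots> \<le> ennreal r * (\<integral>\<^sup>+s. indicator {r..2 * r} s * g (s *\<^sub>R y) \<partial>lborel)"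
        proof (intro mult_mono ennreal_leI nn_integral_mono)
          fix s
          have "\<bar>gradient u (s *\<^sub>R y) \<bullet> y\<bar> \<le> norm (gradient u (s *\<^sub>R y)) * norm y"
            by (rule Cauchy_Schwarz_ineq2)
          also have "\<dots> \<le> norm (gradient u (s *\<^sub>R y))" using y(3) by (simp add: mult_left_le)
          finally have "(gradient u (s *\<^sub>R y) \<bullet> y)\<^sup>2 \<le> (norm (gradient u (s *\<^sub>R y)))\<^sup>2"
            by (metis abs_ge_zero power_mono power2_abs)
          then show "ennreal ((gradient u (s *\<^sub>R y) \<bullet> y)\<^sup>2) \<le> g (s *\<^sub>R y)" 
            by (simp add: g_def ennreal_leI)
          show "indicator {r..t} s \<le> (indicator {r..2 * r} s :: ennreal)"
            using r by (auto simp: indicator_def)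
        qed (use r in auto)
        finally have "ennreal (a\<^sup>2) + ennreal (b\<^sup>2) \<le> V (k + k0) y"
          unfolding V_def a_def r_def by (simp add: add_left_mono)
        then have "ennreal (a\<^sup>2 + b\<^sup>2) \<le> ennreal ((real (Suc k))\<^sup>2 * f k)"
          unfolding V_f by (simp add: ennreal_plus)
        then have "a\<^sup>2 + b\<^sup>2 \<le> (real (Suc k))\<^sup>2 * f k"
          by (subst (asm) ennreal_le_iff) (auto simp: f_def)
        also have "\<dots> \<le> (real (Suc k))\<^sup>2 * (\<delta>\<^sup>2 / 2)"
          using elim by (intro mult_left_mono) auto
        finally have ab: "a\<^sup>2 + b\<^sup>2 \<le> (real (Suc k))\<^sup>2 * (\<delta>\<^sup>2 / 2)" .
        have "(a + b)\<^sup>2 \<le> 2 * (a\<^sup>2 + b\<^sup>2)"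
          using zero_le_power2[of "a - b"] by (simp add: power2_sum power2_diff)
        also have "\<dots> \<le> 2 * ((real (Suc k))\<^sup>2 * (\<delta>\<^sup>2 / 2))"
          by (rule mult_left_mono[OF ab]) simp
        also have "\<dots> = (\<delta> * real (Suc k))\<^sup>2"
          unfolding power_mult_distrib by simp
        finally have "(a + b)\<^sup>2 \<le> (\<delta> * real (Suc k))\<^sup>2" .
        then have "a + b \<le> \<delta> * real (Suc k)"
          by (rule power2_le_imp_le) (use \<open>\<delta> > 0\<close> in simp)
        also have "\<dots> \<le> \<delta> * (real (k + k0) + 1)"
          using \<open>\<delta> > 0\<close> by (intro mult_left_mono) auto
        finally show "u (t *\<^sub>R y) \<le> bmean u (2 ^ (k + k0)) + \<delta> * (real (k + k0) + 1)"
          by (simp add: a_def b_def r_def)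
      qed
    qed
    then show "\<forall>\<^sub>F j in sequentially. \<forall>t\<in>{2 ^ j..2 ^ Suc j}. u (t *\<^sub>R y) \<le> bmean u (2 ^ j) + \<delta> * (real j + 1)"
      by (rule eventually_sequentially_seg[of "\<lambda>j. \<forall>t\<in>{2 ^ j..2 ^ Suc j}. u (t *\<^sub>R y) \<le> bmean u (2 ^ j) + \<delta> * (real j + 1)" k0, THEN iffD1])
  qed
qed

text \<open>For \<open>\<alpha> > 1\<close> the factor \<open>exp u\<close> decays along the chosen
  ray faster than \<open>1 / r\<close> by a power, so consecutive dyadic points on it are at
  geometrically decreasing conformal distance while escaping to infinity.\<close>

lemma complete_exponent_le_1:
  fixes u :: "real ^ 'n::finite \<Rightarrow> real"
  assumes u: "smooth u" and "conf_complete u"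
    and energy: "\<And>r. S \<le> r \<Longrightarrow> r\<^sup>2 * bmean (\<lambda>x. (norm (gradient u x))\<^sup>2) r \<le> M"
    and \<alpha>: "((\<lambda>r. bmean u r / ln r) \<longlongrightarrow> - \<alpha>) at_top"
  shows "\<alpha> \<le> 1"
proof (rule ccontr)
  assume "\<not> \<alpha> \<le> 1"
  \<comment> \<open>Of the excess \<open>3 * \<eta>\<close>, one share is lost in the limit of
    \<open>bmean u r / ln r\<close> and one in the deviation along the ray;
    \<open>u \<le> - (1 + \<eta>) * ln (2 ^ j)\<close> remains.\<close>
  define \<eta> where "\<eta> = (\<alpha> - 1) / 3"
  have \<eta>: "\<eta> > 0" "\<alpha> = 1 + 3 * \<eta>" using \<open>\<not> \<alpha> \<le> 1\<close> by (simp_all add: \<eta>_def field_simps)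
  have cu: "continuous_on UNIV u" by (rule smooth_continuous[OF u])
  obtain y where y: "y \<noteq> 0" "norm y \<le> 1"
    and dev: "\<And>\<delta>. 0 < \<delta> \<Longrightarrow> \<forall>\<^sub>F j in sequentially. \<forall>t\<in>{2 ^ j..2 ^ Suc j}.
        u (t *\<^sub>R y) \<le> bmean u (2 ^ j) + \<delta> * (real j + 1)"
    using ray_of_slow_deviation[OF u energy] by blast
  have pow: "filterlim (\<lambda>j. (2::real) ^ j) at_top sequentially"
    by (rule filterlim_at_infinity_imp_filterlim_at_top[OF filterlim_realpow_sequentially_gt1]) auto
  have "((\<lambda>j. bmean u (2 ^ j) / ln (2 ^ j)) \<longlonglongrightarrow> - \<alpha>)"
    by (rule filterlim_compose[OF \<alpha> pow])
  then have "\<forall>\<^sub>F j in sequentially. bmean u (2 ^ j) / ln (2 ^ j) < - \<alpha> + \<eta>"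
    using \<eta> by (intro order_tendstoD(2)) auto
  \<comment> \<open>The \<open>\<delta>\<close> for the ray: since \<open>j + 1 \<le> 2 * j\<close>
    for \<open>j \<ge> 1\<close>, the deviation is at most
    \<open>\<eta> * ln (2 ^ j)\<close>.\<close>
  moreover have "0 < \<eta> * ln 2 / 2" using \<eta> by simp
  note dev[OF this]
  ultimately have "\<forall>\<^sub>F j in sequentially. conf_dist u (2 ^ j *\<^sub>R y) (2 ^ Suc j *\<^sub>R y) \<le> (2 powr (- \<eta>)) ^ j"
    using eventually_ge_at_top[of 1]
  proof eventually_elim
    case (elim j)
    have l2: "ln (2 ^ j :: real) = real j * ln 2" by (simp add: ln_realpow)
    have "bmean u (2 ^ j) \<le> (- \<alpha> + \<eta>) * (real j * ln 2)"
      using elim l2 by (simp add: divide_less_eq less_imp_le)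
    moreover have "\<eta> * ln 2 / 2 * (real j + 1) \<le> \<eta> * (real j * ln 2)"
    proof -
      have "\<eta> * ln 2 / 2 * (real j + 1) \<le> \<eta> * ln 2 / 2 * (2 * real j)"
        using elim \<eta> by (intro mult_left_mono) auto
      then show ?thesis by (simp add: mult_ac)
    qed
    ultimately have bnd: "u (t *\<^sub>R y) \<le> - (1 + \<eta>) * (real j * ln 2)" if "2 ^ j \<le> t" "t \<le> 2 ^ Suc j" for t
    proof -
      have "u (t *\<^sub>R y) \<le> bmean u (2 ^ j) + \<eta> * ln 2 / 2 * (real j + 1)" using elim that by auto
      also have "\<dots> \<le> (- \<alpha> + \<eta>) * (real j * ln 2) + \<eta> * (real j * ln 2)"
        by (intro add_mono) fact+
      also have "\<dots> = - (1 + \<eta>) * (real j * ln 2)" by (simp add: \<eta>(2) algebra_simps)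
      finally show ?thesis .
    qed
    have "conf_dist u (2 ^ j *\<^sub>R y) (2 ^ Suc j *\<^sub>R y) \<le> exp (- (1 + \<eta>) * (real j * ln 2)) * norm (2 ^ Suc j *\<^sub>R y - 2 ^ j *\<^sub>R y)"
    proof (rule conf_dist_linepath_le[OF cu])
      fix t :: real assume t: "0 \<le> t" "t \<le> 1"
      have "linepath (2 ^ j *\<^sub>R y) (2 ^ Suc j *\<^sub>R y) t = (2 ^ j * (1 + t)) *\<^sub>R y"
        by (simp add: linepath_def algebra_simps flip: scaleR_add_left)
      then show "u (linepath (2 ^ j *\<^sub>R y) (2 ^ Suc j *\<^sub>R y) t) \<le> - (1 + \<eta>) * (real j * ln 2)"
        using bnd[of "2 ^ j * (1 + t)"] t by simp
    qed
    also have "2 ^ Suc j *\<^sub>R y - 2 ^ j *\<^sub>R y = 2 ^ j *\<^sub>R y"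
      by (simp flip: scaleR_diff_left)
    also have "exp (- (1 + \<eta>) * (real j * ln 2)) * norm (2 ^ j *\<^sub>R y) \<le> exp (- (1 + \<eta>) * (real j * ln 2)) * 2 ^ j"
      using y(2) by (intro mult_left_mono) auto
    also have "exp (- (1 + \<eta>) * (real j * ln 2)) * 2 ^ j = exp (real j * (- \<eta> * ln 2))"
    proof -
      have "(2::real) ^ j = exp (real j * ln 2)" by (simp add: exp_of_nat_mult)
      then show ?thesis by (simp add: algebra_simps flip: exp_add)
    qed
    also have "\<dots> = (2 powr (- \<eta>)) ^ j"
      unfolding exp_of_nat_mult by (simp add: powr_def)
    finally show ?case .
  qed
  then obtain N where N: "\<And>j. N \<le> j \<Longrightarrow> conf_dist u (2 ^ j *\<^sub>R y) (2 ^ Suc j *\<^sub>R y) \<le> (2 powr (- \<eta>)) ^ j"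
    by (auto simp: eventually_sequentially)
  show False
  proof (rule conf_complete_no_short_escape[OF cu \<open>conf_complete u\<close> _ _ N])
    show "2 powr (- \<eta>) < 1" using \<eta> by (simp add: powr_less_one)
    have "filterlim (\<lambda>j. norm y * 2 ^ j) at_top sequentially"
      using y(1) by (intro filterlim_tendsto_pos_mult_at_top[OF tendsto_const _ pow]) auto
    then show "filterlim (\<lambda>j. norm (2 ^ j *\<^sub>R y)) at_top sequentially"
      by (simp add: mult.commute)
  qed auto
qed

section \<open>The bounds on the total Q-curvature\<close>

theorem theorem1p2:
  fixes u :: "real ^ 'n::finite \<Rightarrow> real"
  assumes "CARD('n) \<ge> 4" and "even CARD('n)"
    and "smooth u"
    and "conf_complete u"
    and "finite_total_Q u"
  shows
    "(near_infinity (\<lambda>x. scalar_curvature u x \<ge> 0) \<longrightarrow>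
        0 \<le> total_Q u \<and> total_Q u \<le> fact (CARD('n) - 1) * sphere_volume TYPE('n) / 2) \<and>
     (\<forall>C p. C > 0 \<and> p \<ge> 0 \<and>
          near_infinity (\<lambda>x. scalar_curvature u x \<ge> C * norm x powr (- p)) \<longrightarrow>
        fact (CARD('n) - 1) * sphere_volume TYPE('n) / 2 * max 0 (1 - p / 2) \<le> total_Q u \<and>
        total_Q u \<le> fact (CARD('n) - 1) * sphere_volume TYPE('n) / 2) \<and>
     (\<forall>C. C > 0 \<and> near_infinity (\<lambda>x. scalar_curvature u x \<ge> C) \<longrightarrow>
        total_Q u = fact (CARD('n) - 1) * sphere_volume TYPE('n) / 2)"
proof -
  define \<gamma> where "\<gamma> = fact (CARD('n) - 1) * sphere_volume TYPE('n) / 2"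
  have \<gamma>: "\<gamma> \<ge> 0" by (simp add: \<gamma>_def sphere_volume_def surface_measure_def)
  \<comment> \<open>One \<open>\<alpha>\<close> depending only on \<open>u\<close> carries all the
    bounds; the lower bound on it is kept for arbitrary \<open>C\<close> and \<open>p\<close>, so
    that each curvature hypothesis can be inserted afterwards.\<close>
  have general: "\<exists>\<alpha>. 0 \<le> \<alpha> \<and> \<alpha> \<le> 1 \<and> total_Q u = \<alpha> * \<gamma> \<and> 
      (\<forall>C p. C > 0 \<longrightarrow> p \<ge> 0 \<longrightarrow> (\<forall>x. R < norm x \<longrightarrow> scalar_curvature u x \<ge> C * norm x powr (- p)) \<longrightarrow> 2 \<le> p + 2 * \<alpha>)"
    if R: "R > 0" "\<And>x. R < norm x \<Longrightarrow> scalar_curvature u x \<ge> 0" for R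
  proof -
    have far: "(real CARD('n) - 2) / 2 * (norm (gradient u x))\<^sup>2 \<le> - laplacian u x" if "R < norm x" for x
      using scalar_curvature_lower_bound[of 0 u x] R(2)[OF that] assms(1) by simp
    obtain \<alpha> M S where \<alpha>: "0 \<le> \<alpha>" "total_Q u = \<alpha> * (fact (CARD('n) - 1) * sphere_volume TYPE('n) / 2)"
      "((\<lambda>r. r\<^sup>2 * bmean (\<lambda>x. - laplacian u x) r) \<longlongrightarrow> real CARD('n) * \<alpha>) at_top"
      "((\<lambda>r. bmean u r / ln r) \<longlongrightarrow> - \<alpha>) at_top"
      "\<And>r. S \<le> r \<Longrightarrow> r\<^sup>2 * bmean (\<lambda>x. (norm (gradient u x))\<^sup>2) r \<le> M"
      by (rule radial_asymptotics[OF assms(1,2,3,5) R(1) far]) (assumption, rule that)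
    have "\<alpha> \<le> 1" by (rule complete_exponent_le_1[OF assms(3,4) \<alpha>(5,4)])
    moreover have "2 \<le> p + 2 * \<alpha>"
      if Cp: "C > 0" "p \<ge> 0" "\<And>x. R < norm x \<Longrightarrow> scalar_curvature u x \<ge> C * norm x powr (- p)" for C p
    proof (rule decay_exponent_lower_bound[OF _ assms(3) R(1) _ \<open>p \<ge> 0\<close> _ \<alpha>(3,4)])
      show "0 < C / (2 * (real CARD('n) - 1))" using Cp assms(1) by simp
      fix x :: "real ^ 'n" assume x: "R < norm x"
      have "C * norm x powr (- p) / (2 * (real CARD('n) - 1)) * exp (2 * u x)
        \<le> - laplacian u x - (real CARD('n) - 2) / 2 * (norm (gradient u x))\<^sup>2"
        using assms(1) Cp(3)[OF x] by (intro scalar_curvature_lower_bound) auto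
      moreover have "0 \<le> (real CARD('n) - 2) / 2 * (norm (gradient u x))\<^sup>2" using assms(1) by simp
      ultimately show "C / (2 * (real CARD('n) - 1)) * norm x powr (- p) * exp (2 * u x) \<le> - laplacian u x" by simp
    qed (use assms(1) in simp)
    ultimately show ?thesis
      using \<alpha>(1,2) unfolding \<gamma>_def by (intro exI[of _ \<alpha>] conjI allI impI) simp_all
  qed
  have upper: "0 \<le> total_Q u \<and> total_Q u \<le> \<gamma>" if ni: "near_infinity (\<lambda>x. scalar_curvature u x \<ge> 0)"
  proof -
    obtain R where "R > 0" "\<And>x. R < norm x \<Longrightarrow> scalar_curvature u x \<ge> 0" using near_infinity_norm[OF ni] by blast
    from general[OF this] obtain \<alpha> where \<alpha>: "0 \<le> \<alpha>" "\<alpha> \<le> 1" "total_Q u = \<alpha> * \<gamma>" by blast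
    then show ?thesis using \<gamma> mult_right_mono[of \<alpha> 1 \<gamma>] by simp
  qed
  have power: "\<gamma> * max 0 (1 - p / 2) \<le> total_Q u \<and> total_Q u \<le> \<gamma>"
    if "C > 0" "p \<ge> 0" and ni: "near_infinity (\<lambda>x. scalar_curvature u x \<ge> C * norm x powr (- p))" for C p
  proof -
    obtain R where R: "R > 0" "\<And>x. R < norm x \<Longrightarrow> scalar_curvature u x \<ge> C * norm x powr (- p)"
      using near_infinity_norm[OF ni] by blast
    have "scalar_curvature u x \<ge> 0" if "R < norm x" for x
    proof (rule order_trans)
      show "0 \<le> C * norm x powr (- p)" using \<open>C > 0\<close> by simp
    qed (rule R(2)[OF that])
    from general[OF R(1) this] obtain \<alpha> where \<alpha>: "0 \<le> \<alpha>" "\<alpha> \<le> 1" "total_Q u = \<alpha> * \<gamma>" "2 \<le> p + 2 * \<alpha>"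
      using \<open>C > 0\<close> \<open>p \<ge> 0\<close> R(2) by metis
    have "\<gamma> * max 0 (1 - p / 2) \<le> \<gamma> * \<alpha>" using \<gamma> \<alpha> by (intro mult_left_mono) auto
    moreover have "\<alpha> * \<gamma> \<le> 1 * \<gamma>" using \<gamma> \<alpha> by (intro mult_right_mono)
    ultimately show ?thesis using \<alpha>(3) by (simp add: mult.commute)
  qed
  have const: "total_Q u = \<gamma>" if "C > 0" and ni: "near_infinity (\<lambda>x. scalar_curvature u x \<ge> C)" for C
  proof -
    obtain R where R: "R > 0" "\<And>x. R < norm x \<Longrightarrow> scalar_curvature u x \<ge> C"
      using near_infinity_norm[OF ni] by blast
    \<comment> \<open>The case \<open>p = 0\<close>, where both bounds of \<open>power\<close>
      coincide. As \<open>0 powr 0 = 0\<close>, the factor is 1 only away from the origin, which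
      \<open>R > 0\<close> guarantees.\<close>
    have "scalar_curvature u x \<ge> C * norm x powr (- 0)" if "R < norm x" for x
      using R(2)[OF that] R(1) that by auto
    then have "near_infinity (\<lambda>x. scalar_curvature u x \<ge> C * norm x powr (- 0))"
      unfolding near_infinity_def by (intro exI[of _ "cball 0 R"]) auto
    from power[OF \<open>C > 0\<close> _ this] show ?thesis by simp
  qed
  show ?thesis
    unfolding \<gamma>_def[symmetric] by (intro conjI impI allI) (use upper power const in blast)+
qed

end
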